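(* Let $n\ge2$ and $k_1,k_2,k_3\in[n-1]$. (1) The geometric $R$-matrix $R:\mathbb X_{k_1}\times\mathbb X_{k_2}\to\mathbb X_{k_2}\times\mathbb X_{k_1}$ is an isomorphism of geometric crystals. (2) $R:\mathbb X_{k_1}\times\mathbb X_{k_2}\to\mathbb X_{k_2}\times\mathbb X_{k_1}$ commutes with the symmetries $\mathrm{PR}$, $S$ and $D$; that is, $R\circ\mathrm{PR}=\mathrm{PR}\circ R$, $R\circ S=S\circ R$ and $R\circ D=D\circ R$ as rational maps on $\mathbb X_{k_1}\times\mathbb X_{k_2}$. (3) $R$ satisfies the Yang--Baxter relation: we have the equality $R_1R_2R_1=R_2R_1R_2$ of rational maps $\mathbb X_{k_1}\times\mathbb X_{k_2}\times\mathbb X_{k_3}\to\mathbb X_{k_3}\times\mathbb X_{k_2}\times\mathbb X_{k_1}$.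
   Context: Notation. Fix $n\ge2$; $[m]=\{1,\dots,m\}$, $[i,j]=\{m\in\mathbb Z: i\le m\le j\}$. For $k\in[n-1]$, $\mathbb X_k=\mathrm{Gr}(k,n)\times\mathbb C^\times$, with points written $N|t$. A subspace $N\in\mathrm{Gr}(k,n)$ is the column span of a full-rank $n\times k$ matrix, and $P_J(N)$ is the maximal minor of that matrix with row set $J$ (rows in increasing order), defined up to a common nonzero scalar. Index sets of integers are reduced modulo $n$ to subsets of $[n]$, and $P_I:=0$ if the reduced set does not have exactly $k$ elements. The map $g$. $\lambda$ is an indeterminate. $g(N|t)$ is the $n\times n$ matrix with entries $g(N|t)_{ij}=c_{ij}\,P_{[j-k+1,j-1]\cup\{i\}}(N)/P_{[j-k,j-1]}(N)$, where $c_{ij}=1$ if $j\le k$; $c_{ij}=t$ if $j>k$ and $i\ge j$; $c_{ij}=\lambda$ if $j>k$ and $i<j$. On products, $g(x_1,\dots,x_d)=g(x_1)\cdots g(x_d)$. The geometric $R$-matrix. For $z\in\mathbb C^\times$ and an $n\times n$ matrix $A$ over $\mathbb C[\lambda,\lambda^{-1}]$, $\pi^k_z(A)=N|z$ where $N$ is the span of the first $k$ columns of $A|_{\lambda=(-1)^{k-1}z}$ (defined when these columns are linearly independent). Let $\mathrm{fl}(A)_{ij}=A_{n-j+1,n-i+1}$. Define $S:\mathbb X_k\to\mathbb X_k$ by $S(N|t)=\pi^k_t(\mathrm{fl}(g(N|t)))$. Define $\Psi_{k,\ell}:\mathbb X_\ell\times\mathbb X_k\to\mathbb X_k$ by $\Psi_{k,\ell}(M|s,N|t)=\pi^k_t(g(M|s)g(N|t))$.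 The geometric $R$-matrix is the rational map $R=(\Psi_{k,\ell},\ S\circ\Psi_{\ell,k}\circ S):\mathbb X_\ell\times\mathbb X_k\to\mathbb X_k\times\mathbb X_\ell$, where on products $S(x_1,\dots,x_d)=(S(x_d),\dots,S(x_1))$. On a product $\mathbb X_{a}\times\mathbb X_b\times\mathbb X_c$, $R_1$ applies $R$ to the first two factors and $R_2$ applies $R$ to the last two factors (identity on the remaining factor). Symmetries. $\mathrm{PR}:\mathbb X_k\to\mathbb X_k$, $\mathrm{PR}(N|t)=N'|t$, where $N'$ is obtained from (a matrix representing) $N$ by shifting the rows down by 1 cyclically (the last row becomes the first) and multiplying the new first row by $(-1)^{k-1}t$; $\mathrm{PR}$ acts on products componentwise. $S:\mathbb X_{k_1}\times\cdots\times\mathbb X_{k_d}\to\mathbb X_{k_d}\times\cdots\times\mathbb X_{k_1}$ is given by $S(x_1,\dots,x_d)=(S(x_d),\dots,S(x_1))$, where on a single factor $\mathbb X_k$ one has $S(N|t)=\pi^k_t(\mathrm{fl}(g(N|t)))$ (it reverses the order of the factors). Let $\mu:\mathbb X_k\to\mathbb X_{n-k}$, $\mu(N|t)=T_{w_0}(N^\perp)|t$, where $N^\perp$ is the orthogonal complement with respect to the bilinear form $\langle v_i,v_j\rangle=(-1)^{i+1}\delta_{ij}$ on the standard basis $v_1,\dots,v_n$ and $T_{w_0}$ is induced by reversing the standard basis; $\mu$ acts on products componentwise. Then $D=S\circ\mu:\mathbb X_{k_1}\times\cdots\times\mathbb X_{k_d}\to\mathbb X_{n-k_d}\times\cdots\times\mathbb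 X_{n-k_1}$. Geometric crystal structure on $\mathbb X_k$. It consists of the following rational maps, for $i\in\mathbb Z/n\mathbb Z$ represented by $i\in\{0,\dots,n-1\}$: $\gamma(N|t)=(\gamma_1,\dots,\gamma_n)$ with $\gamma_i=P_{[i-k+1,i]}(N)/P_{[i-k,i-1]}(N)$ for $1\le i\le k$ and $\gamma_i=t\,P_{[i-k+1,i]}(N)/P_{[i-k,i-1]}(N)$ for $k+1\le i\le n$; $\varphi_i(N|t)=t^{-\delta_{i,0}}P_{[i-k+1,i-1]\cup\{i+1\}}(N)/P_{[i-k+1,i]}(N)$; $\varepsilon_i(N|t)=t^{-\delta_{i,k}}\dfrac{P_{[i-k+1,i-1]\cup\{i+1\}}(N)P_{[i-k+1,i]}(N)}{P_{[i-k,i-1]}(N)P_{[i-k+2,i+1]}(N)}$; $e_i:\mathbb C^\times\times\mathbb X_k\to\mathbb X_k$, $e_i^c(N|t)=N'|t$ with $N'=x_i\big(\tfrac{c-1}{\varphi_i(N|t)}\big)\cdot N$ if $i\ne0$ and $N'=x_0\big(\tfrac{(-1)^{k-1}}{t}\tfrac{c-1}{\varphi_0(N|t)}\big)\cdot N$ if $i=0$, where $x_i(a)=Id+aE_{i,i+1}$ for $i\in[n-1]$ and $x_0(a)=Id+aE_{n1}$. Geometric crystal structure on a product $X\times Y$: $\gamma(x,y)=\gamma(x)\gamma(y)$ (componentwise product), $\varphi_i(x,y)=\frac{\varphi_i(x)(\varepsilon_i(x)+\varphi_i(y))}{\varepsilon_i(x)}$, $\varepsilon_i(x,y)=\frac{\varepsilon_i(y)(\varepsilon_i(x)+\varphi_i(y))}{\varphi_i(y)}$,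 $e_i^c(x,y)=(e_i^{c_1}(x),e_i^{c_2}(y))$ with $c_1=\frac{c\varepsilon_i(x)+\varphi_i(y)}{\varepsilon_i(x)+\varphi_i(y)}$, $c_2=\frac{\varepsilon_i(x)+\varphi_i(y)}{\varepsilon_i(x)+c^{-1}\varphi_i(y)}$. These make $\mathbb X_{k_1}\times\mathbb X_{k_2}$ a geometric crystal of type $A^{(1)}_{n-1}$. A morphism of geometric crystals is a rational map $h$ with $e_i^ch=he_i^c$ and $\rho h=\rho$ for $\rho=\gamma,\varphi_i,\varepsilon_i$, for all $i\in\mathbb Z/n\mathbb Z$; an isomorphism is a morphism with an inverse (as a rational map) which is also a morphism. *)

theory Defs
  imports
    "HOL-Analysis.Abstract_Topology"
    "HOL-Library.Monad_Syntax"
    "HOL-Computational_Algebra.Polynomial"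
    "Jordan_Normal_Form.DL_Rank"
    "Jordan_Normal_Form.DL_Submatrix"
begin

section \<open>Varieties and rational maps\<close>

text \<open>
  The varieties needed here are presented as geometric quotients: a set of ``frames'' which is a
  nonempty Zariski-open subset of an affine space, the coordinate functions of that affine space,
  and the projection from frames to points. For the Grassmannian, the frames of a point are the
  full-rank matrices with that column span. As frames of a product are pairs of frames, all these
  varieties are irreducible, so that ``nonempty open'' is the same as ``open and dense''.
\<close>

record ('a, 'p) variety =
  frames :: "'a set"
  coords :: "('a \<Rightarrow> complex) set"
  proj :: "'a \<Rightarrow> 'p"

definition points :: "('a, 'p) variety \<Rightarrow> 'p set" where
  "points V = proj V ` frames V"

definition prod_variety :: "('a, 'p) variety \<Rightarrow> ('b, 'q) variety \<Rightarrow> ('a \<times> 'b, 'p \<times> 'q) variety"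
    (infixr "\<times>\<^sub>V" 80) where
  "V \<times>\<^sub>V W =
    \<lparr> frames = frames V \<times> frames W,
      coords = (\<lambda>c. c \<circ> fst) ` coords V \<union> (\<lambda>c. c \<circ> snd) ` coords W,
      proj = map_prod (proj V) (proj W) \<rparr>"

inductive_set poly_funs :: "('a \<Rightarrow> complex) set \<Rightarrow> ('a \<Rightarrow> complex) set"
  for C :: "('a \<Rightarrow> complex) set" where
  const: "(\<lambda>_. z) \<in> poly_funs C"
| coord: "c \<in> C \<Longrightarrow> c \<in> poly_funs C"
| add: "p \<in> poly_funs C \<Longrightarrow> q \<in> poly_funs C \<Longrightarrow> (\<lambda>a. p a + q a) \<in> poly_funs C"
| mult: "p \<in> poly_funs C \<Longrightarrow> q \<in> poly_funs C \<Longrightarrow> (\<lambda>a. p a * q a) \<in> poly_funs C"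

text \<open>The quotient of the Zariski topology on the frames.\<close>

definition zariski_open :: "('a, 'p) variety \<Rightarrow> 'p set \<Rightarrow> bool" where
  "zariski_open V U \<longleftrightarrow> U \<subseteq> points V \<and>
    (\<forall>a\<in>frames V. proj V a \<in> U \<longrightarrow>
      (\<exists>q\<in>poly_funs (coords V). q a \<noteq> 0 \<and> (\<forall>b\<in>frames V. q b \<noteq> 0 \<longrightarrow> proj V b \<in> U)))"

definition zariski :: "('a, 'p) variety \<Rightarrow> 'p topology" where
  "zariski V = topology (zariski_open V)"

lemma istopology_zariski_open: "istopology (zariski_open V)"
  unfolding istopology_def
proof (intro conjI allI impI)
  fix S T assume S: "zariski_open V S" and T: "zariski_open V T"
  show "zariski_open V (S \<inter> T)"
    unfolding zariski_open_def
  proof (intro conjI ballI impI)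
    show "S \<inter> T \<subseteq> points V" using S by (auto simp: zariski_open_def)
  next
    fix a assume a: "a \<in> frames V" "proj V a \<in> S \<inter> T"
    obtain p where p: "p \<in> poly_funs (coords V)" "p a \<noteq> 0"
        "\<forall>b\<in>frames V. p b \<noteq> 0 \<longrightarrow> proj V b \<in> S"
      using S a unfolding zariski_open_def by blast
    obtain q where q: "q \<in> poly_funs (coords V)" "q a \<noteq> 0"
        "\<forall>b\<in>frames V. q b \<noteq> 0 \<longrightarrow> proj V b \<in> T"
      using T a unfolding zariski_open_def by blast
    show "\<exists>q\<in>poly_funs (coords V). q a \<noteq> 0 \<and> (\<forall>b\<in>frames V. q b \<noteq> 0 \<longrightarrow> proj V b \<in> S \<inter> T)"
      using p q by (intro bexI[of _ "\<lambda>b. p b * q b"]) (auto intro: poly_funs.mult)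
  qed
next
  fix K assume K: "\<forall>S\<in>K. zariski_open V S"
  show "zariski_open V (\<Union>K)"
    unfolding zariski_open_def
  proof (intro conjI ballI impI)
    show "\<Union>K \<subseteq> points V" using K by (auto simp: zariski_open_def)
  next
    fix a assume a: "a \<in> frames V" "proj V a \<in> \<Union>K"
    then obtain S where S: "S \<in> K" "proj V a \<in> S" by blast
    then obtain q where "q \<in> poly_funs (coords V)" "q a \<noteq> 0"
        "\<forall>b\<in>frames V. q b \<noteq> 0 \<longrightarrow> proj V b \<in> S"
      using K a unfolding zariski_open_def by blast
    with S show "\<exists>q\<in>poly_funs (coords V). q a \<noteq> 0 \<and> (\<forall>b\<in>frames V. q b \<noteq> 0 \<longrightarrow> proj V b \<in> \<Union>K)"
      by blast
  qed
qed

lemma openin_zariski: "openin (zariski V) U \<longleftrightarrow> zariski_open V U"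
  by (simp add: zariski_def istopology_zariski_open topology_inverse')

lemma topspace_zariski: "topspace (zariski V) = points V"
proof
  show "topspace (zariski V) \<subseteq> points V"
    unfolding topspace_def openin_zariski zariski_open_def by blast
  have "zariski_open V (points V)"
    unfolding zariski_open_def points_def
    by (auto intro!: bexI[of _ "\<lambda>_. 1"] poly_funs.const)
  then show "points V \<subseteq> topspace (zariski V)"
    unfolding topspace_def openin_zariski by blast
qed

definition regular_on :: "('a, 'p) variety \<Rightarrow> 'p set \<Rightarrow> ('p \<Rightarrow> complex) \<Rightarrow> bool" where
  "regular_on V U h \<longleftrightarrow>
    (\<forall>a\<in>frames V. proj V a \<in> U \<longrightarrow>
      (\<exists>p\<in>poly_funs (coords V). \<exists>q\<in>poly_funs (coords V). q a \<noteq> 0 \<and>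
        (\<forall>b\<in>frames V. proj V b \<in> U \<and> q b \<noteq> 0 \<longrightarrow> h (proj V b) = p b / q b)))"

definition morphism_on :: "('a, 'p) variety \<Rightarrow> ('b, 'q) variety \<Rightarrow> 'p set \<Rightarrow> ('p \<Rightarrow> 'q) \<Rightarrow> bool" where
  "morphism_on V W U f \<longleftrightarrow>
    continuous_map (subtopology (zariski V) U) (zariski W) f \<and>
    (\<forall>Z h. openin (zariski W) Z \<and> regular_on W Z h \<longrightarrow>
      regular_on V {x \<in> U. f x \<in> Z} (h \<circ> f))"

text \<open>
  Rational maps are partial functions, composed by \<open>\<circ>\<^sub>m\<close> (so a composite is undefined wherever
  an intermediate result is), and identified when they agree on a nonempty open set on which both
  are defined. In particular an equality of composites contains the claim that they are defined
  on a dense open set.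
\<close>

definition rational_map :: "('a, 'p) variety \<Rightarrow> ('b, 'q) variety \<Rightarrow> ('p \<rightharpoonup> 'q) \<Rightarrow> bool" where
  "rational_map V W f \<longleftrightarrow>
    (\<exists>U. openin (zariski V) U \<and> U \<noteq> {} \<and> U \<subseteq> dom f \<and> morphism_on V W U (the \<circ> f))"

definition rat_eq :: "('a, 'p) variety \<Rightarrow> ('p \<rightharpoonup> 'q) \<Rightarrow> ('p \<rightharpoonup> 'q) \<Rightarrow> bool" where
  "rat_eq V f g \<longleftrightarrow>
    (\<exists>U. openin (zariski V) U \<and> U \<noteq> {} \<and> U \<subseteq> dom f \<and> U \<subseteq> dom g \<and> (\<forall>x\<in>U. f x = g x))"

definition pdiv :: "complex \<Rightarrow> complex \<rightharpoonup> complex" where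
  "pdiv a b = (if b = 0 then None else Some (a / b))"


section \<open>The varieties \<open>Gr(k, n) \<times> \<complex>\<^sup>\<times>\<close>\<close>

abbreviation colspan :: "nat \<Rightarrow> complex mat \<Rightarrow> complex vec set" where
  "colspan \<equiv> vec_space.col_space"

definition full_rank_mats :: "nat \<Rightarrow> nat \<Rightarrow> complex mat set" where
  "full_rank_mats n k = {A \<in> carrier_mat n k. vec_space.rank n A = k}"

type_synonym point = "complex vec set \<times> complex"

definition XX :: "nat \<Rightarrow> nat \<Rightarrow> (complex mat \<times> complex, point) variety" where
  "XX n k =
    \<lparr> frames = full_rank_mats n k \<times> (UNIV - {0}),
      coords = {(\<lambda>(A, t). A $$ (i, j)) | i j. i < n \<and> j < k} \<union> {\<lambda>(A, t). t},
      proj = (\<lambda>(A, t). (colspan n A, t)) \<rparr>"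

text \<open>
  Row indices are \<open>1, \<dots>, n\<close> in the formulas below, but matrices are indexed from 0, so an index
  \<open>i\<close> reduced modulo \<open>n\<close> denotes row \<open>(i - 1) mod n\<close> of a matrix. Pluecker coordinates depend on
  the matrix chosen to represent the subspace, through a common nonzero factor; they are only used
  in homogeneous expressions of degree 0 and in vanishing conditions.
\<close>

definition row_set :: "nat \<Rightarrow> int set \<Rightarrow> nat set" where
  "row_set n I = (\<lambda>i. nat ((i - 1) mod int n)) ` I"

definition pluecker :: "nat \<Rightarrow> nat \<Rightarrow> complex vec set \<Rightarrow> int set \<Rightarrow> complex" where
  "pluecker n k N I =
    (if card (row_set n I) = k
     then det (submatrix (SOME A. A \<in> full_rank_mats n k \<and> colspan n A = N) (row_set n I) UNIV)
     else 0)"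


section \<open>The geometric R-matrix\<close>

text \<open>The polynomial variable is the indeterminate \<open>\<lambda>\<close>.\<close>

definition g_entry :: "nat \<Rightarrow> nat \<Rightarrow> point \<Rightarrow> int \<Rightarrow> int \<Rightarrow> complex poly" where
  "g_entry n k = (\<lambda>(N, t) i j.
     Polynomial.smult (pluecker n k N ({j - int k + 1..j - 1} \<union> {i}) / pluecker n k N {j - int k..j - 1})
       (if j \<le> int k then 1 else if i \<ge> j then [:t:] else [:0, 1:]))"

definition g_mat :: "nat \<Rightarrow> nat \<Rightarrow> point \<rightharpoonup> complex poly mat" where
  "g_mat n k x =
    (if \<forall>j\<in>{1..int n}. pluecker n k (fst x) {j - int k..j - 1} \<noteq> 0
     then Some (mat n n (\<lambda>(i, j). g_entry n k x (int i + 1) (int j + 1)))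
     else None)"

definition pi_map :: "nat \<Rightarrow> nat \<Rightarrow> complex \<Rightarrow> complex poly mat \<rightharpoonup> point" where
  "pi_map n k z A =
    (let B = mat n k (\<lambda>(i, j). poly (A $$ (i, j)) ((- 1) ^ (k - 1) * z))
     in if B \<in> full_rank_mats n k then Some (colspan n B, z) else None)"

definition fl :: "nat \<Rightarrow> 'a mat \<Rightarrow> 'a mat" where
  "fl n A = mat n n (\<lambda>(i, j). A $$ (n - 1 - j, n - 1 - i))"

definition geo_S :: "nat \<Rightarrow> nat \<Rightarrow> point \<rightharpoonup> point" where
  "geo_S n k = (\<lambda>(N, t). do { A \<leftarrow> g_mat n k (N, t); pi_map n k t (fl n A) })"

definition geo_S2 :: "nat \<Rightarrow> nat \<Rightarrow> nat \<Rightarrow> point \<times> point \<rightharpoonup> point \<times> point" where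
  "geo_S2 n k l = (\<lambda>(x, y). do { x' \<leftarrow> geo_S n k x; y' \<leftarrow> geo_S n l y; Some (y', x') })"

definition Psi :: "nat \<Rightarrow> nat \<Rightarrow> nat \<Rightarrow> point \<times> point \<rightharpoonup> point" where
  "Psi n k l = (\<lambda>(x, (N, t)).
     do { A \<leftarrow> g_mat n l x; B \<leftarrow> g_mat n k (N, t); pi_map n k t (A * B) })"

text \<open>\<open>geo_R n l k\<close> is the map from \<open>\<X>\<^sub>l \<times> \<X>\<^sub>k\<close> to \<open>\<X>\<^sub>k \<times> \<X>\<^sub>l\<close>.\<close>

definition geo_R :: "nat \<Rightarrow> nat \<Rightarrow> nat \<Rightarrow> point \<times> point \<rightharpoonup> point \<times> point" where
  "geo_R n l k = (\<lambda>xy.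
     do { a \<leftarrow> Psi n k l xy;
          b \<leftarrow> (geo_S n l \<circ>\<^sub>m Psi n l k \<circ>\<^sub>m geo_S2 n l k) xy;
          Some (a, b) })"

definition geo_R1 :: "nat \<Rightarrow> nat \<Rightarrow> nat \<Rightarrow> point \<times> point \<times> point \<rightharpoonup> point \<times> point \<times> point" where
  "geo_R1 n a b = (\<lambda>(x, y, z). do { (y', x') \<leftarrow> geo_R n a b (x, y); Some (y', x', z) })"

definition geo_R2 :: "nat \<Rightarrow> nat \<Rightarrow> nat \<Rightarrow> point \<times> point \<times> point \<rightharpoonup> point \<times> point \<times> point" where
  "geo_R2 n b c = (\<lambda>(x, y, z). do { (z', y') \<leftarrow> geo_R n b c (y, z); Some (x, z', y') })"


section \<open>Symmetries\<close>

definition PR :: "nat \<Rightarrow> nat \<Rightarrow> point \<Rightarrow> point" where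
  "PR n k = (\<lambda>(N, t).
     ((\<lambda>v. vec n (\<lambda>i. if i = 0 then (- 1) ^ (k - 1) * t * v $ (n - 1) else v $ (i - 1))) ` N, t))"

definition PR2 :: "nat \<Rightarrow> nat \<Rightarrow> nat \<Rightarrow> point \<times> point \<rightharpoonup> point \<times> point" where
  "PR2 n k l = Some \<circ> map_prod (PR n k) (PR n l)"

text \<open>The sign is \<open>(- 1) ^ (i + 1)\<close> for the basis vectors numbered from 1.\<close>

definition alt_perp :: "nat \<Rightarrow> complex vec set \<Rightarrow> complex vec set" where
  "alt_perp n N = {v \<in> carrier_vec n. \<forall>w\<in>N. (\<Sum>i<n. (- 1) ^ i * v $ i * w $ i) = 0}"

definition mu :: "nat \<Rightarrow> point \<Rightarrow> point" where
  "mu n = (\<lambda>(N, t). ((\<lambda>v. vec n (\<lambda>i. v $ (n - 1 - i))) ` alt_perp n N, t))"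

definition geo_D2 :: "nat \<Rightarrow> nat \<Rightarrow> nat \<Rightarrow> point \<times> point \<rightharpoonup> point \<times> point" where
  "geo_D2 n k l = geo_S2 n (n - k) (n - l) \<circ>\<^sub>m (Some \<circ> map_prod (mu n) (mu n))"


section \<open>Geometric crystals\<close>

text \<open>
  \<open>gam\<close> is indexed by \<open>1, \<dots>, n\<close>, the other maps by \<open>0, \<dots>, n - 1\<close>.
\<close>

record 'p geometric_crystal =
  gam :: "nat \<Rightarrow> 'p \<rightharpoonup> complex"
  phi :: "nat \<Rightarrow> 'p \<rightharpoonup> complex"
  eps :: "nat \<Rightarrow> 'p \<rightharpoonup> complex"
  act :: "nat \<Rightarrow> complex \<Rightarrow> 'p \<rightharpoonup> 'p"

definition X_gam :: "nat \<Rightarrow> nat \<Rightarrow> nat \<Rightarrow> point \<rightharpoonup> complex" where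
  "X_gam n k i = (\<lambda>(N, t). let i' = int i; k' = int k in
     pdiv ((if i \<le> k then 1 else t) * pluecker n k N {i' - k' + 1..i'})
          (pluecker n k N {i' - k'..i' - 1}))"

definition X_phi :: "nat \<Rightarrow> nat \<Rightarrow> nat \<Rightarrow> point \<rightharpoonup> complex" where
  "X_phi n k i = (\<lambda>(N, t). let i' = int i; k' = int k in
     pdiv (pluecker n k N ({i' - k' + 1..i' - 1} \<union> {i' + 1}))
          ((if i = 0 then t else 1) * pluecker n k N {i' - k' + 1..i'}))"

definition X_eps :: "nat \<Rightarrow> nat \<Rightarrow> nat \<Rightarrow> point \<rightharpoonup> complex" where
  "X_eps n k i = (\<lambda>(N, t). let i' = int i; k' = int k in
     pdiv (pluecker n k N ({i' - k' + 1..i' - 1} \<union> {i' + 1}) * pluecker n k N {i' - k' + 1..i'})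
          ((if i = k then t else 1) *
           (pluecker n k N {i' - k'..i' - 1} * pluecker n k N {i' - k' + 2..i' + 1})))"

definition x_mat :: "nat \<Rightarrow> nat \<Rightarrow> complex \<Rightarrow> complex mat" where
  "x_mat n i a = 1\<^sub>m n +
     mat n n (\<lambda>(r, s). if (r, s) = (if i = 0 then (n - 1, 0) else (i - 1, i)) then a else 0)"

definition X_act :: "nat \<Rightarrow> nat \<Rightarrow> nat \<Rightarrow> complex \<Rightarrow> point \<rightharpoonup> point" where
  "X_act n k i c = (\<lambda>(N, t).
     if c = 0 then None else
     do { p \<leftarrow> X_phi n k i (N, t);
          a \<leftarrow> pdiv (c - 1) p;
          Some ((*\<^sub>v) (x_mat n i (if i = 0 then (- 1) ^ (k - 1) / t * a else a)) ` N, t) })"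

definition X_crystal :: "nat \<Rightarrow> nat \<Rightarrow> point geometric_crystal" where
  "X_crystal n k = \<lparr> gam = X_gam n k, phi = X_phi n k, eps = X_eps n k, act = X_act n k \<rparr>"

definition prod_crystal ::
    "'p geometric_crystal \<Rightarrow> 'q geometric_crystal \<Rightarrow> ('p \<times> 'q) geometric_crystal"
    (infixr "\<times>\<^sub>C" 80) where
  "C \<times>\<^sub>C D =
    \<lparr> gam = (\<lambda>i (x, y). do { a \<leftarrow> gam C i x; b \<leftarrow> gam D i y; Some (a * b) }),
      phi = (\<lambda>i (x, y).
        do { px \<leftarrow> phi C i x; ex \<leftarrow> eps C i x; py \<leftarrow> phi D i y; pdiv (px * (ex + py)) ex }),
      eps = (\<lambda>i (x, y).
        do { ex \<leftarrow> eps C i x; py \<leftarrow> phi D i y; ey \<leftarrow> eps D i y; pdiv (ey * (ex + py)) py }),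
      act = (\<lambda>i c (x, y).
        if c = 0 then None else
        do { ex \<leftarrow> eps C i x;
             py \<leftarrow> phi D i y;
             c1 \<leftarrow> pdiv (c * ex + py) (ex + py);
             c2 \<leftarrow> pdiv (ex + py) (ex + inverse c * py);
             x' \<leftarrow> act C i c1 x;
             y' \<leftarrow> act D i c2 y;
             Some (x', y') }) \<rparr>"

text \<open>
  \<open>V\<close> and \<open>W\<close> are the underlying varieties of the geometric crystals \<open>C\<close> and \<open>D\<close> of
  type \<open>A\<close> (affine, rank \<open>n - 1\<close>). Commutation with the action is an equality of rational maps
  from \<open>V\<close> to \<open>W\<close> for every nonzero \<open>c\<close>.
\<close>

definition crystal_morphism :: "nat \<Rightarrow> ('a, 'p) variety \<Rightarrow> 'p geometric_crystal \<Rightarrow>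
    ('b, 'q) variety \<Rightarrow> 'q geometric_crystal \<Rightarrow> ('p \<rightharpoonup> 'q) \<Rightarrow> bool" where
  "crystal_morphism n V C W D h \<longleftrightarrow>
    rational_map V W h \<and>
    (\<forall>i<n. \<forall>c. c \<noteq> 0 \<longrightarrow> rat_eq V (act D i c \<circ>\<^sub>m h) (h \<circ>\<^sub>m act C i c)) \<and>
    (\<forall>i\<in>{1..n}. rat_eq V (gam D i \<circ>\<^sub>m h) (gam C i)) \<and>
    (\<forall>i<n. rat_eq V (phi D i \<circ>\<^sub>m h) (phi C i)) \<and>
    (\<forall>i<n. rat_eq V (eps D i \<circ>\<^sub>m h) (eps C i))"

definition crystal_isomorphism :: "nat \<Rightarrow> ('a, 'p) variety \<Rightarrow> 'p geometric_crystal \<Rightarrow>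
    ('b, 'q) variety \<Rightarrow> 'q geometric_crystal \<Rightarrow> ('p \<rightharpoonup> 'q) \<Rightarrow> bool" where
  "crystal_isomorphism n V C W D h \<longleftrightarrow>
    crystal_morphism n V C W D h \<and>
    (\<exists>h'. crystal_morphism n W D V C h' \<and> rat_eq V (h' \<circ>\<^sub>m h) Some \<and> rat_eq W (h \<circ>\<^sub>m h') Some)"

end

theory Submission
  imports Defs
begin

text \<open>
  The proof replaces Pluecker coordinates by linear algebra over polynomials. The coefficient of
  \<open>\<lambda>\<^sup>m\<close> in an entry \<open>(i, j)\<close> is given the grade \<open>i - j + n * m\<close>; then \<open>g(N|t)\<close> lives in the grades from
  0 to \<open>n - k\<close> and has only ones in the top grade, and at \<open>\<lambda> = (-1)\<^sup>k\<^sup>-\<^sup>1 t\<close>, called \<open>lam k t\<close>, its columns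
  span \<open>N\<close>. Conversely, a matrix of this shape that has rank \<open>k\<close> at this value of \<open>\<lambda>\<close> is \<open>g\<close> of its
  image there (\<open>banded_rank_imp\<close>), since each column is the only vector of the image with the
  prescribed zeros and corner entry. So a matrix is recognised as \<open>g\<close> of a point by its shape and by
  its rank at one value of \<open>\<lambda>\<close>.

  The matrix of the dual point \<open>\<mu>(x)\<close>, up to reflection and signs, is inverse to \<open>g(x)\<close> up to the
  factor \<open>\<lambda> - lam k t\<close> (\<open>dual_mat_inverse\<close>). Hence \<open>g(x)\<close> is invertible for all other \<open>\<lambda>\<close>. Now let
  \<open>x\<close> and \<open>y\<close> have distinct parameters. At the parameter of \<open>y\<close> the image of \<open>g(x) g(y)\<close> has the
  dimension of \<open>y\<close>, so it is a point \<open>x'\<close>, and if \<open>g(x')\<close> exists it divides the product. The quotient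
  has the shape and the rank of a matrix \<open>g(y')\<close> (\<open>g_factor\<close>). Thus \<open>g(x) g(y) = g(x') g(y')\<close> is
  the unique factorisation with types and parameters exchanged, and \<open>R(x, y) = (x', y')\<close>
  (\<open>geo_R_eqI\<close>).

  All assertions now are about the product of the matrices, which \<open>R\<close> does not change. As
  the two factorisations play symmetric roles, the R-matrix with the types exchanged is inverse to
  \<open>R\<close>. \<open>PR\<close>, \<open>S\<close> and \<open>D\<close> act on matrices by conjugation with the cyclic shift, by reflection in the
  antidiagonal and by inversion, so they preserve or reverse factorisations (\<open>R_rel_PR\<close>, \<open>R_rel_S\<close>, \<open>R_rel_D\<close>). The maps \<open>\<gamma>\<close>, \<open>\<phi>\<^sub>i\<close>, \<open>\<epsilon>\<^sub>i\<close> of a product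
  depend only on the diagonal and the next diagonal of the product matrix (\<open>prod_crystal_g_of\<close>), and
  \<open>e\<^sub>i\<close> multiplies the product matrix from both sides by unipotent matrices, which are determined by
  these entries (\<open>prod_act_g_of\<close>). The Yang--Baxter relation is uniqueness of the factorisation of a
  product of three matrices (\<open>triple_factorisation_unique\<close>).

  Equalities of rational maps also need a nonempty open set on which everything is defined. A point
  fixed by \<open>PR\<close>, spanned by eigenvectors of the twisted shift, has a matrix that is a polynomial in the
  shift (\<open>fixed_point\<close>). Such matrices commute, so \<open>R\<close> exchanges two fixed points, and all iterates of
  \<open>R\<close> are defined at them. Openness holds because \<open>R\<close> is given by rational functions on frames
  (\<open>R_liftable\<close>).
\<close>

section \<open>Matrices of full rank and Pluecker coordinates\<close>

lemma mult_unit_vec_eq_col: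
  fixes A :: "'a :: comm_ring_1 mat"
  assumes "A \<in> carrier_mat n k" "j < k"
  shows "A *\<^sub>v unit_vec k j = col A j"
  using assms by (intro eq_vecI) auto

lemma full_rank_iff_injective:
  fixes A :: "complex mat"
  assumes A: "A \<in> carrier_mat n k"
  shows "vec_space.rank n A = k \<longleftrightarrow> (\<forall>v\<in>carrier_vec k. A *\<^sub>v v = 0\<^sub>v n \<longrightarrow> v = 0\<^sub>v k)"
proof -
  interpret vec_space "TYPE(complex)" n .
  show ?thesis
  proof
    assume r: "rank A = k"
    have dist: "distinct (cols A)"
    proof (rule ccontr)
      assume nd: "\<not> distinct (cols A)"
      obtain S where S: "maximal S (\<lambda>T. T \<subseteq> set (cols A) \<and> lin_indpt T)"
        using maximal_exists[of "(\<lambda>T. T \<subseteq> set (cols A) \<and> lin_indpt T)" "card (set (cols A))" "{}"]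
        by (meson List.finite_set card_mono empty_iff empty_subsetI finite_lin_indpt2 rev_finite_subset)
      then have "card S \<le> card (set (cols A))" by (simp add: card_mono maximal_def)
      also have "\<dots> < length (cols A)"
        using nd card_length[of "cols A"] card_distinct[of "cols A"] by linarith
      finally show False using rank_card_indpt[OF A S] r A by simp
    qed
    show "\<forall>v\<in>carrier_vec k. A *\<^sub>v v = 0\<^sub>v n \<longrightarrow> v = 0\<^sub>v k"
      using full_rank_lin_indpt[OF A r dist] lin_depI[OF A _ _ _ dist] by blast
  next
    assume inj: "\<forall>v\<in>carrier_vec k. A *\<^sub>v v = 0\<^sub>v n \<longrightarrow> v = 0\<^sub>v k"
    have dist: "distinct (cols A)"
    proof (rule ccontr)
      assume "\<not> distinct (cols A)"
      then obtain i j where ij: "i \<noteq> j" "i < k" "j < k" "col A i = col A j"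
        using A by (auto simp: distinct_conv_nth)
      have "A *\<^sub>v (unit_vec k i - unit_vec k j) = col A i - col A j"
        using A ij by (simp add: mult_minus_distrib_mat_vec[where nc = k] mult_unit_vec_eq_col[OF A])
      then have "A *\<^sub>v (unit_vec k i - unit_vec k j) = 0\<^sub>v n" using ij A by auto
      then have "unit_vec k i - unit_vec k j = (0\<^sub>v k :: complex vec)" using inj by auto
      then have "(unit_vec k i - unit_vec k j) $ i = (0 :: complex)" using ij by auto
      then show False using ij by auto
    qed
    have "lin_indpt (set (cols A))" using lin_depE[OF A _ dist] inj by metis
    then show "rank A = k" by (rule lin_indpt_full_rank[OF A dist])
  qed
qed

lemma full_rank_mats_iff:
  "A \<in> full_rank_mats n k \<longleftrightarrow>
     A \<in> carrier_mat n k \<and> (\<forall>v\<in>carrier_vec k. A *\<^sub>v v = 0\<^sub>v n \<longrightarrow> v = 0\<^sub>v k)"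
  unfolding full_rank_mats_def using full_rank_iff_injective by blast

lemma colspan_eq_image:
  assumes "A \<in> carrier_mat n k"
  shows "colspan n A = (\<lambda>v. A *\<^sub>v v) ` carrier_vec k"
proof -
  have "colspan n A = {y \<in> carrier_vec (dim_row A). \<exists>x\<in>carrier_vec (dim_col A). A *\<^sub>v x = y}"
    by (rule vec_space.col_space_eq[OF assms])
  with assms show ?thesis by auto
qed

lemma invertible_of_det:
  fixes Z :: "complex mat"
  assumes Z: "Z \<in> carrier_mat k k" and d: "det Z \<noteq> 0"
  obtains Y where "Y \<in> carrier_mat k k" "Z * Y = 1\<^sub>m k" "Y * Z = 1\<^sub>m k"
proof -
  have "Z \<in> Units (ring_mat TYPE(complex) k undefined)" by (rule det_non_zero_imp_unit[OF Z d])
  then show ?thesis using that unfolding Units_def ring_mat_def by auto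
qed

lemma det_nonzero_of_inverse:
  fixes Z :: "complex mat"
  assumes Z: "Z \<in> carrier_mat k k" and Y: "Y \<in> carrier_mat k k" and ZY: "Z * Y = 1\<^sub>m k"
  shows "det Z \<noteq> 0"
  using det_mult[OF Z Y] ZY by auto

lemma full_rank_left_mult:
  fixes Z :: "complex mat"
  assumes F: "F \<in> full_rank_mats n k" and Z: "Z \<in> carrier_mat n n" and d: "det Z \<noteq> 0"
  shows "Z * F \<in> full_rank_mats n k"
  unfolding full_rank_mats_iff
proof (intro conjI ballI impI)
  have Fc: "F \<in> carrier_mat n k" using F by (simp add: full_rank_mats_iff)
  show "Z * F \<in> carrier_mat n k" using Z Fc by auto
  fix v :: "complex vec" assume v: "v \<in> carrier_vec k" and 0: "Z * F *\<^sub>v v = 0\<^sub>v n"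
  have "Z *\<^sub>v (F *\<^sub>v v) = 0\<^sub>v n" using 0 assoc_mult_mat_vec[OF Z Fc v] by simp
  then have "F *\<^sub>v v = 0\<^sub>v n"
    using det_0_iff_vec_prod_zero_field[OF Z] d mult_mat_vec_carrier[OF Fc v] by blast
  then show "v = 0\<^sub>v k" using F v by (auto simp: full_rank_mats_iff)
qed

lemma full_rank_factors:
  assumes F: "F \<in> carrier_mat n k" and Z: "Z \<in> carrier_mat k k" and FZ: "F * Z \<in> full_rank_mats n k"
  shows "F \<in> full_rank_mats n k" "det Z \<noteq> 0" "colspan n (F * Z) = colspan n F"
proof -
  have inj: "v = 0\<^sub>v k" if "v \<in> carrier_vec k" "(F * Z) *\<^sub>v v = 0\<^sub>v n" for v
    using FZ that by (simp add: full_rank_mats_iff)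
  show d: "det Z \<noteq> 0"
  proof
    assume "det Z = 0"
    then obtain v where v: "v \<in> carrier_vec k" "v \<noteq> 0\<^sub>v k" "Z *\<^sub>v v = 0\<^sub>v k"
      using det_0_iff_vec_prod_zero_field[OF Z] by blast
    have "(F * Z) *\<^sub>v v = F *\<^sub>v (Z *\<^sub>v v)" by (rule assoc_mult_mat_vec[OF F Z v(1)])
    then have "(F * Z) *\<^sub>v v = 0\<^sub>v n" using v F by auto
    then show False using inj v by blast
  qed
  obtain Y where Y: "Y \<in> carrier_mat k k" "Z * Y = 1\<^sub>m k" "Y * Z = 1\<^sub>m k"
    by (rule invertible_of_det[OF Z d])
  have eq: "F *\<^sub>v v = (F * Z) *\<^sub>v (Y *\<^sub>v v)" if v: "v \<in> carrier_vec k" for v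
  proof -
    have "(F * Z) *\<^sub>v (Y *\<^sub>v v) = F *\<^sub>v (Z *\<^sub>v (Y *\<^sub>v v))"
      using assoc_mult_mat_vec[OF F Z] Y v by auto
    also have "Z *\<^sub>v (Y *\<^sub>v v) = v" using assoc_mult_mat_vec[OF Z Y(1) v, symmetric] Y(2) v by simp
    finally show ?thesis by simp
  qed
  show "F \<in> full_rank_mats n k" unfolding full_rank_mats_iff
  proof (intro conjI ballI impI F)
    fix v :: "complex vec" assume v: "v \<in> carrier_vec k" "F *\<^sub>v v = 0\<^sub>v n"
    then have "Y *\<^sub>v v = 0\<^sub>v k" using inj[of "Y *\<^sub>v v"] eq[OF v(1)] Y by auto
    then have "Z *\<^sub>v (Y *\<^sub>v v) = 0\<^sub>v k" using Z by auto
    then show "v = 0\<^sub>v k" using assoc_mult_mat_vec[OF Z Y(1) v(1), symmetric] Y(2) v by simp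
  qed
  show "colspan n (F * Z) = colspan n F"
    unfolding colspan_eq_image[OF F] colspan_eq_image[OF mult_carrier_mat[OF F Z]]
  proof (intro Set.set_eqI iffI)
    fix w assume "w \<in> (*\<^sub>v) (F * Z) ` carrier_vec k"
    then obtain v where "v \<in> carrier_vec k" "w = F *\<^sub>v (Z *\<^sub>v v)"
      using assoc_mult_mat_vec[OF F Z] by auto
    then show "w \<in> (*\<^sub>v) F ` carrier_vec k" using Z by auto
  next
    fix w assume "w \<in> (*\<^sub>v) F ` carrier_vec k"
    then show "w \<in> (*\<^sub>v) (F * Z) ` carrier_vec k" using eq Y(1) by fastforce
  qed
qed

lemma full_rank_right_mult:
  assumes F: "F \<in> full_rank_mats n k" and Z: "Z \<in> carrier_mat k k" and d: "det Z \<noteq> 0"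
  shows "F * Z \<in> full_rank_mats n k"
  unfolding full_rank_mats_iff
proof (intro conjI ballI impI)
  have Fc: "F \<in> carrier_mat n k" using F by (simp add: full_rank_mats_iff)
  show "F * Z \<in> carrier_mat n k" using Z Fc by auto
  fix v :: "complex vec" assume v: "v \<in> carrier_vec k" and 0: "F * Z *\<^sub>v v = 0\<^sub>v n"
  then have "F *\<^sub>v (Z *\<^sub>v v) = 0\<^sub>v n" using assoc_mult_mat_vec[OF Fc Z v] by simp
  then have "Z *\<^sub>v v = 0\<^sub>v k" using F Z v by (auto simp: full_rank_mats_iff)
  then show "v = 0\<^sub>v k" using det_0_iff_vec_prod_zero_field[OF Z] d v by blast
qed

lemma same_colspan_change_of_basis:
  assumes A: "A \<in> full_rank_mats n k" and B: "B \<in> full_rank_mats n k"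
    and eq: "colspan n A = colspan n B"
  obtains Z where "Z \<in> carrier_mat k k" "det Z \<noteq> 0" "B = A * Z"
proof -
  have Ac: "A \<in> carrier_mat n k" and Bc: "B \<in> carrier_mat n k"
    using A B by (auto simp: full_rank_mats_iff)
  have "\<exists>z\<in>carrier_vec k. A *\<^sub>v z = col B j" if j: "j < k" for j
  proof -
    have "col B j = B *\<^sub>v unit_vec k j" using mult_unit_vec_eq_col[OF Bc j] by simp
    then have "col B j \<in> colspan n B" unfolding colspan_eq_image[OF Bc] by auto
    then show ?thesis unfolding eq[symmetric] colspan_eq_image[OF Ac] by auto
  qed
  then obtain z where z: "\<And>j. j < k \<Longrightarrow> z j \<in> carrier_vec k \<and> A *\<^sub>v z j = col B j" by metis
  define Z where "Z = mat k k (\<lambda>(i, j). z j $ i)"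
  have Zc: "Z \<in> carrier_mat k k" by (simp add: Z_def)
  have cz: "col Z j = z j" if "j < k" for j
    using z[OF that] that by (intro eq_vecI) (auto simp: Z_def)
  have AZ: "B = A * Z"
  proof (rule eq_matI)
    fix i j assume ij: "i < dim_row (A * Z)" "j < dim_col (A * Z)"
    then have j: "j < k" and i: "i < n" using Zc Ac by auto
    have "B $$ (i, j) = (A *\<^sub>v z j) $ i" using z[OF j] i j Bc by simp
    also have "\<dots> = (A * Z) $$ (i, j)" using cz[OF j] i j Ac Zc by simp
    finally show "B $$ (i, j) = (A * Z) $$ (i, j)" .
  qed (use Ac Bc Zc in auto)
  show ?thesis using that[OF Zc _ AZ] full_rank_factors(2)[OF Ac Zc] B AZ by auto
qed

subsection \<open>Minors\<close>

definition minor :: "nat set \<Rightarrow> complex mat \<Rightarrow> complex" where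
  "minor J A = det (submatrix A J UNIV)"

lemma submatrix_rows_eq:
  fixes A :: "'a mat"
  assumes A: "A \<in> carrier_mat n k" and J: "J \<subseteq> {..<n}" "card J = m"
  shows "submatrix A J UNIV = mat m k (\<lambda>(a, j). A $$ (pick J a, j))"
proof -
  have "{i. i < dim_row A \<and> i \<in> J} = J" using A J by auto
  then show ?thesis using A J(2) by (auto simp: submatrix_def pick_UNIV)
qed

lemma pick_subset: "J \<subseteq> {..<n} \<Longrightarrow> a < card J \<Longrightarrow> pick J a < n"
  using pick_in_set_le[of a J] by blast

lemma submatrix_rows_mult:
  fixes A :: "'a :: comm_ring_1 mat"
  assumes A: "A \<in> carrier_mat n k" and Z: "Z \<in> carrier_mat k l" and J: "J \<subseteq> {..<n}" "card J = m"
  shows "submatrix (A * Z) J UNIV = submatrix A J UNIV * Z"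
  unfolding submatrix_rows_eq[OF A J] submatrix_rows_eq[OF mult_carrier_mat[OF A Z] J]
  using A Z J pick_subset[OF J(1)]
  by (intro eq_matI) (auto simp: scalar_prod_def row_def)

lemma minor_mult:
  assumes A: "A \<in> carrier_mat n k" and Z: "Z \<in> carrier_mat k k" and J: "J \<subseteq> {..<n}" "card J = k"
  shows "minor J (A * Z) = minor J A * det Z"
  unfolding minor_def submatrix_rows_mult[OF A Z J]
  by (rule det_mult[OF _ Z]) (simp add: submatrix_rows_eq[OF A J])

lemma row_set_subset: "n > 0 \<Longrightarrow> row_set n I \<subseteq> {..<n}"
  by (auto simp: row_set_def nat_less_iff)

text \<open>The frame picked in the definition of the Pluecker coordinates differs from a given one by a
  change of basis; \<open>c\<close> is the determinant of that change of basis.\<close>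

lemma pluecker_colspan:
  assumes F: "F \<in> full_rank_mats n k" and n: "n > 0"
  obtains c where "c \<noteq> 0"
    "\<And>I. pluecker n k (colspan n F) I =
      (if card (row_set n I) = k then c * minor (row_set n I) F else 0)"
proof -
  define B where "B = (SOME A. A \<in> full_rank_mats n k \<and> colspan n A = colspan n F)"
  have B: "B \<in> full_rank_mats n k \<and> colspan n B = colspan n F"
    unfolding B_def by (rule someI[of _ F]) (use F in auto)
  obtain Z where Z: "Z \<in> carrier_mat k k" "det Z \<noteq> 0" "B = F * Z"
    using same_colspan_change_of_basis[OF F] B by metis
  have Fc: "F \<in> carrier_mat n k" using F by (simp add: full_rank_mats_iff)
  show ?thesis
  proof (rule that[OF Z(2)])
    fix I
    show "pluecker n k (colspan n F) I =
      (if card (row_set n I) = k then det Z * minor (row_set n I) F else 0)"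
      using minor_mult[OF Fc Z(1) row_set_subset[OF n], of I] Z(3)
      by (auto simp: pluecker_def minor_def B_def)
  qed
qed

lemma bij_betw_pick:
  assumes J: "J \<subseteq> {..<n}" "card J = k"
  shows "bij_betw (pick J) {..<k} J"
proof (rule bij_betw_imageI)
  show inj: "inj_on (pick J) {..<k}"
    using pick_mono_le[of _ J] J(2) by (auto simp: inj_on_def) (metis nat_neq_iff)
  show "pick J ` {..<k} = J"
    using pick_in_set_le[of _ J] J
    by (intro card_subset_eq) (auto simp: card_image[OF inj] finite_subset[OF J(1)])
qed

text \<open>Whether a minor vanishes is tested on vectors killed from the left or from the right. In this
  form the order in which the rows are listed does not matter, which is convenient because the rows
  of interest form cyclic intervals.\<close>

lemma minor_nonzeroI_left:
  assumes F: "F \<in> carrier_mat n k" and J: "J \<subseteq> {..<n}" "card J = k"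
    and inj: "\<And>w. (\<And>c. c < k \<Longrightarrow> (\<Sum>i\<in>J. w i * F $$ (i, c)) = 0) \<Longrightarrow> (\<forall>i\<in>J. w i = (0::complex))"
  shows "minor J F \<noteq> 0"
proof
  let ?S = "submatrix F J UNIV"
  have S: "?S = mat k k (\<lambda>(a, j). F $$ (pick J a, j))" by (rule submatrix_rows_eq[OF F J])
  have Sc: "?S\<^sup>T \<in> carrier_mat k k" using S by auto
  assume "minor J F = 0"
  then have "det (?S\<^sup>T) = 0" using det_transpose[of ?S k] S by (auto simp: minor_def)
  then obtain v where v: "v \<in> carrier_vec k" "v \<noteq> 0\<^sub>v k" "?S\<^sup>T *\<^sub>v v = 0\<^sub>v k"
    using det_0_iff_vec_prod_zero_field[OF Sc] by blast
  note bij = bij_betw_pick[OF J]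
  define w where "w i = v $ (the_inv_into {..<k} (pick J) i)" for i
  have wp: "w (pick J a) = v $ a" if "a < k" for a
    using that bij by (simp add: w_def the_inv_into_f_f bij_betw_def)
  have "(\<Sum>i\<in>J. w i * F $$ (i, c)) = 0" if c: "c < k" for c
  proof -
    have "(\<Sum>i\<in>J. w i * F $$ (i, c)) = (\<Sum>a<k. w (pick J a) * F $$ (pick J a, c))"
      by (rule sum.reindex_bij_betw[OF bij, symmetric])
    also have "\<dots> = (?S\<^sup>T *\<^sub>v v) $ c"
      using c v(1) wp unfolding S by (simp add: scalar_prod_def atLeast0LessThan mult.commute)
    finally show ?thesis using v c by simp
  qed
  then have "\<forall>i\<in>J. w i = 0" by (rule inj)
  then have "v $ a = 0" if "a < k" for a
    using wp[OF that] bij_betw_apply[OF bij, of a] that by auto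
  then have "v = 0\<^sub>v k" using v by auto
  then show False using v by simp
qed

lemma minor_nonzeroD_right:
  assumes F: "F \<in> carrier_mat n k" and J: "J \<subseteq> {..<n}" "card J = k" and nz: "minor J F \<noteq> 0"
    and z: "z \<in> carrier_vec k" and 0: "\<And>i. i \<in> J \<Longrightarrow> (F *\<^sub>v z) $ i = 0"
  shows "z = 0\<^sub>v k"
proof -
  let ?S = "submatrix F J UNIV"
  have S: "?S = mat k k (\<lambda>(a, j). F $$ (pick J a, j))" by (rule submatrix_rows_eq[OF F J])
  have Sc: "?S \<in> carrier_mat k k" using S by auto
  have "?S *\<^sub>v z = 0\<^sub>v k"
  proof (rule eq_vecI)
    fix a assume a: "a < dim_vec (0\<^sub>v k)"
    have p: "pick J a \<in> J" using pick_in_set_le[of a J] a J by auto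
    have "(?S *\<^sub>v z) $ a = (F *\<^sub>v z) $ pick J a"
      using a p J(1) F z unfolding S by (auto simp: scalar_prod_def intro!: sum.cong)
    then show "(?S *\<^sub>v z) $ a = 0\<^sub>v k $ a" using 0[OF p] a by simp
  qed (use S in auto)
  then show ?thesis using det_0_iff_vec_prod_zero_field[OF Sc] nz z unfolding minor_def by blast
qed

lemma full_rank_of_minor:
  assumes F: "F \<in> carrier_mat n k" and J: "J \<subseteq> {..<n}" "card J = k" and nz: "minor J F \<noteq> 0"
  shows "F \<in> full_rank_mats n k"
  unfolding full_rank_mats_iff
proof (intro conjI ballI impI F)
  fix v :: "complex vec" assume v: "v \<in> carrier_vec k" "F *\<^sub>v v = 0\<^sub>v n"
  show "v = 0\<^sub>v k"
    by (rule minor_nonzeroD_right[OF F J nz v(1)]) (use v(2) J(1) in auto)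
qed

section \<open>Cyclic intervals\<close>

definition cyc :: "nat \<Rightarrow> nat \<Rightarrow> nat \<Rightarrow> nat set" where
  "cyc n a m = (\<lambda>r. (a + r) mod n) ` {..<m}"

lemma inj_on_add_mod:
  fixes n :: nat
  shows "inj_on (\<lambda>r. (a + r) mod n) {..<n}"
proof (rule linorder_inj_onI)
  fix r s assume rs: "r < s" "s \<in> {..<n}"
  show "(a + r) mod n \<noteq> (a + s) mod n"
  proof
    assume "(a + r) mod n = (a + s) mod n"
    then have "n dvd (a + s) - (a + r)" using rs by (intro mod_eq_dvd_iff_nat[THEN iffD1]) auto
    then show False using rs by (auto dest!: dvd_imp_le)
  qed
qed auto

lemma inj_on_cyc:
  fixes n :: nat
  shows "m \<le> n \<Longrightarrow> inj_on (\<lambda>r. (a + r) mod n) {..<m}"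
  by (rule inj_on_subset[OF inj_on_add_mod]) auto

lemma card_cyc: "m \<le> n \<Longrightarrow> card (cyc n a m) = m"
  unfolding cyc_def by (subst card_image[OF inj_on_cyc]) auto

lemma cyc_subset: "0 < n \<Longrightarrow> cyc n a m \<subseteq> {..<n}"
  by (auto simp: cyc_def)

lemma finite_cyc [simp]: "finite (cyc n a m)"
  by (simp add: cyc_def)

lemma cyc_Suc: "cyc n a (Suc m) = insert (a mod n) (cyc n (Suc a) m)"
  unfolding cyc_def lessThan_Suc_eq_insert_0 by (auto simp: image_image)

lemma row_set_interval:
  assumes n: "n > 0" and pa: "(p - 1) mod int n = int a mod int n"
  shows "row_set n {p..p + int m - 1} = cyc n a m"
proof -
  have iv: "{p..p + int m - 1} = (\<lambda>r. p + int r) ` {..<m}"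
  proof (intro equalityI subsetI)
    fix x assume "x \<in> {p..p + int m - 1}"
    then show "x \<in> (\<lambda>r. p + int r) ` {..<m}"
      by (intro image_eqI[of _ _ "nat (x - p)"]) auto
  qed auto
  have "nat ((p + int r - 1) mod int n) = (a + r) mod n" for r
  proof -
    have "(p + int r - 1) mod int n = ((p - 1) mod int n + int r) mod int n"
      by (simp add: mod_add_left_eq add_diff_eq diff_add_eq)
    also have "\<dots> = int ((a + r) mod n)" unfolding pa by (simp add: mod_add_left_eq of_nat_mod)
    finally show ?thesis by simp
  qed
  then show ?thesis unfolding row_set_def cyc_def iv by (simp add: image_image)
qed

lemma row_set_Un: "row_set n (I \<union> J) = row_set n I \<union> row_set n J"
  by (auto simp: row_set_def)

lemma row_set_singleton: "i < n \<Longrightarrow> row_set n {int i + 1} = {i}"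
  by (simp add: row_set_def nat_mod_as_int)

text \<open>This cyclic interval consists of the rows where column \<open>j\<close> of a \<open>g\<close>-matrix has to vanish; the
  two alternatives are its parts above and below the diagonal.\<close>

lemma cyc_gap_iff:
  assumes "0 < k" "k < n" "i < n" "j < n"
  shows "i \<in> cyc n (Suc (j + (n - k))) (k - 1) \<longleftrightarrow> i < j \<and> j < i + k \<or> j + (n - k) < i"
proof
  assume "i \<in> cyc n (Suc (j + (n - k))) (k - 1)"
  then obtain r where r: "r < k - 1" "i = (Suc (j + (n - k)) + r) mod n" by (auto simp: cyc_def)
  show "i < j \<and> j < i + k \<or> j + (n - k) < i"
  proof (cases "Suc (j + (n - k)) + r < n")
    case True then show ?thesis using r by auto
  next
    case False
    then have "Suc (j + (n - k)) + r - n < n" using r(1) assms by linarith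
    then have "i = Suc (j + (n - k)) + r - n"
      unfolding r(2) using False le_mod_geq[of n "Suc (j + (n - k)) + r"] by simp
    then have "i + n = Suc (j + (n - k)) + r" using False by simp
    then show ?thesis using r(1) assms by linarith
  qed
next
  assume h: "i < j \<and> j < i + k \<or> j + (n - k) < i"
  show "i \<in> cyc n (Suc (j + (n - k))) (k - 1)"
  proof (cases "j + (n - k) < i")
    case True
    then show ?thesis unfolding cyc_def using assms
      by (intro image_eqI[of _ _ "i - Suc (j + (n - k))"]) auto
  next
    case False
    then have hh: "i < j" "j < i + k" using h by auto
    have "Suc (j + (n - k)) + (i + k - Suc j) = i + n" using hh assms by auto
    then show ?thesis unfolding cyc_def using assms hh
      by (intro image_eqI[of _ _ "i + k - Suc j"]) auto
  qed
qed

section \<open>Banded matrices over the polynomial ring\<close>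

definition ev :: "complex \<Rightarrow> complex poly mat \<Rightarrow> complex mat" where
  "ev z = map_mat (\<lambda>p. poly p z)"

lemma ev_carrier [simp]: "ev z A \<in> carrier_mat n m \<longleftrightarrow> A \<in> carrier_mat n m"
  by (simp add: ev_def)

lemma ev_dim [simp]: "dim_row (ev z A) = dim_row A" "dim_col (ev z A) = dim_col A"
  by (simp_all add: ev_def)

lemma ev_index [simp]: "i < dim_row A \<Longrightarrow> j < dim_col A \<Longrightarrow> ev z A $$ (i, j) = poly (A $$ (i, j)) z"
  by (simp add: ev_def)

lemma ev_mult:
  assumes "A \<in> carrier_mat n m" "B \<in> carrier_mat m l"
  shows "ev z (A * B) = ev z A * ev z B"
  using assms by (intro eq_matI) (auto simp: scalar_prod_def poly_sum)

lemma ev_smult: "ev z (p \<cdot>\<^sub>m A) = poly p z \<cdot>\<^sub>m ev z A"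
  by (intro eq_matI) auto

lemma ev_one [simp]: "ev z (1\<^sub>m n) = 1\<^sub>m n"
  by (intro eq_matI) auto

text \<open>A polynomial matrix of size \<open>n\<close> unfolds to a doubly infinite \<open>n\<close>-periodic matrix, in which the
  coefficient of \<open>\<lambda>\<^sup>m\<close> in the entry \<open>(i, j)\<close> stands on the diagonal with number \<open>i - j + n * m\<close>, its
  grade. A banded matrix is concentrated in the grades from 0 to \<open>d\<close>, with ones in grade \<open>d\<close>; all
  conditions avoid subtraction.\<close>

definition banded :: "nat \<Rightarrow> nat \<Rightarrow> complex poly mat \<Rightarrow> bool" where
  "banded n d A \<longleftrightarrow> A \<in> carrier_mat n n \<and>
    (\<forall>i<n. \<forall>j<n. \<forall>m.
      (coeff (A $$ (i, j)) m \<noteq> 0 \<longrightarrow> j \<le> i + n * m \<and> i + n * m \<le> j + d) \<and>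
      (i + n * m = j + d \<longrightarrow> coeff (A $$ (i, j)) m = 1))"

lemma banded_carrier: "banded n d A \<Longrightarrow> A \<in> carrier_mat n n"
  by (simp add: banded_def)

lemma banded_zero:
  "banded n d A \<Longrightarrow> i < n \<Longrightarrow> j < n \<Longrightarrow> i + n * m < j \<or> j + d < i + n * m \<Longrightarrow> coeff (A $$ (i, j)) m = 0"
  unfolding banded_def by fastforce

lemma banded_top:
  "banded n d A \<Longrightarrow> i < n \<Longrightarrow> j < n \<Longrightarrow> i + n * m = j + d \<Longrightarrow> coeff (A $$ (i, j)) m = 1"
  unfolding banded_def by blast

lemma bandedI:
  assumes "A \<in> carrier_mat n n"
    and "\<And>i j m. i < n \<Longrightarrow> j < n \<Longrightarrow> i + n * m < j \<or> j + d < i + n * m \<Longrightarrow> coeff (A $$ (i, j)) m = 0"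
    and "\<And>i j m. i < n \<Longrightarrow> j < n \<Longrightarrow> i + n * m = j + d \<Longrightarrow> coeff (A $$ (i, j)) m = 1"
  shows "banded n d A"
  unfolding banded_def using assms by (meson not_le)

lemma banded_entry:
  assumes A: "banded n d A" and d: "d < n" and ij: "i < n" "j < n"
  shows "A $$ (i, j) = (if j \<le> i then [:coeff (A $$ (i, j)) 0:] else [:0, coeff (A $$ (i, j)) 1:])"
proof (rule poly_eqI)
  fix m
  show "coeff (A $$ (i, j)) m =
    coeff (if j \<le> i then [:coeff (A $$ (i, j)) 0:] else [:0, coeff (A $$ (i, j)) 1:]) m"
  proof (cases "j \<le> i")
    case True
    have "coeff (A $$ (i, j)) (Suc m') = 0" for m'
      by (rule banded_zero[OF A ij]) (use True d in auto)
    then show ?thesis using True by (cases m) auto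
  next
    case False
    have "coeff (A $$ (i, j)) (Suc (Suc m')) = 0" for m'
      by (rule banded_zero[OF A ij]) (use d ij in auto)
    moreover have "coeff (A $$ (i, j)) 0 = 0"
      by (rule banded_zero[OF A ij]) (use False in auto)
    ultimately show ?thesis using False by (auto simp: coeff_pCons split: nat.split)
  qed
qed

text \<open>For \<open>d < n\<close> an entry is a constant on and below the diagonal and a multiple of \<open>\<lambda>\<close> above it, so a
  single nonzero value of \<open>\<lambda>\<close> determines the matrix.\<close>

lemma banded_eqI:
  assumes A: "banded n d A" and B: "banded n d B" and d: "d < n" and z: "z \<noteq> 0"
    and eq: "ev z A = ev z B"
  shows "A = B"
proof (rule eq_matI)
  have AC: "A \<in> carrier_mat n n" and BC: "B \<in> carrier_mat n n"
    using A B by (auto simp: banded_carrier)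
  fix i j assume "i < dim_row B" "j < dim_col B"
  then have ij: "i < n" "j < n" using BC by auto
  have "poly (A $$ (i, j)) z = ev z A $$ (i, j)" using ij AC by simp
  also have "\<dots> = poly (B $$ (i, j)) z" using ij BC unfolding eq by simp
  finally have e: "poly (A $$ (i, j)) z = poly (B $$ (i, j)) z" .
  show "A $$ (i, j) = B $$ (i, j)"
  proof (cases "j \<le> i")
    case True
    from True banded_entry[OF A d ij] obtain a where a: "A $$ (i, j) = [:a:]" by auto
    from True banded_entry[OF B d ij] obtain b where b: "B $$ (i, j) = [:b:]" by auto
    from e a b show ?thesis by simp
  next
    case False
    from False banded_entry[OF A d ij] obtain a where a: "A $$ (i, j) = [:0, a:]" by auto
    from False banded_entry[OF B d ij] obtain b where b: "B $$ (i, j) = [:0, b:]" by auto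
    from e a b z show ?thesis by simp
  qed
qed (use A B in \<open>auto simp: banded_def\<close>)

text \<open>Grades add up under multiplication.\<close>

lemma banded_mult:
  assumes A: "banded n d A" and B: "banded n e B"
  shows "banded n (d + e) (A * B)"
proof (rule bandedI)
  have AC: "A \<in> carrier_mat n n" and BC: "B \<in> carrier_mat n n"
    using A B by (auto simp: banded_carrier)
  then show "A * B \<in> carrier_mat n n" by auto
  have co: "coeff ((A * B) $$ (i, j)) m =
      (\<Sum>l<n. \<Sum>p\<le>m. coeff (A $$ (i, l)) p * coeff (B $$ (l, j)) (m - p))" if "i < n" "j < n" for i j m
    using that AC BC by (simp add: scalar_prod_def coeff_sum coeff_mult atLeast0LessThan)
  fix i j m assume ij: "i < n" "j < n"
  have grade: "n * m = n * p + n * (m - p)" if "p \<le> m" for p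
    using that by (simp flip: distrib_left)
  {
    assume out: "i + n * m < j \<or> j + (d + e) < i + n * m"
    have "coeff (A $$ (i, l)) p * coeff (B $$ (l, j)) (m - p) = 0" if l: "l < n" and p: "p \<le> m" for l p
    proof (rule ccontr)
      assume "\<not> ?thesis"
      then have "l \<le> i + n * p" "i + n * p \<le> l + d" "j \<le> l + n * (m - p)" "l + n * (m - p) \<le> j + e"
        using A B ij l unfolding banded_def by auto
      then show False using out grade[OF p] by linarith
    qed
    then show "coeff ((A * B) $$ (i, j)) m = 0" unfolding co[OF ij] by (intro sum.neutral ballI) auto
  }
  {
    assume top: "i + n * m = j + (d + e)"
    have n: "n > 0" using ij by auto
    \<comment> \<open>The only contribution comes from the column of the corner entry in row \<open>j + e\<close> of \<open>B\<close>.\<close>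
    define l0 where "l0 = (j + e) mod n"
    define q0 where "q0 = (j + e) div n"
    have l0: "l0 < n" using n by (simp add: l0_def)
    have lq: "l0 + n * q0 = j + e" by (simp add: l0_def q0_def)
    have q0m: "q0 \<le> m"
    proof (rule ccontr)
      assume "\<not> q0 \<le> m"
      then have "n * Suc m \<le> n * q0" by (intro mult_le_mono2) auto
      then show False using lq top ij by auto
    qed
    have z: "coeff (A $$ (i, l)) p * coeff (B $$ (l, j)) (m - p) = 0"
      if l: "l < n" and p: "p \<le> m" and ne: "(l, p) \<noteq> (l0, m - q0)" for l p
    proof (rule ccontr)
      assume "\<not> ?thesis"
      then have "l \<le> i + n * p" "i + n * p \<le> l + d" "j \<le> l + n * (m - p)" "l + n * (m - p) \<le> j + e"
        using A B ij l unfolding banded_def by auto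
      then have e: "l + n * (m - p) = j + e" using top grade[OF p] by linarith
      have "l = l0" using e l unfolding l0_def by (simp flip: e)
      moreover have "m - p = q0" using l n unfolding q0_def by (simp flip: e)
      ultimately show False using ne p by auto
    qed
    have "coeff ((A * B) $$ (i, j)) m =
      (\<Sum>l<n. \<Sum>p\<le>m. if l = l0 \<and> p = m - q0 then coeff (A $$ (i, l0)) (m - q0) * coeff (B $$ (l0, j)) (m - (m - q0)) else 0)"
      unfolding co[OF ij] using z by (intro sum.cong refl) auto
    also have "\<dots> = (\<Sum>l<n. if l = l0 then (\<Sum>p\<le>m. if p = m - q0 then coeff (A $$ (i, l0)) (m - q0) * coeff (B $$ (l0, j)) (m - (m - q0)) else 0) else 0)"
      by (intro sum.cong refl) auto
    also have "\<dots> = coeff (A $$ (i, l0)) (m - q0) * coeff (B $$ (l0, j)) q0"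
      using l0 q0m by simp
    also have "coeff (B $$ (l0, j)) q0 = 1" by (rule banded_top[OF B l0 ij(2) lq])
    also have "coeff (A $$ (i, l0)) (m - q0) = 1"
    proof (rule banded_top[OF A ij(1) l0])
      show "i + n * (m - q0) = l0 + d" using top lq grade[OF q0m] by linarith
    qed
    finally show "coeff ((A * B) $$ (i, j)) m = 1" by simp
  }
qed

section \<open>The matrices \<open>g(N|t)\<close>\<close>

text \<open>The value of \<open>\<lambda>\<close> at which \<open>g(N|t)\<close> drops to rank \<open>k\<close>.\<close>

definition lam :: "nat \<Rightarrow> complex \<Rightarrow> complex" where
  "lam k t = (- 1) ^ (k - 1) * t"

lemma lam_eq_0_iff [simp]: "lam k t = 0 \<longleftrightarrow> t = 0"
  by (simp add: lam_def)

text \<open>A description of \<open>g\<close> without Pluecker coordinates: \<open>g(N|t)\<close> is the band matrix whose columns at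
  \<open>\<lambda> = lam k t\<close> lie in \<open>N\<close>. That \<open>F\<close> has full rank is a consequence, because a band matrix has rank at
  least \<open>k\<close> everywhere outside \<open>\<lambda> = 0\<close>.\<close>

definition g_of :: "nat \<Rightarrow> nat \<Rightarrow> point \<Rightarrow> complex poly mat \<Rightarrow> bool" where
  "g_of n k x G \<longleftrightarrow> banded n (n - k) G \<and> snd x \<noteq> 0 \<and>
    (\<exists>F X. F \<in> carrier_mat n k \<and> X \<in> carrier_mat k n \<and> fst x = colspan n F \<and>
      ev (lam k (snd x)) G = F * X)"

subsection \<open>Triangularity of band matrices\<close>

lemma banded_gap:
  assumes A: "banded n (n - k) A" and k: "0 < k" "k < n" and c: "c < n" and q: "0 < q" "q < k"
  shows "A $$ ((c + (n - k) + q) mod n, c) = 0"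
proof (rule poly_eqI)
  fix m
  define i where "i = (c + (n - k) + q) mod n"
  have i: "i < n" using k by (simp add: i_def)
  have "i \<in> cyc n (Suc (c + (n - k))) (k - 1)"
    unfolding cyc_def i_def using q by (intro image_eqI[of _ _ "q - 1"]) auto
  then have h: "i < c \<and> c < i + k \<or> c + (n - k) < i" by (simp only: cyc_gap_iff[OF k i c])
  have "i + n * m < c \<or> c + (n - k) < i + n * m"
  proof (cases m)
    case (Suc m')
    then have "n \<le> n * m" by simp
    then show ?thesis using h k by linarith
  qed (use h in auto)
  then show "coeff (A $$ ((c + (n - k) + q) mod n, c)) m = coeff 0 m"
    using banded_zero[OF A i c] unfolding i_def by simp
qed

lemma banded_corner:
  assumes A: "banded n (n - k) A" and k: "0 < k" "k < n" and c: "c < n"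
  shows "A $$ ((c + (n - k)) mod n, c) = (if c < k then [:1:] else [:0, 1:])"
proof (cases "c < k")
  case True
  then have "coeff (A $$ (c + (n - k), c)) 0 = 1"
    by (intro banded_top[OF A _ c]) (use k in auto)
  moreover have "A $$ (c + (n - k), c) = [:coeff (A $$ (c + (n - k), c)) 0:]"
    by (subst banded_entry[OF A _ _ c]) (use True k in auto)
  moreover have "(c + (n - k)) mod n = c + (n - k)" using True k by simp
  ultimately show ?thesis using True by auto
next
  case False
  have e: "(c + (n - k)) mod n = c - k" using False k c by (simp add: mod_if)
  have "coeff (A $$ (c - k, c)) 1 = 1"
    by (rule banded_top[OF A _ c]) (use k c False in auto)
  moreover have "A $$ (c - k, c) = [:0, coeff (A $$ (c - k, c)) 1:]"
    by (subst banded_entry[OF A _ _ c]) (use False k c in auto)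
  ultimately show ?thesis using False e by auto
qed

text \<open>Restricted to the rows of the cyclic interval of length \<open>k\<close> that starts at the corner of column
  \<open>c\<close>, the columns \<open>c, c + 1, \<dots>\<close> form a triangular matrix with the corners on the diagonal.\<close>

lemma banded_triangular:
  assumes A: "banded n (n - k) A" and k: "0 < k" "k < n" and z: "z \<noteq> 0" and c: "c < n"
    and w: "\<And>r. r < k \<Longrightarrow> (\<Sum>i\<in>cyc n (c + (n - k)) k. w i * ev z A $$ (i, (c + r) mod n)) = 0"
  shows "\<forall>i\<in>cyc n (c + (n - k)) k. w i = (0::complex)"
proof -
  have AC: "A \<in> carrier_mat n n" using A by (simp add: banded_carrier)
  define idx where "idx r = (c + (n - k) + r) mod n" for r
  have idx: "idx r < n" for r using k by (simp add: idx_def)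
  have shift: "idx (r + q) = ((c + r) mod n + (n - k) + q) mod n" for r q
  proof -
    have "((c + r) mod n + (n - k) + q) mod n = ((c + r) mod n + ((n - k) + q)) mod n"
      by (simp add: ac_simps)
    also have "\<dots> = (c + r + ((n - k) + q)) mod n" by (rule mod_add_left_eq)
    finally show ?thesis unfolding idx_def by (simp add: ac_simps)
  qed
  have "w (idx r) = 0" if "r < k" for r
    using that
  proof (induction r rule: less_induct)
    case (less r)
    let ?d = "(c + r) mod n"
    have d: "?d < n" using k by simp
    have zero: "w (idx s) * ev z A $$ (idx s, ?d) = 0" if s: "s < k" "s \<noteq> r" for s
    proof (cases "s < r")
      case True
      then show ?thesis using less.IH[of s] s by simp
    next
      case False
      then obtain q where q: "s = r + q" "0 < q" using s less_imp_add_positive[of r s] by auto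
      have "A $$ (idx s, ?d) = 0"
        unfolding q shift using banded_gap[OF A k d q(2)] q s by auto
      then show ?thesis using AC d idx by simp
    qed
    have "0 = (\<Sum>i\<in>cyc n (c + (n - k)) k. w i * ev z A $$ (i, ?d))" using w[OF less.prems] by simp
    also have "\<dots> = (\<Sum>s<k. w (idx s) * ev z A $$ (idx s, ?d))"
      unfolding cyc_def idx_def using k by (subst sum.reindex[OF inj_on_cyc]) auto
    also have "\<dots> = (\<Sum>s<k. if s = r then w (idx r) * ev z A $$ (idx r, ?d) else 0)"
      using zero by (intro sum.cong refl) auto
    also have "\<dots> = w (idx r) * ev z A $$ (idx r, ?d)" using less.prems by simp
    finally have "w (idx r) * ev z A $$ (idx r, ?d) = 0" by simp
    moreover have "A $$ (idx r, ?d) = (if ?d < k then [:1:] else [:0, 1:])"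
      using shift[of r 0] banded_corner[OF A k d] by simp
    ultimately show ?case using z AC d idx by (auto split: if_splits)
  qed
  then show ?thesis by (auto simp: cyc_def idx_def)
qed

lemma banded_image_minor:
  assumes A: "banded n (n - k) A" and k: "0 < k" "k < n" and z: "z \<noteq> 0" and c: "c < n"
    and F: "F \<in> carrier_mat n k" and X: "X \<in> carrier_mat k n" and eq: "ev z A = F * X"
  shows "minor (cyc n (c + (n - k)) k) F \<noteq> 0"
proof (rule minor_nonzeroI_left[OF F])
  let ?J = "cyc n (c + (n - k)) k"
  show J: "?J \<subseteq> {..<n}" "card ?J = k" using k by (auto simp: cyc_subset card_cyc)
  fix w assume w: "\<And>m. m < k \<Longrightarrow> (\<Sum>i\<in>?J. w i * F $$ (i, m)) = (0::complex)"
  have "(\<Sum>i\<in>?J. w i * ev z A $$ (i, d)) = 0" if d: "d < n" for d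
  proof -
    have "(\<Sum>i\<in>?J. w i * ev z A $$ (i, d)) = (\<Sum>i\<in>?J. \<Sum>m<k. w i * F $$ (i, m) * X $$ (m, d))"
      unfolding eq using F X J d
      by (intro sum.cong refl) (auto simp: scalar_prod_def sum_distrib_left mult.assoc atLeast0LessThan subset_iff)
    also have "\<dots> = (\<Sum>m<k. (\<Sum>i\<in>?J. w i * F $$ (i, m)) * X $$ (m, d))"
      by (subst sum.swap) (simp add: sum_distrib_right)
    finally show ?thesis using w by simp
  qed
  then show "\<forall>i\<in>?J. w i = 0"
    by (intro banded_triangular[OF A k z c]) (use k in auto)
qed

definition first_cols :: "nat \<Rightarrow> 'a mat \<Rightarrow> 'a mat" where
  "first_cols k A = mat (dim_row A) k (\<lambda>(i, j). A $$ (i, j))"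

lemma first_cols_carrier: "A \<in> carrier_mat n m \<Longrightarrow> first_cols k A \<in> carrier_mat n k"
  by (simp add: first_cols_def)

lemma first_cols_mult:
  "A \<in> carrier_mat n m \<Longrightarrow> B \<in> carrier_mat m l \<Longrightarrow> k \<le> l \<Longrightarrow> first_cols k (A * B) = A * first_cols k B"
  by (intro eq_matI) (auto simp: first_cols_def scalar_prod_def)

lemma banded_first_cols_full_rank:
  assumes A: "banded n (n - k) A" and k: "0 < k" "k < n" and z: "z \<noteq> 0"
  shows "first_cols k (ev z A) \<in> full_rank_mats n k"
proof (rule full_rank_of_minor)
  let ?J = "cyc n (0 + (n - k)) k"
  have AC: "A \<in> carrier_mat n n" using A by (simp add: banded_carrier)
  then show B: "first_cols k (ev z A) \<in> carrier_mat n k" by (simp add: first_cols_def)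
  show J: "?J \<subseteq> {..<n}" "card ?J = k" using k by (auto simp: cyc_subset card_cyc)
  show "minor ?J (first_cols k (ev z A)) \<noteq> 0"
  proof (rule minor_nonzeroI_left[OF B J])
    fix w assume w: "\<And>m. m < k \<Longrightarrow> (\<Sum>i\<in>?J. w i * first_cols k (ev z A) $$ (i, m)) = (0::complex)"
    show "\<forall>i\<in>?J. w i = 0"
    proof (rule banded_triangular[OF A k z])
      fix r assume r: "r < k"
      have "(\<Sum>i\<in>?J. w i * ev z A $$ (i, (0 + r) mod n)) = (\<Sum>i\<in>?J. w i * first_cols k (ev z A) $$ (i, r))"
        using r k J(1) AC by (intro sum.cong refl) (auto simp: first_cols_def subset_iff)
      then show "(\<Sum>i\<in>?J. w i * ev z A $$ (i, (0 + r) mod n)) = 0" using w[OF r] by simp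
    qed (use k in auto)
  qed
qed

subsection \<open>Minors with one varying row\<close>

lemma card_insert_below:
  fixes K :: "nat set"
  assumes "finite K" "i \<notin> K" "a \<in> K"
  shows "card {b \<in> insert i K. b < a} = insert_index (card {b \<in> K. b < i}) (card {b \<in> K. b < a})"
proof (cases "a < i")
  case True
  have "{b \<in> insert i K. b < a} = {b \<in> K. b < a}" using True by auto
  moreover have "card {b \<in> K. b < a} < card {b \<in> K. b < i}"
    by (rule psubset_card_mono) (use assms True in auto)
  ultimately show ?thesis by (simp add: insert_index_def)
next
  case False
  then have ia: "i < a" using assms by (metis linorder_neqE_nat)
  have "{b \<in> insert i K. b < a} = insert i {b \<in> K. b < a}" using ia by auto
  then have "card {b \<in> insert i K. b < a} = Suc (card {b \<in> K. b < a})" using assms by simp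
  moreover have "card {b \<in> K. b < i} \<le> card {b \<in> K. b < a}"
    by (rule card_mono) (use assms ia in auto)
  ultimately show ?thesis by (simp add: insert_index_def)
qed

lemma pick_insert:
  fixes K :: "nat set"
  assumes K: "finite K" "i \<notin> K" and q: "q < card K"
  shows "pick (insert i K) (insert_index (card {b \<in> K. b < i}) q) = pick K q"
proof -
  have a: "pick K q \<in> K" using pick_in_set_le[OF q] .
  have "card {b \<in> K. b < pick K q} = q" using q by (simp add: card_pick)
  then have "card {b \<in> insert i K. b < pick K q} = insert_index (card {b \<in> K. b < i}) q"
    using card_insert_below[OF K a] by simp
  then show ?thesis using pick_card_in_set[of "pick K q" "insert i K"] a by auto
qed

text \<open>Laplace expansion along the row \<open>i\<close>. The cofactors \<open>E\<close> only depend on the rows in \<open>K\<close>, so up to sign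
  the minors with one row varying are the entries of one vector of the column span. For \<open>i\<close> in \<open>K\<close> the
  same sum is a determinant with a repeated row.\<close>

lemma minor_insert_expansion:
  assumes F: "F \<in> carrier_mat n k" and K: "K \<subseteq> {..<n}" "Suc (card K) = k"
  obtains E where "E \<in> carrier_vec k"
    "\<And>i. i < n \<Longrightarrow> i \<notin> K \<Longrightarrow> minor (insert i K) F = (- 1) ^ card {b \<in> K. b < i} * (F *\<^sub>v E) $ i"
    "\<And>i. i \<in> K \<Longrightarrow> (F *\<^sub>v E) $ i = 0"
proof -
  have fK: "finite K" using K(1) finite_subset by blast
  define M where "M i = mat k k (\<lambda>(r, m). if r = 0 then F $$ (i, m) else F $$ (pick K (r - 1), m))" for i
  define E where "E = vec k (\<lambda>m. cofactor (M 0) 0 m)"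
  have Mc: "M i \<in> carrier_mat k k" for i by (simp add: M_def)
  have k: "0 < k" using K by auto
  have cof: "cofactor (M i) 0 m = cofactor (M 0) 0 m" for i m
    unfolding cofactor_def
    by (intro arg_cong[where f = "\<lambda>x. _ * det x"] eq_matI) (auto simp: mat_delete_def M_def)
  have detM: "det (M i) = (F *\<^sub>v E) $ i" if i: "i < n" for i
  proof -
    have "det (M i) = (\<Sum>m<k. M i $$ (0, m) * cofactor (M i) 0 m)"
      by (rule laplace_expansion_row[OF Mc k])
    also have "\<dots> = (\<Sum>m<k. F $$ (i, m) * E $ m)"
      using k by (intro sum.cong refl) (simp only: cof[of i], simp add: M_def E_def)
    also have "\<dots> = (F *\<^sub>v E) $ i"
      using i F by (simp add: scalar_prod_def atLeast0LessThan E_def)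
    finally show ?thesis .
  qed
  show ?thesis
  proof (rule that[of E])
    show "E \<in> carrier_vec k" by (simp add: E_def)
  next
    fix i assume i: "i < n" "i \<notin> K"
    let ?p = "card {b \<in> K. b < i}" and ?S = "submatrix F (insert i K) UNIV"
    have "?p \<le> card K" by (rule card_mono[OF fK]) auto
    then have p: "?p < k" using K(2) by simp
    have S: "?S = mat k k (\<lambda>(a, j). F $$ (pick (insert i K) a, j))"
      by (rule submatrix_rows_eq[OF F]) (use i K fK in auto)
    have pp: "pick (insert i K) ?p = i"
    proof -
      have "{b \<in> insert i K. b < i} = {b \<in> K. b < i}" by auto
      then show ?thesis using pick_card_in_set[of i "insert i K"] by simp
    qed
    have del: "mat_delete ?S ?p m = mat_delete (M i) 0 m" if m: "m < k" for m
    proof (rule eq_matI)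
      fix a b assume "a < dim_row (mat_delete (M i) 0 m)" "b < dim_col (mat_delete (M i) 0 m)"
      then have ab: "a < k - 1" "b < k - 1" using Mc[of i] by auto
      have "pick (insert i K) (insert_index ?p a) = pick K a"
        by (rule pick_insert[OF fK i(2)]) (use ab K in auto)
      then show "mat_delete ?S ?p m $$ (a, b) = mat_delete (M i) 0 m $$ (a, b)"
        using ab m by (simp add: S mat_delete_def M_def insert_index_def del: pick.simps split: if_splits)
    qed (use S in \<open>auto simp: M_def\<close>)
    have "minor (insert i K) F = (\<Sum>m<k. ?S $$ (?p, m) * cofactor ?S ?p m)"
      unfolding minor_def by (rule laplace_expansion_row[OF _ p]) (simp add: S)
    also have "\<dots> = (\<Sum>m<k. (- 1) ^ ?p * (M i $$ (0, m) * cofactor (M i) 0 m))"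
    proof (intro sum.cong refl)
      fix m assume "m \<in> {..<k}"
      then have m: "m < k" by simp
      have "?S $$ (?p, m) = M i $$ (0, m)" unfolding S M_def using p m k pp by simp
      then show "?S $$ (?p, m) * cofactor ?S ?p m = (- 1) ^ ?p * (M i $$ (0, m) * cofactor (M i) 0 m)"
        unfolding cofactor_def del[OF m] by (simp add: power_add)
    qed
    also have "\<dots> = (- 1) ^ ?p * det (M i)"
      by (simp add: laplace_expansion_row[OF Mc k, of i] sum_distrib_left)
    finally show "minor (insert i K) F = (- 1) ^ ?p * (F *\<^sub>v E) $ i" using detM[OF i(1)] by simp
  next
    fix i assume i: "i \<in> K"
    define a where "a = card {b \<in> K. b < i}"
    have "{b \<in> K. b < i} \<subset> K" using i by auto
    then have "a < card K" unfolding a_def by (rule psubset_card_mono[OF fK])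
    moreover have "pick K a = i" unfolding a_def by (rule pick_card_in_set[OF i])
    ultimately have a: "a < card K" "pick K a = i" by auto
    have "det (M i) = 0"
    proof (rule det_identical_rows[OF Mc])
      show "0 \<noteq> Suc a" "0 < k" "Suc a < k" using a K by auto
      show "row (M i) 0 = row (M i) (Suc a)"
        using a K by (intro eq_vecI) (auto simp: M_def)
    qed
    then show "(F *\<^sub>v E) $ i = 0" using detM[of i] i K by auto
  qed
qed

subsection \<open>Existence and uniqueness\<close>

text \<open>Columns are counted from 0. Column \<open>j\<close> of a \<open>g\<close>-matrix vanishes on the gap of \<open>j\<close>; the window of \<open>j\<close>
  consists of the gap and the row \<open>(j + (n - k)) mod n\<close> of the corner, the entry of top grade. The
  denominators in the definition of \<open>g\<close> are the minors of the windows.\<close>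

definition window :: "nat \<Rightarrow> nat \<Rightarrow> nat \<Rightarrow> nat set" where
  "window n k j = cyc n (j + (n - k)) k"

definition gap :: "nat \<Rightarrow> nat \<Rightarrow> nat \<Rightarrow> nat set" where
  "gap n k j = cyc n (Suc (j + (n - k))) (k - 1)"

lemma window_eq_insert: "0 < k \<Longrightarrow> window n k j = insert ((j + (n - k)) mod n) (gap n k j)"
  unfolding window_def gap_def using cyc_Suc[of n "j + (n - k)" "k - 1"] by simp

lemma window_subset: "0 < n \<Longrightarrow> window n k j \<subseteq> {..<n}"
  by (simp add: window_def cyc_subset)

lemma card_window: "k \<le> n \<Longrightarrow> card (window n k j) = k"
  by (simp add: window_def card_cyc)

lemma gap_subset: "0 < n \<Longrightarrow> gap n k j \<subseteq> {..<n}"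
  by (simp add: gap_def cyc_subset)

lemma card_gap: "k < n \<Longrightarrow> card (gap n k j) = k - 1"
  by (simp add: gap_def card_cyc)

lemma row_set_window:
  assumes "0 < k" "k < n"
  shows "row_set n {int c + 1 - int k..int c} = window n k c"
proof -
  have e: "int c + 1 - int k - 1 + int n = int (c + (n - k))" using assms by auto
  have "(int c + 1 - int k - 1) mod int n = int (c + (n - k)) mod int n"
    unfolding e[symmetric] by simp
  from row_set_interval[OF _ this, of k] show ?thesis using assms by (simp add: window_def)
qed

lemma row_set_gap:
  assumes "0 < k" "k < n"
  shows "row_set n {int c + 1 - int k + 1..int c} = gap n k c"
proof -
  have e: "int c + 1 - int k + 1 - 1 + int n = int (Suc (c + (n - k)))" using assms by auto
  have "(int c + 1 - int k + 1 - 1) mod int n = int (Suc (c + (n - k))) mod int n"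
    unfolding e[symmetric] by simp
  from row_set_interval[OF _ this, of "k - 1"] show ?thesis using assms by (simp add: gap_def)
qed

text \<open>The quotient of Pluecker coordinates in the definition of \<open>g\<close>.\<close>

definition minor_ratio :: "nat \<Rightarrow> nat \<Rightarrow> complex mat \<Rightarrow> nat \<Rightarrow> nat \<Rightarrow> complex" where
  "minor_ratio n k F i j =
    (if i \<in> gap n k j then 0 else minor (insert i (gap n k j)) F / minor (window n k j) F)"

lemma card_insert_gap:
  "0 < k \<Longrightarrow> k < n \<Longrightarrow> card (insert i (gap n k j)) = (if i \<in> gap n k j then k - 1 else k)"
  using card_gap[of k n j] by (auto simp: insert_absorb card_insert_if gap_def)

lemma g_mat_colspan:
  assumes F: "F \<in> full_rank_mats n k" and k: "0 < k" "k < n"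
  shows "g_mat n k (colspan n F, t) =
    (if \<forall>c<n. minor (window n k c) F \<noteq> 0
     then Some (mat n n (\<lambda>(i, j). Polynomial.smult (minor_ratio n k F i j)
            (if j < k then 1 else if j \<le> i then [:t:] else [:0, 1:])))
     else None)"
proof -
  have n: "n > 0" using k by simp
  obtain c where c: "c \<noteq> 0" and P: "\<And>I. pluecker n k (colspan n F) I =
      (if card (row_set n I) = k then c * minor (row_set n I) F else 0)"
    by (rule pluecker_colspan[OF F n]) auto
  have W: "pluecker n k (colspan n F) {int j + 1 - int k..int j} = c * minor (window n k j) F" for j
    using k unfolding P row_set_window[OF k] by (simp add: card_window)
  have "{1..int n} = (\<lambda>c. int c + 1) ` {..<n}"
  proof (intro equalityI subsetI)
    fix x assume "x \<in> {1..int n}"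
    then show "x \<in> (\<lambda>c. int c + 1) ` {..<n}" by (intro image_eqI[of _ _ "nat (x - 1)"]) auto
  qed auto
  then have good: "(\<forall>j\<in>{1..int n}. pluecker n k (fst (colspan n F, t)) {j - int k..j - 1} \<noteq> 0) \<longleftrightarrow>
      (\<forall>c<n. minor (window n k c) F \<noteq> 0)"
    using W c by (simp, auto)
  have entry: "g_entry n k (colspan n F, t) (int i + 1) (int j + 1) =
      Polynomial.smult (minor_ratio n k F i j)
            (if j < k then 1 else if j \<le> i then [:t:] else [:0, 1:])" if "i < n" "j < n" for i j
  proof -
    have "row_set n ({int j + 1 - int k + 1..int j + 1 - 1} \<union> {int i + 1}) = insert i (gap n k j)"
      using that row_set_gap[OF k, of j] by (simp only: row_set_Un row_set_singleton) simp
    then have "pluecker n k (colspan n F) ({int j + 1 - int k + 1..int j + 1 - 1} \<union> {int i + 1}) =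
        (if i \<in> gap n k j then 0 else c * minor (insert i (gap n k j)) F)"
      using k by (auto simp only: P card_insert_gap[OF k] split: if_splits)
    moreover have "pluecker n k (colspan n F) {int j + 1 - int k..int j + 1 - 1} = c * minor (window n k j) F"
      using W[of j] by simp
    ultimately have "pluecker n k (colspan n F) ({int j + 1 - int k + 1..int j + 1 - 1} \<union> {int i + 1}) /
        pluecker n k (colspan n F) {int j + 1 - int k..int j + 1 - 1} = minor_ratio n k F i j"
      using c by (simp only: minor_ratio_def) simp
    moreover have "(int j + 1 \<le> int k) = (j < k)" "(int i + 1 \<ge> int j + 1) = (j \<le> i)" by auto
    ultimately show ?thesis unfolding g_entry_def by (simp only: prod.case)
  qed
  have "mat n n (\<lambda>(i, j). g_entry n k (colspan n F, t) (int i + 1) (int j + 1)) =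
    mat n n (\<lambda>(i, j). Polynomial.smult (minor_ratio n k F i j)
            (if j < k then 1 else if j \<le> i then [:t:] else [:0, 1:]))"
    by (intro eq_matI) (simp_all add: entry)
  then show ?thesis unfolding g_mat_def good by simp
qed

lemma mat_mult_index_vec:
  "A \<in> carrier_mat n k \<Longrightarrow> X \<in> carrier_mat k m \<Longrightarrow> i < n \<Longrightarrow> j < m \<Longrightarrow> (A * X) $$ (i, j) = (A *\<^sub>v col X j) $ i"
  by simp

text \<open>The column \<open>j\<close> of \<open>g\<close> is the vector of \<open>N\<close>, unique up to a scalar, that vanishes on the gap of \<open>j\<close>;
  its entries are minors of the frame by Cramer's rule.\<close>

lemma g_mat_imp_g_of:
  assumes F: "F \<in> full_rank_mats n k" and k: "0 < k" "k < n" and t: "t \<noteq> 0"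
    and G: "g_mat n k (colspan n F, t) = Some G"
  shows "g_of n k (colspan n F, t) G"
proof -
  have n: "n > 0" using k by simp
  have Fc: "F \<in> carrier_mat n k" using F by (simp add: full_rank_mats_iff)
  have nz: "minor (window n k c) F \<noteq> 0" if "c < n" for c
    using G that unfolding g_mat_colspan[OF F k] by (auto split: if_splits)
  have Gd: "G = mat n n (\<lambda>(i, j). Polynomial.smult (minor_ratio n k F i j)
            (if j < k then 1 else if j \<le> i then [:t:] else [:0, 1:]))"
    using G unfolding g_mat_colspan[OF F k] by (auto split: if_splits)
  have gap_iff: "i \<in> gap n k j \<longleftrightarrow> i < j \<and> j < i + k \<or> j + (n - k) < i" if "i < n" "j < n" for i j
    unfolding gap_def using cyc_gap_iff[OF k that] .
  have corner: "minor_ratio n k F ((j + (n - k)) mod n) j = 1" if j: "j < n" for j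
  proof -
    have "(j + (n - k)) mod n \<notin> gap n k j"
    proof
      assume "(j + (n - k)) mod n \<in> gap n k j"
      then have "window n k j = gap n k j" using window_eq_insert[OF k(1), of n j] by auto
      then show False using card_window[of k n j] card_gap[of k n j] k by simp
    qed
    then show ?thesis
      using nz[OF j] unfolding minor_ratio_def window_eq_insert[OF k(1)] by simp
  qed
  have band: "banded n (n - k) G"
  proof (rule bandedI)
    show "G \<in> carrier_mat n n" unfolding Gd by simp
    fix i j m assume ij: "i < n" "j < n"
    have co: "coeff (G $$ (i, j)) m = minor_ratio n k F i j *
        coeff (if j < k then 1 else if j \<le> i then [:t:] else [:0, 1:]) m"
      unfolding Gd using ij by simp
    {
      assume out: "i + n * m < j \<or> j + (n - k) < i + n * m"
      show "coeff (G $$ (i, j)) m = 0"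
      proof (cases "coeff (if j < k then 1 else if j \<le> i then [:t:] else [:0, 1:]) m = 0")
        case False
        then have "(j < k \<or> j \<le> i) \<and> m = 0 \<or> \<not> j < k \<and> \<not> j \<le> i \<and> m = 1"
          by (auto simp: coeff_pCons split: if_splits nat.splits)
        then have "i \<in> gap n k j" unfolding gap_iff[OF ij] using out k ij by auto
        then show ?thesis unfolding co minor_ratio_def by simp
      qed (simp add: co)
    }
    {
      assume top: "i + n * m = j + (n - k)"
      have i: "i = (j + (n - k)) mod n" using ij by (simp flip: top)
      have "j < k \<and> m = 0 \<or> \<not> j < k \<and> \<not> j \<le> i \<and> m = 1"
      proof (cases m)
        case 0 then show ?thesis using top ij k by auto
      next
        case (Suc m')
        then have "n * m = n + n * m'" by simp
        moreover have "m' = 0"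
        proof (rule ccontr)
          assume "m' \<noteq> 0"
          then have "n \<le> n * m'" by simp
          then show False using top \<open>n * m = _\<close> ij k by linarith
        qed
        ultimately show ?thesis using top Suc k ij by auto
      qed
      then show "coeff (G $$ (i, j)) m = 1"
        unfolding co using corner[OF ij(2)] by (auto simp flip: i)
    }
  qed
  have "\<exists>x\<in>carrier_vec k. \<forall>i<n. ev (lam k t) G $$ (i, j) = (F *\<^sub>v x) $ i" if j: "j < n" for j
  proof -
    have "Suc (card (gap n k j)) = k" using card_gap[of k n j] k by simp
    from minor_insert_expansion[OF Fc gap_subset[OF n] this]
    obtain E where E: "E \<in> carrier_vec k"
      and out: "\<And>i. i < n \<Longrightarrow> i \<notin> gap n k j \<Longrightarrow>
          minor (insert i (gap n k j)) F = (- 1) ^ card {b \<in> gap n k j. b < i} * (F *\<^sub>v E) $ i"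
      and inn: "\<And>i. i \<in> gap n k j \<Longrightarrow> (F *\<^sub>v E) $ i = 0" by metis
    \<comment> \<open>Sorting the row \<open>i\<close> into the gap costs a sign, which the factor in the definition of \<open>g\<close>
      and the sign in \<open>lam k t\<close> make independent of \<open>i\<close>.\<close>
    define e where "e = (if j < k then (- 1) ^ j else (- 1) ^ (k - 1) * t) / minor (window n k j) F"
    have "ev (lam k t) G $$ (i, j) = e * (F *\<^sub>v E) $ i" if i: "i < n" for i
    proof (cases "i \<in> gap n k j")
      case True
      then show ?thesis unfolding Gd using i j inn[OF True] by (simp add: minor_ratio_def)
    next
      case False
      have ng: "\<not> (i < j \<and> j < i + k \<or> j + (n - k) < i)" using False gap_iff[OF i j] by simp
      have sub: "b < n" if "b \<in> gap n k j" for b using gap_subset[OF n, of k j] that by auto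
      have lo: "{b \<in> gap n k j. b < i} = {b. b < i \<and> (b < j \<and> j < b + k \<or> j + (n - k) < b)}"
        using gap_iff[OF _ j] sub i by (auto simp del: not_less)
      have card: "(if j < k then 1 else if j \<le> i then t else lam k t) * (- 1) ^ card {b \<in> gap n k j. b < i}
          = (if j < k then (- 1) ^ j else (- 1) ^ (k - 1) * t)"
      proof (cases "j < k")
        case True
        then have "{b. b < i \<and> (b < j \<and> j < b + k \<or> j + (n - k) < b)} = {..<j}" using ng by auto
        then show ?thesis using True unfolding lo by simp
      next
        case jk: False
        show ?thesis
        proof (cases "j \<le> i")
          case True
          then have "{b. b < i \<and> (b < j \<and> j < b + k \<or> j + (n - k) < b)} = {Suc j - k..<j}"
            using ng jk i by auto
          then show ?thesis using True jk unfolding lo by simp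
        next
          case False
          then have e: "{b. b < i \<and> (b < j \<and> j < b + k \<or> j + (n - k) < b)} = {}" using ng by auto
          show ?thesis using False jk unfolding lo e by (simp add: lam_def)
        qed
      qed
      have "ev (lam k t) G $$ (i, j) =
          minor (insert i (gap n k j)) F / minor (window n k j) F * (if j < k then 1 else if j \<le> i then t else lam k t)"
        unfolding Gd using i j False by (simp add: minor_ratio_def)
      also have "\<dots> = ((if j < k then 1 else if j \<le> i then t else lam k t) * (- 1) ^ card {b \<in> gap n k j. b < i})
          * (F *\<^sub>v E) $ i / minor (window n k j) F"
        unfolding out[OF i False] by simp
      also have "\<dots> = e * (F *\<^sub>v E) $ i" unfolding card e_def by simp
      finally show ?thesis .
    qed
    then show ?thesis using E Fc by (intro bexI[of _ "e \<cdot>\<^sub>v E"]) (auto simp: mult_mat_vec[OF Fc E])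
  qed
  then obtain x where x: "\<And>j. j < n \<Longrightarrow> x j \<in> carrier_vec k \<and> (\<forall>i<n. ev (lam k t) G $$ (i, j) = (F *\<^sub>v x j) $ i)"
    by metis
  define X where "X = mat k n (\<lambda>(m, j). x j $ m)"
  have X: "X \<in> carrier_mat k n" by (simp add: X_def)
  have "ev (lam k t) G = F * X"
  proof (rule eq_matI)
    fix i j assume "i < dim_row (F * X)" "j < dim_col (F * X)"
    then have ij: "i < n" "j < n" using Fc X by auto
    have "col X j = x j" using x[OF ij(2)] ij by (intro eq_vecI) (auto simp: X_def)
    then show "ev (lam k t) G $$ (i, j) = (F * X) $$ (i, j)"
      using x[OF ij(2)] ij mat_mult_index_vec[OF Fc X ij] by simp
  qed (use Fc X banded_carrier[OF band] in auto)
  then show ?thesis unfolding g_of_def using band t Fc X by auto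
qed

text \<open>Conversely, a band matrix whose value at one point has rank \<open>k\<close> can only be \<open>g\<close> of its
  image: each column is the unique vector of the image with the prescribed zeros and corner.\<close>

lemma banded_rank_imp:
  assumes G: "banded n (n - k) G" and k: "0 < k" "k < n" and t: "t \<noteq> 0"
    and F: "F \<in> carrier_mat n k" and X: "X \<in> carrier_mat k n" and eq: "ev (lam k t) G = F * X"
  shows "F \<in> full_rank_mats n k"
    and "g_mat n k (colspan n F, t) = Some G"
    and "pi_map n k t G = Some (colspan n F, t)"
    and "det (first_cols k X) \<noteq> 0"
proof -
  have GC: "G \<in> carrier_mat n n" using G by (simp add: banded_carrier)
  have n: "n > 0" using k by simp
  have z: "lam k t \<noteq> 0" using t by simp
  have B: "first_cols k (ev (lam k t) G) \<in> full_rank_mats n k"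
    by (rule banded_first_cols_full_rank[OF G k z])
  have BX: "first_cols k (ev (lam k t) G) = F * first_cols k X"
    unfolding eq by (rule first_cols_mult[OF F X]) (use k in simp)
  have Xc: "first_cols k X \<in> carrier_mat k k" using X by (rule first_cols_carrier)
  note fac = full_rank_factors[OF F Xc B[unfolded BX]]
  show Ff: "F \<in> full_rank_mats n k" by (rule fac)
  show "det (first_cols k X) \<noteq> 0" by (rule fac)
  have "mat n k (\<lambda>(i, j). poly (G $$ (i, j)) ((- 1) ^ (k - 1) * t)) = first_cols k (ev (lam k t) G)"
    using GC k by (intro eq_matI) (auto simp: first_cols_def lam_def)
  then show "pi_map n k t G = Some (colspan n F, t)"
    unfolding pi_map_def Let_def using B BX fac(3) by simp
  have nz: "minor (window n k c) F \<noteq> 0" if "c < n" for c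
    unfolding window_def by (rule banded_image_minor[OF G k z that F X eq])
  then obtain G' where G': "g_mat n k (colspan n F, t) = Some G'"
    unfolding g_mat_colspan[OF Ff k] by auto
  have "g_of n k (colspan n F, t) G'" by (rule g_mat_imp_g_of[OF Ff k t G'])
  then obtain F' X' where G'b: "banded n (n - k) G'" and F': "F' \<in> carrier_mat n k" and X': "X' \<in> carrier_mat k n"
    and FF: "colspan n F = colspan n F'" and eq': "ev (lam k t) G' = F' * X'"
    unfolding g_of_def by auto
  have "F' * first_cols k X' \<in> full_rank_mats n k"
    using banded_first_cols_full_rank[OF G'b k z] first_cols_mult[OF F' X', of k] k unfolding eq' by simp
  then have "F' \<in> full_rank_mats n k"
    by (rule full_rank_factors(1)[OF F' first_cols_carrier[OF X']])
  then obtain Z where Z: "Z \<in> carrier_mat k k" "F' = F * Z"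
    using same_colspan_change_of_basis[OF Ff _ FF] by metis
  define Y where "Y = Z * X'"
  have Y: "Y \<in> carrier_mat k n" using Z X' by (simp add: Y_def)
  have eqY: "ev (lam k t) G' = F * Y" unfolding eq' Z(2) Y_def by (rule assoc_mult_mat[OF F Z(1) X'])
  have cols: "col X j = col Y j" if j: "j < n" for j
  proof -
    have Xj: "col X j \<in> carrier_vec k" and Yj: "col Y j \<in> carrier_vec k" using X Y j by auto
    have "col X j - col Y j = 0\<^sub>v k"
    proof (rule minor_nonzeroD_right[OF F window_subset[OF n] card_window nz[OF j]])
      fix i assume i: "i \<in> window n k j"
      then have in': "i < n" using window_subset[OF n] by auto
      have e: "G $$ (i, j) = G' $$ (i, j)"
      proof -
        obtain q where q: "q < k" "i = (j + (n - k) + q) mod n" using i unfolding window_def cyc_def by auto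
        show ?thesis
        proof (cases "q = 0")
          case True
          then show ?thesis using q banded_corner[OF G k j] banded_corner[OF G'b k j] by simp
        next
          case False
          then show ?thesis using q banded_gap[OF G k j] banded_gap[OF G'b k j] by simp
        qed
      qed
      have "(F *\<^sub>v (col X j - col Y j)) $ i = (F *\<^sub>v col X j - F *\<^sub>v col Y j) $ i"
        using mult_minus_distrib_mat_vec[OF F Xj Yj] by simp
      also have "\<dots> = (F * X) $$ (i, j) - (F * Y) $$ (i, j)"
        using F X Y in' j by simp
      also have "\<dots> = 0"
        using e GC banded_carrier[OF G'b] in' j unfolding eq[symmetric] eqY[symmetric] by simp
      finally show "(F *\<^sub>v (col X j - col Y j)) $ i = 0" .
    qed (use k Xj Yj in auto)
    then have d: "(col X j - col Y j) $ i = 0" if "i < k" for i using that by simp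
    show ?thesis
    proof (rule eq_vecI)
      fix i assume "i < dim_vec (col Y j)"
      then show "col X j $ i = col Y j $ i" using d[of i] Xj Yj Y by (simp del: index_col)
    qed (use X Y in simp)
  qed
  have "X = Y" using cols X Y
    by (intro eq_matI) (metis carrier_matD index_col, auto)
  then have "G = G'" using banded_eqI[OF G G'b _ z] eq eqY k by simp
  then show "g_mat n k (colspan n F, t) = Some G" using G' by simp
qed

lemma g_of_frame:
  assumes x: "g_of n k x G" and k: "0 < k" "k < n"
  obtains F X where "F \<in> full_rank_mats n k" "F \<in> carrier_mat n k" "X \<in> carrier_mat k n"
    "x = (colspan n F, snd x)" "ev (lam k (snd x)) G = F * X" "det (first_cols k X) \<noteq> 0"
    "snd x \<noteq> 0" "banded n (n - k) G" "g_mat n k x = Some G" "pi_map n k (snd x) G = Some x"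
    "\<And>c. c < n \<Longrightarrow> minor (window n k c) F \<noteq> 0"
proof -
  obtain F X where FX: "F \<in> carrier_mat n k" "X \<in> carrier_mat k n" "fst x = colspan n F"
      "ev (lam k (snd x)) G = F * X" and G: "banded n (n - k) G" and t: "snd x \<noteq> 0"
    using x unfolding g_of_def by auto
  have xe: "x = (colspan n F, snd x)" using FX(3) by (metis prod.collapse)
  note b = banded_rank_imp[OF G k t FX(1,2,4)]
  have "minor (window n k c) F \<noteq> 0" if "c < n" for c
    using b(2) that unfolding g_mat_colspan[OF b(1) k] by (auto split: if_splits)
  then show ?thesis using that[OF b(1) FX(1,2) xe FX(4) b(4) t G] b(2,3) xe by metis
qed

lemma g_of_iff:
  assumes k: "0 < k" "k < n"
  shows "g_of n k x G \<longleftrightarrow> x \<in> points (XX n k) \<and> g_mat n k x = Some G"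
proof
  assume "g_of n k x G"
  then obtain F X where "F \<in> full_rank_mats n k" "x = (colspan n F, snd x)" "snd x \<noteq> 0" "g_mat n k x = Some G"
    using g_of_frame[OF _ k] by metis
  then show "x \<in> points (XX n k) \<and> g_mat n k x = Some G"
    unfolding points_def XX_def by force
next
  assume x: "x \<in> points (XX n k) \<and> g_mat n k x = Some G"
  then obtain F t where "F \<in> full_rank_mats n k" "t \<noteq> 0" "x = (colspan n F, t)"
    unfolding points_def XX_def by auto
  then show "g_of n k x G" using g_mat_imp_g_of[OF _ k] x by auto
qed

lemma g_of_unique: "0 < k \<Longrightarrow> k < n \<Longrightarrow> g_of n k x G \<Longrightarrow> g_of n k x G' \<Longrightarrow> G = G'"
  by (simp add: g_of_iff)

lemma g_of_unique_point:
  assumes "0 < k" "k < n" "g_of n k x G" "g_of n k y G" "snd x = snd y"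
  shows "x = y"
  using assms g_of_frame by (metis option.inject)

lemma g_of_points: "0 < k \<Longrightarrow> k < n \<Longrightarrow> g_of n k x G \<Longrightarrow> x \<in> points (XX n k)"
  by (simp add: g_of_iff)

lemma g_of_carrier: "g_of n k x G \<Longrightarrow> G \<in> carrier_mat n n"
  by (auto simp: g_of_def banded_carrier)

lemma g_ofI:
  assumes "banded n (n - k) G" "t \<noteq> 0" "F \<in> carrier_mat n k" "X \<in> carrier_mat k n" "ev (lam k t) G = F * X"
  shows "g_of n k (colspan n F, t) G"
  unfolding g_of_def using assms by auto

section \<open>The involution \<open>S\<close>\<close>

lemma fl_carrier [simp]: "fl n A \<in> carrier_mat n n"
  by (simp add: fl_def)

lemma fl_fl: "A \<in> carrier_mat n n \<Longrightarrow> fl n (fl n A) = A"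
  by (intro eq_matI) (auto simp: fl_def)

lemma fl_mult:
  fixes A B :: "'a :: comm_ring_1 mat"
  assumes A: "A \<in> carrier_mat n n" and B: "B \<in> carrier_mat n n"
  shows "fl n (A * B) = fl n B * fl n A"
proof (rule eq_matI)
  fix i j assume "i < dim_row (fl n B * fl n A)" "j < dim_col (fl n B * fl n A)"
  then have ij: "i < n" "j < n" by (auto simp: fl_def)
  have "(\<Sum>l<n. A $$ (n - 1 - j, l) * B $$ (l, n - 1 - i)) =
      (\<Sum>l<n. A $$ (n - 1 - j, n - 1 - l) * B $$ (n - 1 - l, n - 1 - i))"
    by (rule sum.reindex_bij_witness[of _ "\<lambda>l. n - 1 - l" "\<lambda>l. n - 1 - l"]) auto
  then show "fl n (A * B) $$ (i, j) = (fl n B * fl n A) $$ (i, j)"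
    using ij A B by (simp add: fl_def scalar_prod_def atLeast0LessThan mult.commute)
qed (auto simp: fl_def)

lemma banded_fl:
  assumes A: "banded n d A"
  shows "banded n d (fl n A)"
proof (rule bandedI)
  fix i j m assume ij: "i < n" "j < n"
  then have ij': "n - 1 - j < n" "n - 1 - i < n" by auto
  have e: "fl n A $$ (i, j) = A $$ (n - 1 - j, n - 1 - i)" using ij by (simp add: fl_def)
  show "coeff (fl n A $$ (i, j)) m = 0" if "i + n * m < j \<or> j + d < i + n * m"
    unfolding e by (rule banded_zero[OF A ij']) (use that ij in linarith)
  show "coeff (fl n A $$ (i, j)) m = 1" if "i + n * m = j + d"
    unfolding e by (rule banded_top[OF A ij']) (use that ij in linarith)
qed simp

text \<open>Reflection in the antidiagonal turns the row space of \<open>g(N|t)\<close> into the column space, so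
  \<open>S\<close> is the map of points that corresponds to \<open>fl\<close> on matrices.\<close>

lemma geo_S_g_of:
  assumes x: "g_of n k x G" and k: "0 < k" "k < n"
  obtains x' where "geo_S n k x = Some x'" "g_of n k x' (fl n G)" "snd x' = snd x"
proof -
  obtain F X where F: "F \<in> carrier_mat n k" and X: "X \<in> carrier_mat k n"
    and xe: "x = (colspan n F, snd x)" and eq: "ev (lam k (snd x)) G = F * X"
    and t: "snd x \<noteq> 0" and G: "banded n (n - k) G" and gm: "g_mat n k x = Some G"
    by (rule g_of_frame[OF x k])
  have GC: "G \<in> carrier_mat n n" using G by (rule banded_carrier)
  define F' where "F' = mat n k (\<lambda>(i, m). X $$ (m, n - 1 - i))"
  define X' where "X' = mat k n (\<lambda>(m, j). F $$ (n - 1 - j, m))"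
  have F': "F' \<in> carrier_mat n k" and X': "X' \<in> carrier_mat k n" by (auto simp: F'_def X'_def)
  have "ev (lam k (snd x)) (fl n G) = fl n (F * X)"
    unfolding eq[symmetric] using GC by (intro eq_matI) (auto simp: fl_def)
  also have "\<dots> = F' * X'"
    using F X by (intro eq_matI) (auto simp: fl_def F'_def X'_def scalar_prod_def mult.commute)
  finally have e: "ev (lam k (snd x)) (fl n G) = F' * X'" .
  note b = banded_rank_imp[OF banded_fl[OF G] k t F' X' e]
  have "geo_S n k x = Some (colspan n F', snd x)"
    using gm b(3) by (subst (asm) xe, subst xe) (simp add: geo_S_def)
  then show ?thesis using that g_ofI[OF banded_fl[OF G] t F' X' e] by simp
qed

lemma geo_S2_g_of:
  assumes x: "g_of n l x A" and y: "g_of n k y B" and l: "0 < l" "l < n" and k: "0 < k" "k < n"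
  obtains x' y' where "geo_S2 n l k (x, y) = Some (y', x')" "geo_S n l x = Some x'" "geo_S n k y = Some y'"
    "g_of n l x' (fl n A)" "g_of n k y' (fl n B)" "snd x' = snd x" "snd y' = snd y"
proof -
  obtain x' where x': "geo_S n l x = Some x'" "g_of n l x' (fl n A)" "snd x' = snd x"
    by (rule geo_S_g_of[OF x l])
  obtain y' where y': "geo_S n k y = Some y'" "g_of n k y' (fl n B)" "snd y' = snd y"
    by (rule geo_S_g_of[OF y k])
  have "geo_S2 n l k (x, y) = Some (y', x')" using x' y' by (simp add: geo_S2_def)
  then show ?thesis using that x' y' by blast
qed

lemma geo_S_involution:
  assumes x: "g_of n k x G" and k: "0 < k" "k < n" and x': "geo_S n k x = Some x'"
  shows "geo_S n k x' = Some x"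
proof -
  have x'2: "g_of n k x' (fl n G)" "snd x' = snd x" using geo_S_g_of[OF x k] x' by auto
  obtain x'' where x'': "geo_S n k x' = Some x''" "g_of n k x'' (fl n (fl n G))" "snd x'' = snd x'"
    by (rule geo_S_g_of[OF x'2(1) k])
  then have "g_of n k x'' G" using g_of_carrier[OF x] by (simp add: fl_fl)
  then show ?thesis using g_of_unique_point[OF k _ x] x'' x'2 by simp
qed

section \<open>Duality and the inverse of \<open>g(N|t)\<close>\<close>

lemma minor_nonzeroI_right:
  assumes F: "F \<in> carrier_mat n k" and J: "J \<subseteq> {..<n}" "card J = k"
    and inj: "\<And>z. z \<in> carrier_vec k \<Longrightarrow> (\<And>i. i \<in> J \<Longrightarrow> (F *\<^sub>v z) $ i = 0) \<Longrightarrow> z = 0\<^sub>v k"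
  shows "minor J F \<noteq> 0"
proof
  let ?S = "submatrix F J UNIV"
  have S: "?S = mat k k (\<lambda>(a, j). F $$ (pick J a, j))" by (rule submatrix_rows_eq[OF F J])
  have Sc: "?S \<in> carrier_mat k k" using S by auto
  assume "minor J F = 0"
  then obtain z where z: "z \<in> carrier_vec k" "z \<noteq> 0\<^sub>v k" "?S *\<^sub>v z = 0\<^sub>v k"
    using det_0_iff_vec_prod_zero_field[OF Sc] unfolding minor_def by blast
  have "(F *\<^sub>v z) $ i = 0" if i: "i \<in> J" for i
  proof -
    have fJ: "finite J" using J finite_subset by blast
    define a where "a = card {b \<in> J. b < i}"
    have "{b \<in> J. b < i} \<subset> J" using i by auto
    then have a: "a < k" unfolding a_def J(2)[symmetric] by (rule psubset_card_mono[OF fJ])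
    have p: "pick J a = i" unfolding a_def by (rule pick_card_in_set[OF i])
    have "0 = (?S *\<^sub>v z) $ a" using z a by simp
    also have "\<dots> = (F *\<^sub>v z) $ i"
      using a i J(1) F z(1) p unfolding S by (auto simp: scalar_prod_def intro!: sum.cong)
    finally show ?thesis by simp
  qed
  then show False using inj z by blast
qed

lemma minor_nonzeroD_left:
  assumes F: "F \<in> carrier_mat n k" and J: "J \<subseteq> {..<n}" "card J = k" and nz: "minor J F \<noteq> 0"
    and w: "\<And>c. c < k \<Longrightarrow> (\<Sum>i\<in>J. w i * F $$ (i, c)) = (0::complex)" and i: "i \<in> J"
  shows "w i = 0"
proof -
  let ?S = "submatrix F J UNIV"
  have S: "?S = mat k k (\<lambda>(a, j). F $$ (pick J a, j))" by (rule submatrix_rows_eq[OF F J])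
  have Sc: "?S \<in> carrier_mat k k" "?S\<^sup>T \<in> carrier_mat k k" using S by auto
  note bij = bij_betw_pick[OF J]
  define v where "v = vec k (\<lambda>a. w (pick J a))"
  have "?S\<^sup>T *\<^sub>v v = 0\<^sub>v k"
  proof (rule eq_vecI)
    fix c assume "c < dim_vec (0\<^sub>v k)"
    then have c: "c < k" by simp
    have "(?S\<^sup>T *\<^sub>v v) $ c = (\<Sum>a<k. w (pick J a) * F $$ (pick J a, c))"
      using c unfolding S v_def by (simp add: scalar_prod_def atLeast0LessThan mult.commute)
    also have "\<dots> = (\<Sum>i\<in>J. w i * F $$ (i, c))" by (rule sum.reindex_bij_betw[OF bij])
    finally show "(?S\<^sup>T *\<^sub>v v) $ c = 0\<^sub>v k $ c" using w[OF c] c by simp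
  qed (use S in auto)
  moreover have "det (?S\<^sup>T) \<noteq> 0" using nz det_transpose[OF Sc(1)] by (simp add: minor_def)
  moreover have "v \<in> carrier_vec k" by (simp add: v_def)
  ultimately have v0: "v = 0\<^sub>v k" using det_0_iff_vec_prod_zero_field[OF Sc(2)] by blast
  have "i \<in> pick J ` {..<k}" using bij i by (simp add: bij_betw_def)
  then obtain a where a: "a < k" "pick J a = i" by auto
  have "w i = v $ a" using a by (simp add: v_def)
  then show ?thesis using v0 a by simp
qed

text \<open>In the cyclic order that starts with the window of length \<open>k\<close>, reversal of the rows takes position
  \<open>r\<close> to position \<open>n - 1 - r\<close>, so the positions from \<open>k\<close> on become the first \<open>n - k\<close> ones.\<close>

lemma cyc_reverse_complement:
  assumes k: "0 < k" "k < n" and c: "c < n" and i: "i < n" and ni: "i \<notin> window n k ((n - c) mod n)"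
  shows "n - 1 - i \<in> window n (n - k) c"
proof -
  let ?c = "(n - c) mod n"
  define a where "a = ?c + (n - k)"
  have surj: "(\<lambda>r. (a + r) mod n) ` {..<n} = {..<n}"
  proof (rule card_subset_eq)
    show "(\<lambda>r. (a + r) mod n) ` {..<n} \<subseteq> {..<n}" using i by auto
    show "card ((\<lambda>r. (a + r) mod n) ` {..<n}) = card {..<n}" by (rule card_image[OF inj_on_add_mod])
  qed simp
  have "i \<in> (\<lambda>r. (a + r) mod n) ` {..<n}" unfolding surj using i by simp
  then obtain r where r: "r < n" "i = (a + r) mod n" by blast
  have kr: "k \<le> r"
  proof (rule ccontr)
    assume "\<not> k \<le> r"
    then have "i \<in> window n k ?c" unfolding window_def cyc_def using r a_def by auto
    then show False using ni by simp
  qed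
  define b where "b = c + k"
  have ab: "(a + b) mod n = 0"
  proof -
    have "(a + b) mod n = (?c + c + n) mod n" unfolding a_def b_def using k by (simp add: ac_simps)
    also have "\<dots> = 0" using c by (cases "c = 0") auto
    finally show ?thesis .
  qed
  obtain p where p: "a + b = n * p" using ab by (auto simp: mod_eq_0_iff_dvd elim: dvdE)
  define q where "q = (a + r) div n"
  have q: "a + r = n * q + i" using r(2) by (simp add: q_def)
  have "b + (n - 1 - r) + n * q = (n - 1 - i) + n * p" using p q r(1) i by linarith
  then have "(b + (n - 1 - r)) mod n = (n - 1 - i) mod n" by (metis mod_mult_self2)
  then have "(b + (n - 1 - r)) mod n = n - 1 - i" using i by simp
  then show ?thesis unfolding window_def cyc_def b_def using kr r(1) k
    by (intro image_eqI[of _ _ "n - 1 - r"]) auto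
qed

text \<open>A vector of the orthogonal complement supported on a window is zero, because the frame is
  invertible on the window; hence the complementary minors of the complement do not vanish.\<close>

lemma mu_g_of:
  assumes x: "g_of n k x G" and k: "0 < k" "k < n"
  obtains Q where "g_of n (n - k) (mu n x) Q"
proof -
  obtain F where Ff: "F \<in> full_rank_mats n k" and F: "F \<in> carrier_mat n k"
    and xe: "x = (colspan n F, snd x)" and t: "snd x \<noteq> 0"
    and nz: "\<And>c. c < n \<Longrightarrow> minor (window n k c) F \<noteq> 0"
    by (rule g_of_frame[OF x k]) blast
  have n: "0 < n" using k by simp
  \<comment> \<open>Normalise the frame so that its last \<open>k\<close> rows form the identity matrix; then the first
    \<open>n - k\<close> coordinates of a vector of the complement are free and determine the others.\<close>
  let ?J = "window n k 0"
  have J: "?J = {n - k..<n}"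
  proof -
    have "?J \<subseteq> {n - k..<n}" unfolding window_def cyc_def using k by auto
    moreover have "card ?J = card {n - k..<n}" using card_window[of k n 0] k by simp
    ultimately show ?thesis by (intro card_subset_eq) auto
  qed
  define T where "T = submatrix F ?J UNIV"
  have Te: "T = mat k k (\<lambda>(a, j). F $$ (pick ?J a, j))"
    unfolding T_def by (rule submatrix_rows_eq[OF F window_subset[OF n] card_window]) (use k in simp)
  have T: "T \<in> carrier_mat k k" using Te by simp
  have "det T \<noteq> 0" using nz[of 0] k by (simp add: T_def minor_def)
  then obtain Y where Y: "Y \<in> carrier_mat k k" "T * Y = 1\<^sub>m k" "Y * T = 1\<^sub>m k"
    by (rule invertible_of_det[OF T])
  have dY: "det Y \<noteq> 0" by (rule det_nonzero_of_inverse[OF Y(1) T Y(3)])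
  define H where "H = F * Y"
  have H: "H \<in> carrier_mat n k" using F Y by (simp add: H_def)
  have "F * Y \<in> full_rank_mats n k" by (rule full_rank_right_mult[OF Ff Y(1) dY])
  then have csH: "colspan n F = colspan n H" using full_rank_factors(3)[OF F Y(1)] by (simp add: H_def)
  have nzH: "minor (window n k c) H \<noteq> 0" if "c < n" for c
    unfolding H_def using minor_mult[OF F Y(1) window_subset[OF n] card_window] nz[OF that] dY k by simp
  have pickJ: "pick ?J a = n - k + a" if "a < k" for a
  proof -
    have "{b \<in> ?J. b < n - k + a} = {n - k..<n - k + a}" unfolding J using that k by auto
    then have "card {b \<in> ?J. b < n - k + a} = a" by simp
    moreover have "n - k + a \<in> ?J" unfolding J using that k by auto
    ultimately show ?thesis using pick_card_in_set[of "n - k + a" ?J] by simp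
  qed
  have Hid: "H $$ (n - k + a, m) = (if a = m then 1 else 0)" if am: "a < k" "m < k" for a m
  proof -
    have "H $$ (n - k + a, m) = (T * Y) $$ (a, m)"
      unfolding H_def Te using am F Y(1) k pickJ[OF am(1)] by (simp add: scalar_prod_def)
    then show ?thesis using am Y(2) by simp
  qed
  define perp where "perp v \<longleftrightarrow> (\<forall>m<k. (\<Sum>i<n. (- 1) ^ i * v $ i * H $$ (i, m)) = 0)" for v :: "complex vec"
  have altp: "alt_perp n (colspan n F) = {v \<in> carrier_vec n. perp v}"
  proof (intro Set.set_eqI iffI)
    fix v assume v: "v \<in> alt_perp n (colspan n F)"
    have "(\<Sum>i<n. (- 1) ^ i * v $ i * H $$ (i, m)) = 0" if m: "m < k" for m
    proof -
      have "H *\<^sub>v unit_vec k m \<in> colspan n F" unfolding csH colspan_eq_image[OF H] by auto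
      then have "col H m \<in> colspan n F" using mult_unit_vec_eq_col[OF H m] by simp
      then have "(\<Sum>i<n. (- 1) ^ i * v $ i * col H m $ i) = 0" using v unfolding alt_perp_def by blast
      then show ?thesis using H m by simp
    qed
    then show "v \<in> {v \<in> carrier_vec n. perp v}" using v unfolding perp_def alt_perp_def by auto
  next
    fix v assume v: "v \<in> {v \<in> carrier_vec n. perp v}"
    have "(\<Sum>i<n. (- 1) ^ i * v $ i * w $ i) = 0" if w: "w \<in> colspan n F" for w
    proof -
      obtain u where u: "u \<in> carrier_vec k" "w = H *\<^sub>v u" using w unfolding csH colspan_eq_image[OF H] by auto
      have "(\<Sum>i<n. (- 1) ^ i * v $ i * w $ i) = (\<Sum>i<n. \<Sum>m<k. (- 1) ^ i * v $ i * H $$ (i, m) * u $ m)"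
        using u H by (intro sum.cong refl) (simp add: scalar_prod_def sum_distrib_left mult.assoc atLeast0LessThan)
      also have "\<dots> = (\<Sum>m<k. (\<Sum>i<n. (- 1) ^ i * v $ i * H $$ (i, m)) * u $ m)"
        by (subst sum.swap) (simp add: sum_distrib_right)
      also have "\<dots> = 0" using v unfolding perp_def by simp
      finally show ?thesis .
    qed
    then show "v \<in> alt_perp n (colspan n F)" using v unfolding alt_perp_def by auto
  qed
  have split: "(\<Sum>i<n. (- 1) ^ i * v $ i * H $$ (i, m)) =
      (\<Sum>i<n - k. (- 1) ^ i * v $ i * H $$ (i, m)) + (- 1) ^ (n - k + m) * v $ (n - k + m)"
    if m: "m < k" for v :: "complex vec" and m
  proof -
    have "{..<n} = {..<n - k} \<union> {n - k..<n}" using k by auto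
    then have "(\<Sum>i<n. (- 1) ^ i * v $ i * H $$ (i, m)) =
        (\<Sum>i<n - k. (- 1) ^ i * v $ i * H $$ (i, m)) + (\<Sum>i\<in>{n - k..<n}. (- 1) ^ i * v $ i * H $$ (i, m))"
      by (simp add: sum.union_disjoint ivl_disj_int)
    also have "(\<Sum>i\<in>{n - k..<n}. (- 1) ^ i * v $ i * H $$ (i, m)) =
        (\<Sum>a<k. (- 1) ^ (n - k + a) * v $ (n - k + a) * H $$ (n - k + a, m))"
      using k by (intro sum.reindex_bij_witness[of _ "\<lambda>a. n - k + a" "\<lambda>i. i - (n - k)"]) auto
    also have "\<dots> = (\<Sum>a<k. if a = m then (- 1) ^ (n - k + m) * v $ (n - k + m) else 0)"
      using Hid m by (intro sum.cong refl) auto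
    also have "\<dots> = (- 1) ^ (n - k + m) * v $ (n - k + m)" using m by simp
    finally show ?thesis .
  qed
  have perp_iff: "perp v \<longleftrightarrow> (\<forall>m<k. v $ (n - k + m) = - ((- 1) ^ (n - k + m) * (\<Sum>i<n - k. (- 1) ^ i * v $ i * H $$ (i, m))))" for v
  proof -
    have "(s + (- 1) ^ e * y = 0) \<longleftrightarrow> (y = - ((- 1) ^ e * s))" for s y :: complex and e :: nat
      by (cases "even e") (auto simp: eq_neg_iff_add_eq_0 add.commute)
    then show ?thesis unfolding perp_def using split by simp
  qed
  define W where "W = mat n (n - k) (\<lambda>(i, a). let i' = n - 1 - i in
    if i' < n - k then (if i' = a then 1 else 0)
    else - ((- 1) ^ (i' + a) * H $$ (a, i' - (n - k))))"
  have W: "W \<in> carrier_mat n (n - k)" by (simp add: W_def)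
  have Wlow: "(W *\<^sub>v z) $ (n - 1 - i) = z $ i" if "i < n - k" "z \<in> carrier_vec (n - k)" for i z
  proof -
    have "(W *\<^sub>v z) $ (n - 1 - i) = (\<Sum>a<n - k. W $$ (n - 1 - i, a) * z $ a)"
      using that W by (simp add: scalar_prod_def atLeast0LessThan)
    also have "\<dots> = (\<Sum>a<n - k. if a = i then z $ i else 0)"
      using that by (intro sum.cong refl) (auto simp: W_def Let_def)
    also have "\<dots> = z $ i" using that by simp
    finally show ?thesis .
  qed
  have Whigh: "(W *\<^sub>v z) $ (n - 1 - (n - k + m)) = - ((- 1) ^ (n - k + m) * (\<Sum>i<n - k. (- 1) ^ i * z $ i * H $$ (i, m)))"
    if "m < k" "z \<in> carrier_vec (n - k)" for m z
  proof -
    have "(W *\<^sub>v z) $ (n - 1 - (n - k + m)) = (\<Sum>a<n - k. W $$ (n - 1 - (n - k + m), a) * z $ a)"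
      using that W k by (simp add: scalar_prod_def atLeast0LessThan)
    also have "\<dots> = (\<Sum>a<n - k. - ((- 1) ^ (n - k + m) * ((- 1) ^ a * z $ a * H $$ (a, m))))"
    proof (intro sum.cong refl)
      fix a assume a: "a \<in> {..<n - k}"
      define r where "r = n - 1 - (n - k + m)"
      have r: "r < n" "n - 1 - r = n - k + m" using that k by (auto simp: r_def)
      have "W $$ (r, a) = (if n - 1 - r < n - k then (if n - 1 - r = a then 1 else 0)
          else - ((- 1) ^ (n - 1 - r + a) * H $$ (a, n - 1 - r - (n - k))))"
        unfolding W_def Let_def using r(1) a by simp
      then have "W $$ (r, a) = - ((- 1) ^ (n - k + m + a) * H $$ (a, m))"
        unfolding r(2) by simp
      then have "W $$ (n - 1 - (n - k + m), a) = - ((- 1) ^ (n - k + m + a) * H $$ (a, m))"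
        by (simp only: r_def)
      then show "W $$ (n - 1 - (n - k + m), a) * z $ a = - ((- 1) ^ (n - k + m) * ((- 1) ^ a * z $ a * H $$ (a, m)))"
        by (simp add: power_add)
    qed
    finally show ?thesis by (simp add: sum_negf sum_distrib_left)
  qed
  define rv where "rv v = vec n (\<lambda>i. v $ (n - 1 - i))" for v :: "complex vec"
  have rvrv: "rv (rv v) = v" if "v \<in> carrier_vec n" for v using that by (intro eq_vecI) (auto simp: rv_def)
  have Wperp: "perp (rv (W *\<^sub>v z))" if z: "z \<in> carrier_vec (n - k)" for z
    unfolding perp_iff
  proof (intro allI impI)
    fix m assume m: "m < k"
    have "rv (W *\<^sub>v z) $ i = z $ i" if "i < n - k" for i
      using Wlow[OF that z] that by (simp add: rv_def)
    moreover have "rv (W *\<^sub>v z) $ (n - k + m) = (W *\<^sub>v z) $ (n - 1 - (n - k + m))"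
      using m k by (simp add: rv_def)
    ultimately show "rv (W *\<^sub>v z) $ (n - k + m) =
        - ((- 1) ^ (n - k + m) * (\<Sum>i<n - k. (- 1) ^ i * rv (W *\<^sub>v z) $ i * H $$ (i, m)))"
      using Whigh[OF m z] by simp
  qed
  have mux: "mu n x = (colspan n W, snd x)"
  proof -
    have "rv ` alt_perp n (colspan n F) = colspan n W"
      unfolding altp colspan_eq_image[OF W]
    proof (intro Set.set_eqI iffI)
      fix u assume "u \<in> rv ` {v \<in> carrier_vec n. perp v}"
      then obtain v where v: "v \<in> carrier_vec n" "perp v" "u = rv v" by auto
      define z where "z = vec (n - k) (\<lambda>i. v $ i)"
      have z: "z \<in> carrier_vec (n - k)" by (simp add: z_def)
      have "W *\<^sub>v z = rv v"
      proof (rule eq_vecI)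
        fix i assume "i < dim_vec (rv v)"
        then have i: "i < n" by (simp add: rv_def)
        show "(W *\<^sub>v z) $ i = rv v $ i"
        proof (cases "n - 1 - i < n - k")
          case True
          then show ?thesis using Wlow[OF True z] i by (simp add: rv_def z_def)
        next
          case False
          define m where "m = n - 1 - i - (n - k)"
          have m: "m < k" "n - 1 - i = n - k + m" using False i k by (auto simp: m_def)
          have "n - 1 - (n - k + m) = i" using m(2) i by simp
          then have "(W *\<^sub>v z) $ i = - ((- 1) ^ (n - k + m) * (\<Sum>i<n - k. (- 1) ^ i * z $ i * H $$ (i, m)))"
            using Whigh[OF m(1) z] by simp
          also have "\<dots> = v $ (n - k + m)"
            using v(2) m(1) unfolding perp_iff by (simp add: z_def)
          finally show ?thesis using i m by (simp add: rv_def)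
        qed
      qed (use W in \<open>simp add: rv_def\<close>)
      then show "u \<in> (*\<^sub>v) W ` carrier_vec (n - k)" unfolding v(3) using z by (metis imageI)
    next
      fix u assume "u \<in> (*\<^sub>v) W ` carrier_vec (n - k)"
      then obtain z where z: "z \<in> carrier_vec (n - k)" "u = W *\<^sub>v z" by auto
      then have "u = rv (rv u)" "perp (rv u)" using Wperp[OF z(1)] W by (auto simp: rvrv)
      then show "u \<in> rv ` {v \<in> carrier_vec n. perp v}" by (auto simp: rv_def)
    qed
    then show ?thesis by (subst xe) (simp add: mu_def rv_def)
  qed
  have nzW: "minor (window n (n - k) c) W \<noteq> 0" if c: "c < n" for c
  proof (rule minor_nonzeroI_right[OF W window_subset[OF n] card_window])
    fix z assume z: "z \<in> carrier_vec (n - k)" and 0: "\<And>i. i \<in> window n (n - k) c \<Longrightarrow> (W *\<^sub>v z) $ i = 0"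
    let ?v = "rv (W *\<^sub>v z)" and ?V = "window n k ((n - c) mod n)"
    have supp: "?v $ i = 0" if "i < n" "i \<notin> ?V" for i
      using 0[OF cyc_reverse_complement[OF k c that]] that by (simp add: rv_def)
    have vV: "(- 1) ^ i * ?v $ i = 0" if i: "i \<in> ?V" for i
    proof (rule minor_nonzeroD_left[OF H window_subset[OF n] card_window nzH _ i])
      fix m assume m: "m < k"
      have "(\<Sum>i\<in>?V. (- 1) ^ i * ?v $ i * H $$ (i, m)) = (\<Sum>i<n. (- 1) ^ i * ?v $ i * H $$ (i, m))"
        using supp window_subset[OF n, of k] by (intro sum.mono_neutral_left) auto
      then show "(\<Sum>i\<in>?V. (- 1) ^ i * ?v $ i * H $$ (i, m)) = 0"
        using Wperp[OF z] m unfolding perp_def by simp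
    qed (use k in auto)
    show "z = 0\<^sub>v (n - k)"
    proof (rule eq_vecI)
      fix i assume "i < dim_vec (0\<^sub>v (n - k))"
      then have i: "i < n - k" by simp
      have "z $ i = ?v $ i" using Wlow[OF i z] i by (simp add: rv_def)
      also have "\<dots> = 0" using supp[of i] vV[of i] i by (cases "i \<in> ?V") auto
      finally show "z $ i = 0\<^sub>v (n - k) $ i" using i by simp
    qed (use z in simp)
  qed (use k in simp)
  have Wf: "W \<in> full_rank_mats n (n - k)"
    by (rule full_rank_of_minor[OF W window_subset[OF n] card_window nzW[of 0]]) (use k in auto)
  have nk: "0 < n - k" "n - k < n" using k by auto
  from nzW obtain Q where "g_mat n (n - k) (colspan n W, snd x) = Some Q"
    unfolding g_mat_colspan[OF Wf nk] by auto
  then show ?thesis using that g_mat_imp_g_of[OF Wf nk t] mux by simp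
qed

text \<open>The automorphism of the ring of polynomial matrices that multiplies grade \<open>d\<close> by \<open>(-1)\<^sup>d\<close>. It turns
  the alternating bilinear form in the definition of \<open>\<mu>\<close> into the standard one.\<close>

definition twist :: "nat \<Rightarrow> complex poly mat \<Rightarrow> complex poly mat" where
  "twist n A = mat n n (\<lambda>(i, j). Polynomial.smult ((- 1) ^ (i + j)) (pcompose (A $$ (i, j)) [:0, (- 1) ^ n:]))"

lemma twist_carrier [simp]: "twist n A \<in> carrier_mat n n"
  by (simp add: twist_def)

lemma smult_sum: "Polynomial.smult c (sum f S) = (\<Sum>i\<in>S. Polynomial.smult c (f i))"
  by (induction S rule: infinite_finite_induct) (auto simp: smult_add_right)

lemma twist_mult:
  assumes A: "A \<in> carrier_mat n n" and B: "B \<in> carrier_mat n n"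
  shows "twist n (A * B) = twist n A * twist n B"
proof (rule eq_matI)
  fix i j assume "i < dim_row (twist n A * twist n B)" "j < dim_col (twist n A * twist n B)"
  then have ij: "i < n" "j < n" by (auto simp: twist_def)
  have sgn: "(- 1 :: complex) ^ (l + j) * (- 1) ^ (i + l) = (- 1) ^ (i + j)" for l
    by (simp add: power_add[symmetric] uminus_power_if)
  show "twist n (A * B) $$ (i, j) = (twist n A * twist n B) $$ (i, j)"
    using ij A B by (simp add: twist_def scalar_prod_def pcompose_sum pcompose_mult sgn smult_sum mult.commute)
qed (auto simp: twist_def)

lemma twist_twist:
  assumes A: "A \<in> carrier_mat n n"
  shows "twist n (twist n A) = A"
proof (rule eq_matI)
  fix i j assume "i < dim_row A" "j < dim_col A"
  then have ij: "i < n" "j < n" using A by auto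
  have "pcompose (pcompose p [:0, (- 1) ^ n:]) [:0, (- 1) ^ n:] = p" for p :: "complex poly"
    by (rule poly_eqI) (simp add: coeff_pcompose_linear power_mult_distrib[symmetric] flip: mult.assoc)
  then show "twist n (twist n A) $$ (i, j) = A $$ (i, j)"
    using ij by (simp add: twist_def pcompose_smult power_add[symmetric])
qed (use A in \<open>auto simp: twist_def\<close>)

lemma ev_twist_index:
  "i < n \<Longrightarrow> j < n \<Longrightarrow> ev z (twist n A) $$ (i, j) = (- 1) ^ (i + j) * poly (A $$ (i, j)) ((- 1) ^ n * z)"
  by (simp add: twist_def poly_pcompose mult.commute)

lemma lam_dual: "0 < k \<Longrightarrow> k < n \<Longrightarrow> (- 1) ^ n * lam k t = lam (n - k) t"
proof -
  assume "0 < k" "k < n"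
  then have "n + (k - 1) = (n - k - 1) + 2 * k" by auto
  then have "(- 1 :: complex) ^ (n + (k - 1)) = (- 1) ^ (n - k - 1 + 2 * k)" by (rule arg_cong)
  then have "(- 1 :: complex) ^ n * (- 1) ^ (k - 1) = (- 1) ^ (n - k - 1)" by (simp add: power_add)
  then show ?thesis by (simp add: lam_def flip: mult.assoc)
qed

lemma smult_mat_cancel:
  fixes p :: "'a :: idom"
  assumes "p \<noteq> 0" "A \<in> carrier_mat n m" "B \<in> carrier_mat n m" "p \<cdot>\<^sub>m A = p \<cdot>\<^sub>m B"
  shows "A = B"
proof (rule eq_matI)
  fix i j assume ij: "i < dim_row B" "j < dim_col B"
  have "(p \<cdot>\<^sub>m A) $$ (i, j) = (p \<cdot>\<^sub>m B) $$ (i, j)" by (simp only: assms(4))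
  then show "A $$ (i, j) = B $$ (i, j)" using ij assms(1-3) by simp
qed (use assms in auto)

lemma poly_eqI_except:
  fixes p q :: "complex poly"
  assumes "\<And>z. z \<noteq> a \<Longrightarrow> poly p z = poly q z"
  shows "p = q"
proof -
  have "[:- a, 1:] * (p - q) = 0"
    by (subst poly_all_0_iff_0[symmetric]) (use assms in auto)
  then show ?thesis by (metis mult_eq_0_iff pCons_eq_0_iff one_neq_zero right_minus_eq)
qed

text \<open>Here \<open>Q\<close> is to be the matrix of the dual point \<open>\<mu>(x)\<close>; the sign makes the entries of top grade
  equal to 1.\<close>

definition dual_mat :: "nat \<Rightarrow> nat \<Rightarrow> complex poly mat \<Rightarrow> complex poly mat" where
  "dual_mat n k Q = [:(- 1) ^ k:] \<cdot>\<^sub>m twist n (fl n Q)"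

text \<open>The matrix of the dual point, reflected and twisted, is annihilated by the frame of the point
  at \<open>lam k t\<close>. As the product of the two matrices is banded with \<open>\<lambda>\<close> on the extreme diagonal, this
  alone forces it to be the scalar \<open>\<lambda> - lam k t\<close>.\<close>

lemma dual_mat_inverse:
  assumes x: "g_of n k x G" and k: "0 < k" "k < n" and Q: "g_of n (n - k) (mu n x) Q"
  defines "H \<equiv> dual_mat n k Q" and "c \<equiv> [:- lam k (snd x), 1:]"
  shows "banded n k H"
    and "H * G = c \<cdot>\<^sub>m 1\<^sub>m n" and "G * H = c \<cdot>\<^sub>m 1\<^sub>m n"
    and "\<And>F. F \<in> carrier_mat n k \<Longrightarrow> fst x = colspan n F \<Longrightarrow> ev (lam k (snd x)) H * F = 0\<^sub>m n k"
proof -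
  let ?z = "lam k (snd x)"
  have t: "snd x \<noteq> 0" and Gb: "banded n (n - k) G" using x by (auto simp: g_of_def)
  have GC: "G \<in> carrier_mat n n" using Gb by (rule banded_carrier)
  have Qb: "banded n k Q" using Q k by (simp add: g_of_def)
  have QC: "Q \<in> carrier_mat n n" using Qb by (rule banded_carrier)
  have HC: "H \<in> carrier_mat n n" by (simp add: H_def dual_mat_def)
  have sgn: "(- 1 :: complex) ^ k * ((- 1) ^ (i + j) * ((- 1) ^ n) ^ m) = (- 1) ^ (k + (i + j) + n * m)" for i j m
    by (simp add: power_add power_mult)
  have coH: "coeff (H $$ (i, j)) m = (- 1) ^ (k + (i + j) + n * m) * coeff (fl n Q $$ (i, j)) m"
    if "i < n" "j < n" for i j m
    unfolding sgn[symmetric] H_def dual_mat_def twist_def using that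
    by (simp add: coeff_pcompose_linear)
  show Hb: "banded n k H"
  proof (rule bandedI[OF HC])
    fix i j m assume ij: "i < n" "j < n"
    show "coeff (H $$ (i, j)) m = 0" if "i + n * m < j \<or> j + k < i + n * m"
      using banded_zero[OF banded_fl[OF Qb] ij that] coH[OF ij] by simp
    show "coeff (H $$ (i, j)) m = 1" if e: "i + n * m = j + k"
    proof -
      have ee: "k + (i + j) + n * m = 2 * (k + j)" using e by simp
      have "(- 1 :: complex) ^ (k + (i + j) + n * m) = 1" unfolding ee power_mult by simp
      then show ?thesis using banded_top[OF banded_fl[OF Qb] ij e] coH[OF ij, of m] by simp
    qed
  qed
  have colQ: "\<exists>v\<in>alt_perp n (fst x). \<forall>i<n. ev (lam (n - k) (snd x)) Q $$ (i, b) = v $ (n - 1 - i)" if b: "b < n" for b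
  proof -
    obtain F' X' where F': "F' \<in> carrier_mat n (n - k)" and X': "X' \<in> carrier_mat (n - k) n"
      and mF: "fst (mu n x) = colspan n F'" and eq: "ev (lam (n - k) (snd (mu n x))) Q = F' * X'"
      using Q unfolding g_of_def by auto
    have sm: "snd (mu n x) = snd x" by (cases x) (simp add: mu_def)
    have "F' *\<^sub>v col X' b \<in> fst (mu n x)" unfolding mF colspan_eq_image[OF F'] using X' b by auto
    also have "fst (mu n x) = (\<lambda>v. vec n (\<lambda>i. v $ (n - 1 - i))) ` alt_perp n (fst x)" by (cases x) (simp add: mu_def)
    finally obtain v where v: "v \<in> alt_perp n (fst x)" "F' *\<^sub>v col X' b = vec n (\<lambda>i. v $ (n - 1 - i))" by auto
    have "ev (lam (n - k) (snd x)) Q $$ (i, b) = v $ (n - 1 - i)" if i: "i < n" for i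
      using eq mat_mult_index_vec[OF F' X' i b] v(2) i unfolding sm by simp
    then show ?thesis using v(1) by blast
  qed
  have evH: "ev ?z H $$ (i, j) = (- 1) ^ k * ((- 1) ^ (i + j) * ev (lam (n - k) (snd x)) Q $$ (n - 1 - j, n - 1 - i))"
    if ij: "i < n" "j < n" for i j
  proof -
    have "ev ?z H $$ (i, j) = (- 1) ^ k * ev ?z (twist n (fl n Q)) $$ (i, j)"
      unfolding H_def dual_mat_def ev_smult using ij by (simp add: carrier_matD[OF twist_carrier])
    also have "ev ?z (twist n (fl n Q)) $$ (i, j) = (- 1) ^ (i + j) * poly (fl n Q $$ (i, j)) ((- 1) ^ n * ?z)"
      by (rule ev_twist_index[OF ij])
    also have "poly (fl n Q $$ (i, j)) ((- 1) ^ n * ?z) = ev (lam (n - k) (snd x)) Q $$ (n - 1 - j, n - 1 - i)"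
      unfolding lam_dual[OF k] using ij QC by (simp add: fl_def)
    finally show ?thesis .
  qed
  show kill: "ev ?z H * F = 0\<^sub>m n k" if F: "F \<in> carrier_mat n k" and NF: "fst x = colspan n F" for F
  proof (rule eq_matI)
    fix i m assume "i < dim_row (0\<^sub>m n k :: complex mat)" "m < dim_col (0\<^sub>m n k :: complex mat)"
    then have im: "i < n" "m < k" by auto
    have "n - 1 - i < n" using im by simp
    then obtain v where v: "v \<in> alt_perp n (fst x)"
      "\<And>j. j < n \<Longrightarrow> ev (lam (n - k) (snd x)) Q $$ (j, n - 1 - i) = v $ (n - 1 - j)" using colQ by blast
    have "F *\<^sub>v unit_vec k m \<in> fst x" unfolding NF colspan_eq_image[OF F] by auto
    then have "col F m \<in> fst x" using mult_unit_vec_eq_col[OF F im(2)] by simp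
    then have "(\<Sum>j<n. (- 1) ^ j * v $ j * col F m $ j) = 0" using v(1) unfolding alt_perp_def by blast
    then have 0: "(\<Sum>j<n. (- 1) ^ j * v $ j * F $$ (j, m)) = 0" using F im by simp
    have "(ev ?z H * F) $$ (i, m) = (\<Sum>j<n. ev ?z H $$ (i, j) * F $$ (j, m))"
      using HC F im by (simp add: scalar_prod_def atLeast0LessThan)
    also have "\<dots> = (\<Sum>j<n. (- 1) ^ k * (- 1) ^ i * ((- 1) ^ j * v $ j * F $$ (j, m)))"
    proof (intro sum.cong refl)
      fix j assume "j \<in> {..<n}"
      then have j: "j < n" "n - 1 - j < n" "n - 1 - (n - 1 - j) = j" by auto
      show "ev ?z H $$ (i, j) * F $$ (j, m) = (- 1) ^ k * (- 1) ^ i * ((- 1) ^ j * v $ j * F $$ (j, m))"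
        unfolding evH[OF im(1) j(1)] v(2)[OF j(2)] j(3) by (simp add: power_add)
    qed
    also have "\<dots> = 0" unfolding sum_distrib_left[symmetric] 0 by simp
    finally show "(ev ?z H * F) $$ (i, m) = 0\<^sub>m n k $$ (i, m)" using im by simp
  qed (use HC F in auto)
  have evHG: "ev ?z (H * G) = 0\<^sub>m n n"
  proof -
    obtain F X where F: "F \<in> carrier_mat n k" and X: "X \<in> carrier_mat k n" and NF: "fst x = colspan n F"
      and eq: "ev ?z G = F * X" using x by (auto simp: g_of_def)
    have evHC: "ev ?z H \<in> carrier_mat n n" using HC by simp
    have "ev ?z (H * G) = ev ?z H * (F * X)" unfolding ev_mult[OF HC GC] eq ..
    also have "\<dots> = ev ?z H * F * X" by (rule assoc_mult_mat[symmetric, OF evHC F X])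
    also have "\<dots> = 0\<^sub>m n n" unfolding kill[OF F NF] using X by simp
    finally show ?thesis .
  qed
  have HGb: "banded n n (H * G)" using banded_mult[OF Hb Gb] k by simp
  show HG: "H * G = c \<cdot>\<^sub>m 1\<^sub>m n"
  proof (rule eq_matI)
    fix i j assume "i < dim_row (c \<cdot>\<^sub>m 1\<^sub>m n)" "j < dim_col (c \<cdot>\<^sub>m 1\<^sub>m n)"
    then have ij: "i < n" "j < n" by auto
    let ?p = "(H * G) $$ (i, j)"
    have root: "poly ?p ?z = 0"
    proof -
      have "poly ?p ?z = ev ?z (H * G) $$ (i, j)" using ij HC GC by (simp del: index_mult_mat(1))
      then show ?thesis unfolding evHG using ij by simp
    qed
    have pz: "coeff ?p m = 0" if "i + n * m < j \<or> j + n < i + n * m" for m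
      by (rule banded_zero[OF HGb ij that])
    have high: "coeff ?p (Suc (Suc m)) = 0" for m by (rule pz) (use ij in auto)
    then have pe: "?p = [:coeff ?p 0, coeff ?p 1:]"
      by (intro poly_eqI) (auto simp: coeff_pCons split: nat.split)
    show "?p = (c \<cdot>\<^sub>m 1\<^sub>m n) $$ (i, j)"
    proof (cases i j rule: linorder_cases)
      case less
      have "coeff ?p 0 = 0" by (rule pz) (use less in auto)
      then have "?p = [:0, coeff ?p 1:]" using pe by simp
      moreover have "coeff ?p 1 = 0" using root t calculation
        by (metis add_0 lam_eq_0_iff mult_eq_0_iff mult_zero_right add.right_neutral poly_0 poly_pCons)
      ultimately show ?thesis using less ij by simp
    next
      case greater
      have "coeff ?p 1 = 0" by (rule pz) (use greater in auto)
      then have "?p = [:coeff ?p 0:]" using pe by simp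
      moreover have "coeff ?p 0 = 0" using root calculation
        by (metis add.right_neutral mult_zero_right poly_0 poly_pCons)
      ultimately show ?thesis using greater ij by simp
    next
      case equal
      have "coeff ?p 1 = 1" by (rule banded_top[OF HGb ij]) (use equal in auto)
      then have e: "?p = [:coeff ?p 0, 1:]" using pe by simp
      have "coeff ?p 0 + ?z = 0" using arg_cong[OF e, of "\<lambda>p. poly p ?z"] root by simp
      then have "coeff ?p 0 = - ?z" by (simp add: add_eq_0_iff2)
      then show ?thesis using e equal ij by (simp add: c_def)
    qed
  qed (use HC GC in auto)
  have evinv: "ev z H * ev z G = (z - ?z) \<cdot>\<^sub>m 1\<^sub>m n" for z
    using arg_cong[OF HG, of "ev z"] unfolding ev_mult[OF HC GC] ev_smult by (simp add: c_def)
  show "G * H = c \<cdot>\<^sub>m 1\<^sub>m n"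
  proof (rule eq_matI)
    fix i j assume "i < dim_row (c \<cdot>\<^sub>m 1\<^sub>m n)" "j < dim_col (c \<cdot>\<^sub>m 1\<^sub>m n)"
    then have ij: "i < n" "j < n" by auto
    show "(G * H) $$ (i, j) = (c \<cdot>\<^sub>m 1\<^sub>m n) $$ (i, j)"
    proof (rule poly_eqI_except[of ?z])
      fix z assume z: "z \<noteq> ?z"
      define b where "b = inverse (z - ?z)"
      have b: "b * (z - ?z) = 1" using z by (simp add: b_def)
      have bH: "b \<cdot>\<^sub>m ev z H \<in> carrier_mat n n" and eG: "ev z G \<in> carrier_mat n n" and eH: "ev z H \<in> carrier_mat n n"
        using HC GC by auto
      have "(b \<cdot>\<^sub>m ev z H) * ev z G = b \<cdot>\<^sub>m (ev z H * ev z G)" by (rule mult_smult_assoc_mat[OF eH eG])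
      also have "\<dots> = 1\<^sub>m n" unfolding evinv by (intro eq_matI) (auto simp: b)
      finally have "ev z G * (b \<cdot>\<^sub>m ev z H) = 1\<^sub>m n" by (rule mat_mult_left_right_inverse[OF bH eG])
      then have "b \<cdot>\<^sub>m (ev z G * ev z H) = 1\<^sub>m n" unfolding mult_smult_distrib[OF eG eH] .
      then have "(b \<cdot>\<^sub>m ev z (G * H)) $$ (i, j) = 1\<^sub>m n $$ (i, j)" unfolding ev_mult[OF GC HC] by simp
      then have "b * poly ((G * H) $$ (i, j)) z = (if i = j then 1 else 0)" using ij GC HC by (simp del: index_mult_mat(1))
      then have "(b * (z - ?z)) * poly ((G * H) $$ (i, j)) z = (if i = j then z - ?z else 0)"
        by (auto simp: mult.assoc mult.left_commute[of b])
      then have "poly ((G * H) $$ (i, j)) z = (if i = j then z - ?z else 0)" unfolding b by simp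
      then show "poly ((G * H) $$ (i, j)) z = poly ((c \<cdot>\<^sub>m 1\<^sub>m n) $$ (i, j)) z"
        using ij by (simp add: c_def del: index_mult_mat(1))
    qed
  qed (use HC GC in auto)
qed

lemma g_inverse:
  assumes x: "g_of n k x G" and k: "0 < k" "k < n"
  obtains H where "banded n k H" "H * G = [:- lam k (snd x), 1:] \<cdot>\<^sub>m 1\<^sub>m n" "G * H = [:- lam k (snd x), 1:] \<cdot>\<^sub>m 1\<^sub>m n"
    "\<And>F. F \<in> carrier_mat n k \<Longrightarrow> fst x = colspan n F \<Longrightarrow> ev (lam k (snd x)) H * F = 0\<^sub>m n k"
proof -
  obtain Q where Q: "g_of n (n - k) (mu n x) Q" by (rule mu_g_of[OF x k])
  show ?thesis by (rule that[OF dual_mat_inverse[OF x k Q]])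
qed

lemma g_det_nonzero:
  assumes x: "g_of n k x G" and k: "0 < k" "k < n" and z: "z \<noteq> lam k (snd x)"
  shows "det (ev z G) \<noteq> 0"
proof -
  obtain H where Hb: "banded n k H" and GH: "G * H = [:- lam k (snd x), 1:] \<cdot>\<^sub>m 1\<^sub>m n"
    by (rule g_inverse[OF x k])
  have GC: "G \<in> carrier_mat n n" and HC: "H \<in> carrier_mat n n"
    using x Hb by (auto simp: g_of_def banded_carrier)
  have "ev z G * ev z H = (z - lam k (snd x)) \<cdot>\<^sub>m 1\<^sub>m n"
    using arg_cong[OF GH, of "ev z"] unfolding ev_mult[OF GC HC] ev_smult by simp
  then have "det (ev z G) * det (ev z H) = (z - lam k (snd x)) ^ n"
    using det_mult[of "ev z G" n "ev z H"] GC HC by (simp add: det_smult)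
  then show ?thesis using z by auto
qed

lemma g_left_cancel:
  assumes x: "g_of n k x G" and k: "0 < k" "k < n" and A: "A \<in> carrier_mat n n" and B: "B \<in> carrier_mat n n"
    and eq: "G * A = G * B"
  shows "A = B"
proof -
  obtain H where Hb: "banded n k H" and HG: "H * G = [:- lam k (snd x), 1:] \<cdot>\<^sub>m 1\<^sub>m n"
    by (rule g_inverse[OF x k])
  have GC: "G \<in> carrier_mat n n" and HC: "H \<in> carrier_mat n n"
    using x Hb by (auto simp: g_of_def banded_carrier)
  have c: "H * (G * M) = [:- lam k (snd x), 1:] \<cdot>\<^sub>m M" if M: "M \<in> carrier_mat n n" for M
    unfolding assoc_mult_mat[OF HC GC M, symmetric] HG
    using mult_smult_assoc_mat[of "1\<^sub>m n" n n M n "[:- lam k (snd x), 1:]"] M by simp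
  show ?thesis by (rule smult_mat_cancel[OF _ A B, of "[:- lam k (snd x), 1:]"]) (use c[OF A] c[OF B] eq in auto)
qed

section \<open>Factorisation of products of two \<open>g\<close>-matrices\<close>

text \<open>Comparison of coefficients, from the lowest grade upwards and from the highest one downwards.\<close>

lemma banded_divide:
  assumes C: "banded n (d + n) C" and a: "a \<noteq> (0::complex)" and B: "B \<in> carrier_mat n n"
    and eq: "\<And>i j. i < n \<Longrightarrow> j < n \<Longrightarrow> C $$ (i, j) = [:- a, 1:] * B $$ (i, j)"
  shows "banded n d B"
proof (rule bandedI[OF B])
  fix i j m assume ij: "i < n" "j < n"
  have co0: "coeff (C $$ (i, j)) 0 = - a * coeff (B $$ (i, j)) 0" unfolding eq[OF ij] by simp
  have coS: "coeff (C $$ (i, j)) (Suc m) = coeff (B $$ (i, j)) m - a * coeff (B $$ (i, j)) (Suc m)" for m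
    unfolding eq[OF ij] by simp
  have low: "coeff (B $$ (i, j)) m = 0" if "i + n * m < j" for m
    using that
  proof (induction m)
    case 0
    then show ?case using banded_zero[OF C ij, of 0] co0 a by simp
  next
    case (Suc m)
    then have "coeff (B $$ (i, j)) m = 0" "coeff (C $$ (i, j)) (Suc m) = 0"
      using banded_zero[OF C ij, of "Suc m"] by auto
    then show ?case using coS a by simp
  qed
  have high: "coeff (B $$ (i, j)) m = 0" if "j + d < i + n * m" for m
  proof -
    let ?D = "degree (B $$ (i, j))"
    have "coeff (B $$ (i, j)) (m + r) = 0" if "m + r + s = m + Suc ?D" for r s
      using that
    proof (induction s arbitrary: r)
      case 0
      then show ?case by (intro coeff_eq_0) simp
    next
      case (Suc s)
      then have "coeff (B $$ (i, j)) (Suc (m + r)) = 0" using Suc.IH[of "Suc r"] by simp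
      moreover have "coeff (C $$ (i, j)) (Suc (m + r)) = 0"
        by (rule banded_zero[OF C ij]) (use \<open>j + d < i + n * m\<close> in \<open>simp add: distrib_left\<close>)
      ultimately show ?case using coS by simp
    qed
    from this[of 0 "Suc ?D"] show ?thesis by simp
  qed
  show "coeff (B $$ (i, j)) m = 0" if "i + n * m < j \<or> j + d < i + n * m"
    using that low high by blast
  show "coeff (B $$ (i, j)) m = 1" if e: "i + n * m = j + d"
  proof -
    have "coeff (C $$ (i, j)) (Suc m) = 1" by (rule banded_top[OF C ij]) (use e in simp)
    moreover have "coeff (B $$ (i, j)) (Suc m) = 0" by (rule high) (use e ij in simp)
    ultimately show ?thesis using coS[of m] by simp
  qed
qed

lemma g_of_any_frame:
  assumes x: "g_of n k (colspan n F, t) G" and k: "0 < k" "k < n" and F: "F \<in> full_rank_mats n k"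
  obtains X where "X \<in> carrier_mat k n" "ev (lam k t) G = F * X" "det (first_cols k X) \<noteq> 0"
proof -
  have Fc: "F \<in> carrier_mat n k" using F by (simp add: full_rank_mats_iff)
  obtain F' X' where F': "F' \<in> full_rank_mats n k" "F' \<in> carrier_mat n k" and X': "X' \<in> carrier_mat k n"
    and cs: "colspan n F = colspan n F'" and eq: "ev (lam k t) G = F' * X'"
    and G: "banded n (n - k) G" and t: "t \<noteq> 0"
    by (rule g_of_frame[OF x k]) auto
  obtain Z where Z: "Z \<in> carrier_mat k k" "F' = F * Z"
    using same_colspan_change_of_basis[OF F F'(1) cs] by metis
  have X: "Z * X' \<in> carrier_mat k n" using Z X' by auto
  have e: "ev (lam k t) G = F * (Z * X')" unfolding eq Z(2) by (rule assoc_mult_mat[OF Fc Z(1) X'])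
  show ?thesis using that[OF X e] banded_rank_imp(4)[OF G k t Fc X e] .
qed

text \<open>Let \<open>H\<close> be the inverse of \<open>A'\<close> up to the factor \<open>\<lambda> - lam k t\<close>. The product \<open>H A B\<close> vanishes at
  \<open>lam k t\<close>, because the image of \<open>A B\<close> there is the subspace that belongs to \<open>A'\<close>. Dividing by
  \<open>\<lambda> - lam k t\<close> gives the second factor, a band matrix which at \<open>lam l s\<close> has the same rank as \<open>A\<close>. The
  adjugate replaces the inverse of \<open>A'\<close> at \<open>lam l s\<close>, as a scalar does not change the column span.\<close>

lemma g_factor:
  assumes x: "g_of n l (colspan n E, s) A" and y: "g_of n k (colspan n F, t) B"
    and E: "E \<in> full_rank_mats n l" and F: "F \<in> full_rank_mats n k"
    and l: "0 < l" "l < n" and k: "0 < k" "k < n"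
    and ne: "lam l s \<noteq> lam k t"
    and x': "g_of n k (colspan n (ev (lam k t) A * F), t) A'"
  obtains B' where "A * B = A' * B'" "g_of n l (colspan n (adj_mat (ev (lam l s) A') * E), s) B'"
proof -
  let ?y = "lam k t" and ?x = "lam l s"
  let ?C = "ev ?y A * F"
  have Ec: "E \<in> carrier_mat n l" and Fc: "F \<in> carrier_mat n k" using E F by (auto simp: full_rank_mats_iff)
  have s: "s \<noteq> 0" and t: "t \<noteq> 0" using x y by (auto simp: g_of_def)
  have Ab: "banded n (n - l) A" and Bb: "banded n (n - k) B" and A'b: "banded n (n - k) A'"
    using x y x' by (auto simp: g_of_def)
  note AC = banded_carrier[OF Ab] and BC = banded_carrier[OF Bb] and A'C = banded_carrier[OF A'b]
  have C: "?C \<in> carrier_mat n k" using AC Fc by (intro mult_carrier_mat[of _ n n]) auto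
  obtain H where Hb: "banded n k H" and HA: "A' * H = [:- ?y, 1:] \<cdot>\<^sub>m 1\<^sub>m n"
    and kill: "\<And>F. F \<in> carrier_mat n k \<Longrightarrow> colspan n ?C = colspan n F \<Longrightarrow> ev ?y H * F = 0\<^sub>m n k"
    by (rule g_inverse[OF x' k]) auto
  note HC = banded_carrier[OF Hb]
  obtain X where X: "X \<in> carrier_mat k n" "ev ?y B = F * X" by (rule g_of_any_frame[OF y k F])
  obtain Y where Y: "Y \<in> carrier_mat l n" "ev ?x A = E * Y" by (rule g_of_any_frame[OF x l E])
  define M where "M = H * (A * B)"
  have ABC: "A * B \<in> carrier_mat n n" using AC BC by auto
  have Mb: "banded n (n - l + n) M"
  proof -
    have "k + (n - l + (n - k)) = n - l + n" using k by simp
    then show ?thesis using banded_mult[OF Hb banded_mult[OF Ab Bb]] unfolding M_def by simp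
  qed
  note MC = banded_carrier[OF Mb]
  have evM: "ev ?y M = 0\<^sub>m n n"
  proof -
    have c: "ev ?y H \<in> carrier_mat n n" "ev ?y A \<in> carrier_mat n n" "ev ?y B \<in> carrier_mat n n" using HC AC BC by auto
    have "ev ?y M = ev ?y H * (ev ?y A * (F * X))"
      unfolding M_def ev_mult[OF HC ABC] ev_mult[OF AC BC] X(2) ..
    also have "ev ?y A * (F * X) = ?C * X" by (rule assoc_mult_mat[symmetric, OF c(2) Fc X(1)])
    also have "ev ?y H * (?C * X) = ev ?y H * ?C * X" by (rule assoc_mult_mat[symmetric, OF c(1) C X(1)])
    also have "\<dots> = 0\<^sub>m n n" unfolding kill[OF C refl] using X by simp
    finally show ?thesis .
  qed
  define B' where "B' = mat n n (\<lambda>(i, j). M $$ (i, j) div [:- ?y, 1:])"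
  have B'C: "B' \<in> carrier_mat n n" by (simp add: B'_def)
  have div: "M $$ (i, j) = [:- ?y, 1:] * B' $$ (i, j)" if ij: "i < n" "j < n" for i j
  proof -
    have "poly (M $$ (i, j)) ?y = ev ?y M $$ (i, j)" using ij MC by simp
    then have "poly (M $$ (i, j)) ?y = 0" unfolding evM using ij by simp
    then have "[:- ?y, 1:] dvd M $$ (i, j)" by (simp add: poly_eq_0_iff_dvd)
    then show ?thesis using ij by (simp add: B'_def del: mult_pCons_left)
  qed
  have B'b: "banded n (n - l) B'" by (rule banded_divide[OF Mb _ B'C div]) (use t in auto)
  have M': "M = [:- ?y, 1:] \<cdot>\<^sub>m B'" using div MC B'C by (intro eq_matI) auto
  have AB: "A * B = A' * B'"
  proof (rule smult_mat_cancel[of "[:- ?y, 1:]" _ n n])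
    have "[:- ?y, 1:] \<cdot>\<^sub>m (A' * B') = A' * M"
      unfolding M' by (rule mult_smult_distrib[symmetric, OF A'C B'C])
    also have "\<dots> = A' * H * (A * B)" unfolding M_def by (rule assoc_mult_mat[symmetric, OF A'C HC ABC])
    also have "\<dots> = [:- ?y, 1:] \<cdot>\<^sub>m (1\<^sub>m n * (A * B))"
      unfolding HA by (rule mult_smult_assoc_mat[OF one_carrier_mat ABC])
    also have "1\<^sub>m n * (A * B) = A * B" by (rule left_mult_one_mat[OF ABC])
    finally show "[:- ?y, 1:] \<cdot>\<^sub>m (A * B) = [:- ?y, 1:] \<cdot>\<^sub>m (A' * B')" ..
  qed (use ABC A'C B'C in auto)
  let ?a = "ev ?x A'"
  have aC: "?a \<in> carrier_mat n n" "ev ?x B' \<in> carrier_mat n n" "ev ?x B \<in> carrier_mat n n" using A'C B'C BC by auto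
  have d: "det ?a \<noteq> 0" using g_det_nonzero[OF x' k, of ?x] ne by simp
  note adj = adj_mat[OF aC(1)]
  have "?a * ev ?x B' = E * Y * ev ?x B"
    using arg_cong[OF AB, of "ev ?x"] unfolding ev_mult[OF AC BC] ev_mult[OF A'C B'C] Y(2) by simp
  then have "adj_mat ?a * (?a * ev ?x B') = adj_mat ?a * (E * (Y * ev ?x B))"
    using assoc_mult_mat[OF Ec Y(1) aC(3)] by simp
  moreover have "adj_mat ?a * (?a * ev ?x B') = det ?a \<cdot>\<^sub>m ev ?x B'"
    unfolding assoc_mult_mat[OF adj(1) aC(1,2), symmetric] adj(3)
    using mult_smult_assoc_mat[of "1\<^sub>m n" n n "ev ?x B'" n "det ?a"] aC by simp
  moreover have YB: "Y * ev ?x B \<in> carrier_mat l n" using Y aC by auto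
  ultimately have dB: "det ?a \<cdot>\<^sub>m ev ?x B' = (adj_mat ?a * E) * (Y * ev ?x B)"
    using assoc_mult_mat[OF adj(1) Ec YB] by simp
  have aE: "adj_mat ?a * E \<in> carrier_mat n l" using adj(1) Ec by auto
  have "ev ?x B' = (1 / det ?a) \<cdot>\<^sub>m (det ?a \<cdot>\<^sub>m ev ?x B')" using d by (intro eq_matI) auto
  also have "\<dots> = (adj_mat ?a * E) * ((1 / det ?a) \<cdot>\<^sub>m (Y * ev ?x B))"
    unfolding dB by (rule mult_smult_distrib[symmetric, OF aE YB])
  finally have e: "ev ?x B' = (adj_mat ?a * E) * ((1 / det ?a) \<cdot>\<^sub>m (Y * ev ?x B))" .
  have "g_of n l (colspan n (adj_mat ?a * E), s) B'"
    by (rule g_ofI[OF B'b s aE _ e]) (use YB in auto)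
  then show ?thesis using that AB by blast
qed

section \<open>The geometric R-matrix as a refactorisation\<close>

lemma pi_map_first_cols:
  assumes "A \<in> carrier_mat n n" "k \<le> n"
  shows "pi_map n k t A = (if first_cols k (ev (lam k t) A) \<in> full_rank_mats n k
    then Some (colspan n (first_cols k (ev (lam k t) A)), t) else None)"
proof -
  have "mat n k (\<lambda>(i, j). poly (A $$ (i, j)) ((- 1) ^ (k - 1) * t)) = first_cols k (ev (lam k t) A)"
    using assms by (intro eq_matI) (auto simp: first_cols_def lam_def)
  then show ?thesis by (simp add: pi_map_def Let_def)
qed

lemma product_first_cols:
  assumes A: "A \<in> carrier_mat n n" and dA: "det (ev (lam k t) A) \<noteq> 0"
    and y: "g_of n k (colspan n F, t) B" and F: "F \<in> full_rank_mats n k" and k: "0 < k" "k < n"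
  shows "first_cols k (ev (lam k t) (A * B)) \<in> full_rank_mats n k"
    and "colspan n (first_cols k (ev (lam k t) (A * B))) = colspan n (ev (lam k t) A * F)"
    and "ev (lam k t) A * F \<in> full_rank_mats n k"
proof -
  let ?y = "lam k t"
  have Fc: "F \<in> carrier_mat n k" using F by (auto simp: full_rank_mats_iff)
  obtain X where X: "X \<in> carrier_mat k n" "ev ?y B = F * X" "det (first_cols k X) \<noteq> 0"
    by (rule g_of_any_frame[OF y k F])
  have BC: "B \<in> carrier_mat n n" using y by (rule g_of_carrier)
  have eA: "ev ?y A \<in> carrier_mat n n" using A by simp
  have Xk: "first_cols k X \<in> carrier_mat k k" using X by (intro first_cols_carrier)
  have "ev ?y (A * B) = ev ?y A * F * X"
    unfolding ev_mult[OF A BC] X(2) using assoc_mult_mat[OF eA Fc X(1)] by simp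
  then have e: "first_cols k (ev ?y (A * B)) = ev ?y A * F * first_cols k X"
    using first_cols_mult[of "ev ?y A * F" n k X n k] eA Fc X(1) k by auto
  show AF: "ev ?y A * F \<in> full_rank_mats n k" by (rule full_rank_left_mult[OF F eA dA])
  show fr: "first_cols k (ev ?y (A * B)) \<in> full_rank_mats n k"
    unfolding e by (rule full_rank_right_mult[OF AF Xk X(3)])
  show "colspan n (first_cols k (ev ?y (A * B))) = colspan n (ev ?y A * F)"
    unfolding e using AF by (intro full_rank_factors(3)[OF _ Xk fr[unfolded e]]) (simp add: full_rank_mats_iff)
qed

text \<open>At the parameter of \<open>y\<close> the matrix of \<open>x\<close> is invertible, so the image of the product there has dimension
  \<open>k\<close>; it lies in the image of the first factor of any other factorisation, so equals it.\<close>

lemma Psi_eqI: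
  assumes x: "g_of n l x A" and y: "g_of n k y B" and x': "g_of n k x' A'"
    and l: "0 < l" "l < n" and k: "0 < k" "k < n"
    and B': "B' \<in> carrier_mat n n" and eq: "A * B = A' * B'"
    and sx': "snd x' = snd y" and ne: "lam l (snd x) \<noteq> lam k (snd y)"
  shows "Psi n k l (x, y) = Some x'"
proof -
  obtain F where F: "F \<in> full_rank_mats n k" "F \<in> carrier_mat n k" "y = (colspan n F, snd y)" and gy: "g_mat n k y = Some B"
    by (rule g_of_frame[OF y k])
  obtain F' X' where F': "F' \<in> carrier_mat n k" "X' \<in> carrier_mat k n" "x' = (colspan n F', snd x')"
    "ev (lam k (snd x')) A' = F' * X'" by (rule g_of_frame[OF x' k])
  let ?y = "lam k (snd y)"
  have AC: "A \<in> carrier_mat n n" "B \<in> carrier_mat n n" "A' \<in> carrier_mat n n"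
    using x y x' by (auto simp: g_of_carrier)
  have dA: "det (ev ?y A) \<noteq> 0" by (rule g_det_nonzero[OF x l]) (use ne in simp)
  have y2: "g_of n k (colspan n F, snd y) B" using y F(3) by simp
  note fr = product_first_cols[OF AC(1) dA y2 F(1) k]
  let ?B = "first_cols k (ev ?y B')"
  have Bk: "?B \<in> carrier_mat n k" using B' by (intro first_cols_carrier) auto
  have "first_cols k (ev ?y (A * B)) = first_cols k (ev ?y A' * ev ?y B')"
    unfolding eq ev_mult[OF AC(3) B'] ..
  also have "\<dots> = ev ?y A' * ?B" by (rule first_cols_mult) (use AC B' k in auto)
  also have "\<dots> = F' * X' * ?B" using F'(4) sx' by simp
  also have "\<dots> = F' * (X' * ?B)" by (rule assoc_mult_mat[OF F'(1,2) Bk])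
  finally have e: "first_cols k (ev ?y (A * B)) = F' * (X' * ?B)" .
  have "colspan n (first_cols k (ev ?y (A * B))) = colspan n F'"
    unfolding e by (rule full_rank_factors(3)[OF F'(1) _ fr(1)[unfolded e]]) (use F'(2) Bk in auto)
  then have "pi_map n k (snd y) (A * B) = Some x'"
    using fr(1) F'(3) sx' AC k by (simp add: pi_map_first_cols)
  moreover have "g_mat n l x = Some A" using x l by (simp add: g_of_iff)
  ultimately show ?thesis using gy by (cases y) (simp add: Psi_def)
qed

text \<open>The graph of the R-matrix: refactorisation of the product of two matrices with the types and the
  parameters exchanged. The condition on the parameters makes the factorisation unique.\<close>

definition R_rel :: "nat \<Rightarrow> nat \<Rightarrow> nat \<Rightarrow> point \<times> point \<Rightarrow> point \<times> point \<Rightarrow> bool" where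
  "R_rel n l k = (\<lambda>(x, y) (x', y'). \<exists>A B A' B'.
     g_of n l x A \<and> g_of n k y B \<and> g_of n k x' A' \<and> g_of n l y' B' \<and>
     A * B = A' * B' \<and> snd x' = snd y \<and> snd y' = snd x \<and> lam l (snd x) \<noteq> lam k (snd y))"

lemma R_relI:
  assumes "g_of n l x A" "g_of n k y B" "g_of n k x' A'" "g_of n l y' B'"
    "A * B = A' * B'" "snd x' = snd y" "snd y' = snd x" "lam l (snd x) \<noteq> lam k (snd y)"
  shows "R_rel n l k (x, y) (x', y')"
  unfolding R_rel_def using assms by auto

lemma R_relE:
  assumes "R_rel n l k (x, y) (x', y')"
  obtains A B A' B' where "g_of n l x A" "g_of n k y B" "g_of n k x' A'" "g_of n l y' B'"
    "A * B = A' * B'" "snd x' = snd y" "snd y' = snd x" "lam l (snd x) \<noteq> lam k (snd y)"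
  using assms unfolding R_rel_def by auto

lemma R_rel_sym: "R_rel n l k p q \<Longrightarrow> R_rel n k l q p"
  unfolding R_rel_def by (fastforce split: prod.splits)

text \<open>The first component is read off from the product by \<open>\<Psi>\<close>. As \<open>fl\<close> reverses products, the second
  component is the first one for the reflected product, reflected back.\<close>

lemma geo_R_eqI:
  assumes R: "R_rel n l k p q" and l: "0 < l" "l < n" and k: "0 < k" "k < n"
  shows "geo_R n l k p = Some q"
proof -
  obtain x y x' y' where pq: "p = (x, y)" "q = (x', y')" by (metis prod.exhaust)
  from R[unfolded pq] obtain A B A' B' where x: "g_of n l x A" and y: "g_of n k y B"
    and x': "g_of n k x' A'" and y': "g_of n l y' B'" and eq: "A * B = A' * B'"
    and s: "snd x' = snd y" "snd y' = snd x" and ne: "lam l (snd x) \<noteq> lam k (snd y)" by (rule R_relE)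
  note AC = g_of_carrier[OF x] g_of_carrier[OF y] g_of_carrier[OF x'] g_of_carrier[OF y']
  have P1: "Psi n k l (x, y) = Some x'" by (rule Psi_eqI[OF x y x' l k AC(4) eq s(1) ne])
  obtain Sx Sy where S: "geo_S2 n l k (x, y) = Some (Sy, Sx)" "g_of n l Sx (fl n A)" "g_of n k Sy (fl n B)"
    "snd Sx = snd x" "snd Sy = snd y" by (rule geo_S2_g_of[OF x y l k])
  obtain Sy' where Sy': "geo_S n l y' = Some Sy'" "g_of n l Sy' (fl n B')" "snd Sy' = snd y'"
    by (rule geo_S_g_of[OF y' l])
  have "fl n B * fl n A = fl n B' * fl n A'"
    using eq AC by (simp flip: fl_mult)
  then have P2: "Psi n l k (Sy, Sx) = Some Sy'"
    using S Sy' s ne by (intro Psi_eqI[OF S(3) S(2) Sy'(2) k l]) auto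
  have "geo_S n l Sy' = Some y'" by (rule geo_S_involution[OF y' l Sy'(1)])
  then have "(geo_S n l \<circ>\<^sub>m Psi n l k \<circ>\<^sub>m geo_S2 n l k) (x, y) = Some y'"
    using S(1) P2 by (simp add: map_comp_def)
  then show ?thesis using P1 by (simp add: geo_R_def pq)
qed

lemma R_rel_functional:
  assumes "R_rel n l k p q" "R_rel n l k p q'" "0 < l" "l < n" "0 < k" "k < n"
  shows "q = q'"
  using assms geo_R_eqI by (metis option.inject)

section \<open>Symmetries\<close>

subsection \<open>Commutation with \<open>S\<close>\<close>

lemma R_rel_S:
  assumes R: "R_rel n l k p q" and l: "0 < l" "l < n" and k: "0 < k" "k < n"
  obtains p' q' where "geo_S2 n l k p = Some p'" "geo_S2 n k l q = Some q'" "R_rel n k l p' q'"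
proof -
  obtain x y x' y' where pq: "p = (x, y)" "q = (x', y')" by (metis prod.exhaust)
  from R[unfolded pq] obtain A B A' B' where x: "g_of n l x A" and y: "g_of n k y B"
    and x': "g_of n k x' A'" and y': "g_of n l y' B'" and eq: "A * B = A' * B'"
    and s: "snd x' = snd y" "snd y' = snd x" and ne: "lam l (snd x) \<noteq> lam k (snd y)" by (rule R_relE)
  note AC = g_of_carrier[OF x] g_of_carrier[OF y] g_of_carrier[OF x'] g_of_carrier[OF y']
  obtain Sx Sy where S: "geo_S2 n l k (x, y) = Some (Sy, Sx)" "g_of n l Sx (fl n A)" "g_of n k Sy (fl n B)"
    "snd Sx = snd x" "snd Sy = snd y" by (rule geo_S2_g_of[OF x y l k])
  obtain Sx' Sy' where S': "geo_S2 n k l (x', y') = Some (Sy', Sx')" "g_of n k Sx' (fl n A')" "g_of n l Sy' (fl n B')"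
    "snd Sx' = snd x'" "snd Sy' = snd y'" by (rule geo_S2_g_of[OF x' y' k l])
  have "fl n B * fl n A = fl n B' * fl n A'" using eq AC by (simp flip: fl_mult)
  then have "R_rel n k l (Sy, Sx) (Sy', Sx')"
    using S S' s ne by (intro R_relI[OF S(3) S(2) S'(3) S'(2)]) auto
  then show ?thesis using that S(1) S'(1) pq by blast
qed

subsection \<open>Commutation with \<open>D\<close>\<close>

lemma geo_D_g_of:
  assumes x: "g_of n k x G" and k: "0 < k" "k < n"
  obtains Q d where "g_of n (n - k) (mu n x) Q" "geo_S n (n - k) (mu n x) = Some d"
    "g_of n (n - k) d (fl n Q)" "snd d = snd x"
proof -
  obtain Q where Q: "g_of n (n - k) (mu n x) Q" by (rule mu_g_of[OF x k])
  have "snd (mu n x) = snd x" by (cases x) (simp add: mu_def)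
  then show ?thesis using geo_S_g_of[OF Q] k that[OF Q] by fastforce
qed

lemma scalar_mat_mult:
  fixes c :: "'a :: comm_ring_1"
  assumes "M \<in> carrier_mat n n"
  shows "(c \<cdot>\<^sub>m 1\<^sub>m n) * M = c \<cdot>\<^sub>m M" "M * (c \<cdot>\<^sub>m 1\<^sub>m n) = c \<cdot>\<^sub>m M"
  using mult_smult_assoc_mat[OF one_carrier_mat assms, of c] mult_smult_distrib[OF assms one_carrier_mat, of c] assms
  by auto

lemma inverse_of_product:
  fixes c d :: "'a :: idom"
  assumes C: "A \<in> carrier_mat n n" "B \<in> carrier_mat n n" "H \<in> carrier_mat n n" "K \<in> carrier_mat n n"
    and H: "H * A = c \<cdot>\<^sub>m 1\<^sub>m n" "A * H = c \<cdot>\<^sub>m 1\<^sub>m n" and K: "K * B = d \<cdot>\<^sub>m 1\<^sub>m n" "B * K = d \<cdot>\<^sub>m 1\<^sub>m n"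
  shows "(K * H) * (A * B) = (c * d) \<cdot>\<^sub>m 1\<^sub>m n" "(A * B) * (K * H) = (c * d) \<cdot>\<^sub>m 1\<^sub>m n"
proof -
  have "(K * H) * (A * B) = K * ((H * A) * B)"
    using C by (simp add: assoc_mult_mat[of _ n n _ n _ n])
  also have "\<dots> = (c * d) \<cdot>\<^sub>m 1\<^sub>m n"
    unfolding H scalar_mat_mult[OF C(2)] mult_smult_distrib[OF C(4,2)] K by (intro eq_matI) auto
  finally show "(K * H) * (A * B) = (c * d) \<cdot>\<^sub>m 1\<^sub>m n" .
  have "(A * B) * (K * H) = A * ((B * K) * H)"
    using C by (simp add: assoc_mult_mat[of _ n n _ n _ n])
  also have "\<dots> = (c * d) \<cdot>\<^sub>m 1\<^sub>m n"
    unfolding K scalar_mat_mult[OF C(3)] mult_smult_distrib[OF C(1,3)] H by (intro eq_matI) (auto simp: mult.commute)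
  finally show "(A * B) * (K * H) = (c * d) \<cdot>\<^sub>m 1\<^sub>m n" .
qed

lemma dual_mat_mult:
  assumes "A \<in> carrier_mat n n" "B \<in> carrier_mat n n"
  shows "dual_mat n k A * dual_mat n l B = [:(- 1) ^ (k + l):] \<cdot>\<^sub>m twist n (fl n A * fl n B)"
proof -
  have t: "twist n (fl n A) \<in> carrier_mat n n" "twist n (fl n B) \<in> carrier_mat n n"
    "[:(- 1) ^ l:] \<cdot>\<^sub>m twist n (fl n B) \<in> carrier_mat n n" by auto
  show ?thesis
    unfolding dual_mat_def mult_smult_assoc_mat[OF t(1,3)] mult_smult_distrib[OF t(1,2)]
      twist_mult[OF fl_carrier fl_carrier]
    by (intro eq_matI) (auto simp: power_add mult.commute)
qed

text \<open>\<open>D\<close> corresponds to matrix inversion up to a scalar and an automorphism, so it reverses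
  factorisations.\<close>

lemma R_rel_D:
  assumes R: "R_rel n l k p q" and l: "0 < l" "l < n" and k: "0 < k" "k < n"
  obtains p' q' where "geo_D2 n l k p = Some p'" "geo_D2 n k l q = Some q'" "R_rel n (n - k) (n - l) p' q'"
proof -
  obtain x y x' y' where pq: "p = (x, y)" "q = (x', y')" by (metis prod.exhaust)
  from R[unfolded pq] obtain A B A' B' where x: "g_of n l x A" and y: "g_of n k y B"
    and x': "g_of n k x' A'" and y': "g_of n l y' B'" and eq: "A * B = A' * B'"
    and s: "snd x' = snd y" "snd y' = snd x" and ne: "lam l (snd x) \<noteq> lam k (snd y)" by (rule R_relE)
  note AC = g_of_carrier[OF x] g_of_carrier[OF y] g_of_carrier[OF x'] g_of_carrier[OF y']
  obtain P dx where dx: "g_of n (n - l) (mu n x) P" "geo_S n (n - l) (mu n x) = Some dx" "g_of n (n - l) dx (fl n P)" "snd dx = snd x"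
    by (rule geo_D_g_of[OF x l])
  obtain Q dy where dy: "g_of n (n - k) (mu n y) Q" "geo_S n (n - k) (mu n y) = Some dy" "g_of n (n - k) dy (fl n Q)" "snd dy = snd y"
    by (rule geo_D_g_of[OF y k])
  obtain P' dx' where dx': "g_of n (n - k) (mu n x') P'" "geo_S n (n - k) (mu n x') = Some dx'" "g_of n (n - k) dx' (fl n P')" "snd dx' = snd x'"
    by (rule geo_D_g_of[OF x' k])
  obtain Q' dy' where dy': "g_of n (n - l) (mu n y') Q'" "geo_S n (n - l) (mu n y') = Some dy'" "g_of n (n - l) dy' (fl n Q')" "snd dy' = snd y'"
    by (rule geo_D_g_of[OF y' l])
  note PC = g_of_carrier[OF dx(1)] g_of_carrier[OF dy(1)] g_of_carrier[OF dx'(1)] g_of_carrier[OF dy'(1)]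
  define c where "c = [:- lam l (snd x), 1:] * [:- lam k (snd y), 1:]"
  let ?I = "dual_mat n k Q * dual_mat n l P" and ?J = "dual_mat n l Q' * dual_mat n k P'" and ?M = "A * B"
  have dC: "dual_mat n m M \<in> carrier_mat n n" for m M by (simp add: dual_mat_def)
  have IC: "?I \<in> carrier_mat n n" "?J \<in> carrier_mat n n" and MC: "?M \<in> carrier_mat n n"
    using mult_carrier_mat[OF dC dC] AC by auto
  note ix = dual_mat_inverse(2,3)[OF x l dx(1)] and iy = dual_mat_inverse(2,3)[OF y k dy(1)]
    and ix' = dual_mat_inverse(2,3)[OF x' k dx'(1)] and iy' = dual_mat_inverse(2,3)[OF y' l dy'(1)]
  have MI: "?M * ?I = c \<cdot>\<^sub>m 1\<^sub>m n"
    unfolding c_def by (rule inverse_of_product(2)[OF AC(1,2) dC dC ix iy])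
  have JM: "?J * ?M = c \<cdot>\<^sub>m 1\<^sub>m n"
    using inverse_of_product(1)[OF AC(3,4) dC dC ix' iy'] unfolding eq c_def s by (simp only: mult.commute)
  have "c \<cdot>\<^sub>m ?J = ?J * (?M * ?I)" unfolding MI scalar_mat_mult[OF IC(2)] ..
  also have "\<dots> = (?J * ?M) * ?I" by (rule assoc_mult_mat[symmetric, OF IC(2) MC IC(1)])
  also have "\<dots> = c \<cdot>\<^sub>m ?I" unfolding JM scalar_mat_mult[OF IC(1)] ..
  finally have cJ: "c \<cdot>\<^sub>m ?J = c \<cdot>\<^sub>m ?I" .
  have "c \<noteq> 0" unfolding c_def by (simp only: mult_eq_0_iff pCons_eq_0_iff one_neq_zero simp_thms)
  then have "?J = ?I" by (rule smult_mat_cancel[OF _ IC(2,1) cJ])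
  then have "[:(- 1) ^ (k + l):] \<cdot>\<^sub>m twist n (fl n Q' * fl n P') = [:(- 1) ^ (k + l):] \<cdot>\<^sub>m twist n (fl n Q * fl n P)"
    unfolding dual_mat_mult[OF PC(2,1)] dual_mat_mult[OF PC(4,3)] by (simp only: add.commute)
  then have "twist n (fl n Q' * fl n P') = twist n (fl n Q * fl n P)"
    by (rule smult_mat_cancel[OF _ twist_carrier twist_carrier, rotated]) simp
  then have "twist n (twist n (fl n Q' * fl n P')) = twist n (twist n (fl n Q * fl n P))" by (rule arg_cong)
  then have e: "fl n Q * fl n P = fl n Q' * fl n P'"
    unfolding twist_twist[OF mult_carrier_mat[OF fl_carrier fl_carrier]] ..
  have "lam (n - k) (snd y) \<noteq> lam (n - l) (snd x)"
    using ne unfolding lam_dual[OF k, symmetric] lam_dual[OF l, symmetric] by simp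
  then have "R_rel n (n - k) (n - l) (dy, dx) (dy', dx')"
    using dx dy dx' dy' s by (intro R_relI[OF dy(3) dx(3) dy'(3) dx'(3) e]) auto
  moreover have "geo_D2 n l k p = Some (dy, dx)" "geo_D2 n k l q = Some (dy', dx')"
    using dx dy dx' dy' by (simp_all add: pq geo_D2_def geo_S2_def map_comp_def)
  ultimately show ?thesis using that by blast
qed

subsection \<open>Commutation with \<open>PR\<close>\<close>

text \<open>The cyclic shift, with \<open>n\<close>-th power \<open>\<lambda>\<close>. Conjugation by it moves all entries of the unfolded matrix
  one step down the diagonal; for the first column this divides by \<open>\<lambda>\<close>, which is possible for band
  matrices.\<close>

definition shift_mat :: "nat \<Rightarrow> complex poly mat" where
  "shift_mat n = mat n n (\<lambda>(i, j). if i = Suc j then 1 else if i = 0 \<and> j = n - 1 then [:0, 1:] else 0)"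

definition shift_conj :: "nat \<Rightarrow> complex poly mat \<Rightarrow> complex poly mat" where
  "shift_conj n G = mat n n (\<lambda>(i, j).
    if i = 0 then if j = 0 then G $$ (n - 1, n - 1) else [:0, 1:] * G $$ (n - 1, j - 1)
    else if j = 0 then poly_shift 1 (G $$ (i - 1, n - 1)) else G $$ (i - 1, j - 1))"

lemma shift_mat_left:
  assumes n: "n \<ge> 2" and G: "G \<in> carrier_mat n m" and ij: "i < n" "j < m"
  shows "(shift_mat n * G) $$ (i, j) = (if i = 0 then [:0, 1:] * G $$ (n - 1, j) else G $$ (i - 1, j))"
proof -
  have "(shift_mat n * G) $$ (i, j) = (\<Sum>l<n. shift_mat n $$ (i, l) * G $$ (l, j))"
    using assms by (simp add: shift_mat_def scalar_prod_def atLeast0LessThan)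
  also have "\<dots> = (\<Sum>l<n. if l = (if i = 0 then n - 1 else i - 1) then (if i = 0 then [:0, 1:] else 1) * G $$ (l, j) else 0)"
    using ij n by (intro sum.cong refl) (auto simp: shift_mat_def)
  finally show ?thesis using ij n by (cases i) auto
qed

lemma shift_mat_right:
  assumes n: "n \<ge> 2" and G: "G \<in> carrier_mat m n" and ij: "i < m" "j < n"
  shows "(G * shift_mat n) $$ (i, j) = (if j = n - 1 then [:0, 1:] * G $$ (i, 0) else G $$ (i, Suc j))"
proof -
  have "(G * shift_mat n) $$ (i, j) = (\<Sum>l<n. G $$ (i, l) * shift_mat n $$ (l, j))"
    using assms by (simp add: shift_mat_def scalar_prod_def atLeast0LessThan)
  also have "\<dots> = (\<Sum>l<n. if l = (if j = n - 1 then 0 else Suc j) then G $$ (i, l) * (if j = n - 1 then [:0, 1:] else 1) else 0)"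
    using ij n by (intro sum.cong refl) (auto simp: shift_mat_def)
  finally show ?thesis using ij n by auto
qed

lemma shift_mat_carrier [simp]: "shift_mat n \<in> carrier_mat n n"
  by (simp add: shift_mat_def)

lemma shift_mat_cancel:
  assumes n: "n \<ge> 2" and A: "A \<in> carrier_mat n n" and B: "B \<in> carrier_mat n n"
    and eq: "A * shift_mat n = B * shift_mat n"
  shows "A = B"
proof (rule eq_matI)
  fix i j assume "i < dim_row B" "j < dim_col B"
  then have ij: "i < n" "j < n" using B by auto
  show "A $$ (i, j) = B $$ (i, j)"
  proof (cases j)
    case 0
    have "[:0, 1:] * A $$ (i, 0) = [:0, 1:] * B $$ (i, 0)"
      using shift_mat_right[OF n A ij(1), of "n - 1"] shift_mat_right[OF n B ij(1), of "n - 1"] n eq by simp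
    then have "A $$ (i, 0) = B $$ (i, 0)" by simp
    then show ?thesis using 0 by simp
  next
    case (Suc j')
    then have "(A * shift_mat n) $$ (i, j') = A $$ (i, j)" "(B * shift_mat n) $$ (i, j') = B $$ (i, j)"
      using shift_mat_right[OF n A ij(1), of j'] shift_mat_right[OF n B ij(1), of j'] ij by auto
    then show ?thesis using eq by simp
  qed
qed (use A B in auto)

lemma colspan_left_mult:
  assumes Z: "Z \<in> carrier_mat n n" and F: "F \<in> carrier_mat n k"
  shows "colspan n (Z * F) = (*\<^sub>v) Z ` colspan n F"
  unfolding colspan_eq_image[OF F] colspan_eq_image[OF mult_carrier_mat[OF Z F]] image_image
  by (rule image_cong[OF refl]) (rule assoc_mult_mat_vec[OF Z F])

text \<open>\<open>PR\<close> multiplies a frame by the shift matrix at \<open>lam k t\<close>.\<close>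

lemma PR_g_of:
  assumes x: "g_of n k x G" and k: "0 < k" "k < n" and n: "n \<ge> 2"
  obtains G' where "g_of n k (PR n k x) G'" "shift_mat n * G = G' * shift_mat n"
proof -
  obtain F X where F: "F \<in> carrier_mat n k" and X: "X \<in> carrier_mat k n"
    and xe: "x = (colspan n F, snd x)" and eq: "ev (lam k (snd x)) G = F * X"
    and t: "snd x \<noteq> 0" and G: "banded n (n - k) G"
    by (rule g_of_frame[OF x k])
  let ?z = "lam k (snd x)"
  let ?G' = "shift_conj n G" and ?L = "shift_mat n"
  have GC: "G \<in> carrier_mat n n" by (rule banded_carrier[OF G])
  have G'C: "?G' \<in> carrier_mat n n" by (simp add: shift_conj_def)
  have shifted: "[:0, 1:] * poly_shift 1 (G $$ (i, n - 1)) = G $$ (i, n - 1)" if "i < n - 1" for i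
  proof (rule poly_eqI)
    fix m
    have "coeff (G $$ (i, n - 1)) 0 = 0" by (rule banded_zero[OF G]) (use that in auto)
    then show "coeff ([:0, 1:] * poly_shift 1 (G $$ (i, n - 1))) m = coeff (G $$ (i, n - 1)) m"
      by (cases m) (auto simp: coeff_poly_shift)
  qed
  have LG: "?L * G = ?G' * ?L"
  proof (rule eq_matI)
    fix i j assume "i < dim_row (?G' * ?L)" "j < dim_col (?G' * ?L)"
    then have ij: "i < n" "j < n" using G'C carrier_matD[OF shift_mat_carrier, of n] by auto
    show "(?L * G) $$ (i, j) = (?G' * ?L) $$ (i, j)"
      unfolding shift_mat_left[OF n GC ij] shift_mat_right[OF n G'C ij]
      using ij n shifted[of "i - 1"] by (auto simp: shift_conj_def simp del: mult_pCons_left)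
  qed (use GC G'C carrier_matD[OF shift_mat_carrier, of n] in auto)
  have G'b: "banded n (n - k) ?G'"
  proof (rule bandedI[OF G'C])
    fix i j m assume ij: "i < n" "j < n"
    \<comment> \<open>The entry of \<open>G\<close> one step up the diagonal, with rows and columns wrapped around.\<close>
    define i' where "i' = (if i = 0 then n - 1 else i - 1)"
    define j' where "j' = (if j = 0 then n - 1 else j - 1)"
    have ij': "i' < n" "j' < n" using ij by (auto simp: i'_def j'_def)
    have co: "coeff (?G' $$ (i, j)) m =
      (if i = 0 \<and> j \<noteq> 0 then (case m of 0 \<Rightarrow> 0 | Suc m' \<Rightarrow> coeff (G $$ (i', j')) m')
       else coeff (G $$ (i', j')) (if i \<noteq> 0 \<and> j = 0 then Suc m else m))"
      using ij by (auto simp: shift_conj_def i'_def j'_def coeff_poly_shift coeff_pCons split: nat.split)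
    show "coeff (?G' $$ (i, j)) m = 0" if out: "i + n * m < j \<or> j + (n - k) < i + n * m"
    proof (cases "i = 0 \<and> j \<noteq> 0")
      case True
      show ?thesis
      proof (cases m)
        case (Suc m')
        have "coeff (G $$ (i', j')) m' = 0"
          by (rule banded_zero[OF G ij']) (use out True Suc ij in \<open>auto simp: i'_def j'_def\<close>)
        then show ?thesis using co True Suc by simp
      qed (use co True in simp)
    next
      case False
      have "coeff (G $$ (i', j')) (if i \<noteq> 0 \<and> j = 0 then Suc m else m) = 0"
        by (rule banded_zero[OF G ij']) (use out False ij in \<open>auto simp: i'_def j'_def\<close>)
      then show ?thesis using co False by (auto split: if_splits)
    qed
    show "coeff (?G' $$ (i, j)) m = 1" if top: "i + n * m = j + (n - k)"
    proof (cases "i = 0 \<and> j \<noteq> 0")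
      case True
      then obtain m' where m: "m = Suc m'" using top k by (cases m) auto
      have "coeff (G $$ (i', j')) m' = 1"
        by (rule banded_top[OF G ij']) (use top True m ij in \<open>auto simp: i'_def j'_def\<close>)
      then show ?thesis using co True m by simp
    next
      case False
      have "coeff (G $$ (i', j')) (if i \<noteq> 0 \<and> j = 0 then Suc m else m) = 1"
        by (rule banded_top[OF G ij']) (use top False ij in \<open>auto simp: i'_def j'_def\<close>)
      then show ?thesis using co False by (auto split: if_splits)
    qed
  qed
  define K where "K = mat n n (\<lambda>(i, j). if j = Suc i then 1 else if i = n - 1 \<and> j = 0 then 1 / ?z else (0::complex))"
  have K: "K \<in> carrier_mat n n" by (simp add: K_def)
  have LC: "ev ?z ?L \<in> carrier_mat n n" by simp
  have LK: "ev ?z ?L * K = 1\<^sub>m n"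
  proof (rule eq_matI)
    fix i j assume "i < dim_row (1\<^sub>m n)" "j < dim_col (1\<^sub>m n)"
    then have ij: "i < n" "j < n" by auto
    have "(ev ?z ?L * K) $$ (i, j) = (\<Sum>l<n. ev ?z ?L $$ (i, l) * K $$ (l, j))"
      using ij K LC by (simp add: scalar_prod_def atLeast0LessThan shift_mat_def)
    also have "\<dots> = (\<Sum>l<n. if l = (if i = 0 then n - 1 else i - 1) then (if i = j then 1 else 0) else 0)"
      using ij n t by (intro sum.cong refl) (auto simp: shift_mat_def K_def)
    also have "\<dots> = 1\<^sub>m n $$ (i, j)" using ij n by auto
    finally show "(ev ?z ?L * K) $$ (i, j) = 1\<^sub>m n $$ (i, j)" .
  qed (use K in \<open>auto simp: shift_mat_def\<close>)
  have G'z: "ev ?z ?G' \<in> carrier_mat n n" using G'C by simp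
  have LF: "ev ?z ?L * F \<in> carrier_mat n k" by (rule mult_carrier_mat[OF LC F])
  have "ev ?z ?G' = ev ?z ?G' * (ev ?z ?L * K)" unfolding LK using G'z by simp
  also have "\<dots> = (ev ?z ?G' * ev ?z ?L) * K" by (rule assoc_mult_mat[symmetric, OF G'z LC K])
  also have "ev ?z ?G' * ev ?z ?L = ev ?z ?L * (F * X)"
    using arg_cong[OF LG, of "ev ?z"] unfolding ev_mult[OF shift_mat_carrier GC] ev_mult[OF G'C shift_mat_carrier] eq by simp
  also have "\<dots> = ev ?z ?L * F * X" by (rule assoc_mult_mat[symmetric, OF LC F X])
  also have "\<dots> * K = ev ?z ?L * F * (X * K)" by (rule assoc_mult_mat[OF LF X K])
  finally have e: "ev ?z ?G' = (ev ?z ?L * F) * (X * K)" .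
  have "(\<lambda>v. vec n (\<lambda>i. if i = 0 then (- 1) ^ (k - 1) * snd x * v $ (n - 1) else v $ (i - 1))) ` colspan n F
      = (*\<^sub>v) (ev ?z ?L) ` colspan n F"
  proof (rule image_cong[OF refl])
    fix v assume "v \<in> colspan n F"
    then have v: "v \<in> carrier_vec n" unfolding colspan_eq_image[OF F] using F by auto
    show "vec n (\<lambda>i. if i = 0 then (- 1) ^ (k - 1) * snd x * v $ (n - 1) else v $ (i - 1)) = ev ?z ?L *\<^sub>v v"
    proof (rule eq_vecI)
      fix i assume "i < dim_vec (ev ?z ?L *\<^sub>v v)"
      then have i: "i < n" by (simp add: shift_mat_def)
      have "(ev ?z ?L *\<^sub>v v) $ i = (\<Sum>l<n. ev ?z ?L $$ (i, l) * v $ l)"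
        using i v LC by (simp add: scalar_prod_def atLeast0LessThan shift_mat_def)
      also have "\<dots> = (\<Sum>l<n. if l = (if i = 0 then n - 1 else i - 1) then (if i = 0 then ?z else 1) * v $ l else 0)"
        using i n by (intro sum.cong refl) (auto simp: shift_mat_def)
      finally show "vec n (\<lambda>i. if i = 0 then (- 1) ^ (k - 1) * snd x * v $ (n - 1) else v $ (i - 1)) $ i = (ev ?z ?L *\<^sub>v v) $ i"
        using i n by (auto simp: lam_def)
    qed (simp add: shift_mat_def)
  qed
  then have PRx: "PR n k x = (colspan n (ev ?z ?L * F), snd x)"
    unfolding colspan_left_mult[OF LC F] by (subst xe) (simp add: PR_def)
  show ?thesis
    by (rule that[OF _ LG]) (unfold PRx, rule g_ofI[OF G'b t LF _ e], use X K in auto)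
qed

lemma snd_PR [simp]: "snd (PR n k x) = snd x"
  by (cases x) (simp add: PR_def)

lemma R_rel_PR:
  assumes R: "R_rel n l k p q" and l: "0 < l" "l < n" and k: "0 < k" "k < n" and n: "n \<ge> 2"
  shows "R_rel n l k (map_prod (PR n l) (PR n k) p) (map_prod (PR n k) (PR n l) q)"
proof -
  obtain x y x' y' where pq: "p = (x, y)" "q = (x', y')" by (metis prod.exhaust)
  from R[unfolded pq] obtain A B A' B' where x: "g_of n l x A" and y: "g_of n k y B"
    and x': "g_of n k x' A'" and y': "g_of n l y' B'" and eq: "A * B = A' * B'"
    and s: "snd x' = snd y" "snd y' = snd x" and ne: "lam l (snd x) \<noteq> lam k (snd y)" by (rule R_relE)
  note AC = g_of_carrier[OF x] g_of_carrier[OF y] g_of_carrier[OF x'] g_of_carrier[OF y']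
  let ?L = "shift_mat n"
  obtain A2 where A2: "g_of n l (PR n l x) A2" "?L * A = A2 * ?L" by (rule PR_g_of[OF x l n])
  obtain B2 where B2: "g_of n k (PR n k y) B2" "?L * B = B2 * ?L" by (rule PR_g_of[OF y k n])
  obtain A2' where A2': "g_of n k (PR n k x') A2'" "?L * A' = A2' * ?L" by (rule PR_g_of[OF x' k n])
  obtain B2' where B2': "g_of n l (PR n l y') B2'" "?L * B' = B2' * ?L" by (rule PR_g_of[OF y' l n])
  note AC2 = g_of_carrier[OF A2(1)] g_of_carrier[OF B2(1)] g_of_carrier[OF A2'(1)] g_of_carrier[OF B2'(1)]
  have slide: "(A2 * B2) * ?L = ?L * (A * B)"
    if C: "A \<in> carrier_mat n n" "B \<in> carrier_mat n n" "A2 \<in> carrier_mat n n" "B2 \<in> carrier_mat n n"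
      and e: "?L * A = A2 * ?L" "?L * B = B2 * ?L" for A B A2 B2 :: "complex poly mat"
  proof -
    have L: "?L \<in> carrier_mat n n" by simp
    have "(A2 * B2) * ?L = A2 * (?L * B)" unfolding e(2) by (rule assoc_mult_mat[OF C(3,4) L])
    also have "\<dots> = (?L * A) * B" unfolding e(1) by (rule assoc_mult_mat[symmetric, OF C(3) L C(2)])
    also have "\<dots> = ?L * (A * B)" by (rule assoc_mult_mat[OF L C(1,2)])
    finally show ?thesis .
  qed
  have "(A2 * B2) * ?L = (A2' * B2') * ?L"
    unfolding slide[OF AC(1,2) AC2(1,2) A2(2) B2(2)] slide[OF AC(3,4) AC2(3,4) A2'(2) B2'(2)] eq ..
  then have "A2 * B2 = A2' * B2'"
    by (rule shift_mat_cancel[OF n mult_carrier_mat[OF AC2(1,2)] mult_carrier_mat[OF AC2(3,4)]])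
  then show ?thesis unfolding pq map_prod_simp
    using s ne by (intro R_relI[OF A2(1) B2(1) A2'(1) B2'(1)]) auto
qed

section \<open>The geometric crystal structure in terms of \<open>g\<close>\<close>

definition dg :: "complex poly mat \<Rightarrow> nat \<Rightarrow> complex" where
  "dg G r = coeff (G $$ (r, r)) 0"

definition prev :: "nat \<Rightarrow> nat \<Rightarrow> nat" where
  "prev n i = (if i = 0 then n - 1 else i - 1)"

text \<open>The entries of grade 1 of the unfolded matrix.\<close>

definition sub :: "nat \<Rightarrow> complex poly mat \<Rightarrow> nat \<Rightarrow> complex" where
  "sub n G i = coeff (G $$ (i, prev n i)) (if i = 0 then 1 else 0)"

lemma prev_less: "i < n \<Longrightarrow> prev n i < n"
  by (auto simp: prev_def)

lemma prev_neq: "n \<ge> 2 \<Longrightarrow> i < n \<Longrightarrow> prev n i \<noteq> i"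
  by (auto simp: prev_def)

lemma coeff_mult_mat:
  assumes "A \<in> carrier_mat n n" "B \<in> carrier_mat n n" "i < n" "j < n"
  shows "coeff ((A * B) $$ (i, j)) m = (\<Sum>l<n. \<Sum>p\<le>m. coeff (A $$ (i, l)) p * coeff (B $$ (l, j)) (m - p))"
  using assms by (simp add: scalar_prod_def coeff_sum coeff_mult atLeast0LessThan)

lemma dg_mult:
  assumes A: "banded n d A" and B: "banded n e B" and r: "r < n"
  shows "dg (A * B) r = dg A r * dg B r"
proof -
  have "dg (A * B) r = (\<Sum>l<n. coeff (A $$ (r, l)) 0 * coeff (B $$ (l, r)) 0)"
    unfolding dg_def coeff_mult_mat[OF banded_carrier[OF A] banded_carrier[OF B] r r] by simp
  also have "\<dots> = (\<Sum>l<n. if l = r then dg A r * dg B r else 0)"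
  proof (intro sum.cong refl)
    fix l assume "l \<in> {..<n}"
    then have l: "l < n" by simp
    show "coeff (A $$ (r, l)) 0 * coeff (B $$ (l, r)) 0 = (if l = r then dg A r * dg B r else 0)"
      using banded_zero[OF A r l, of 0] banded_zero[OF B l r, of 0]
      by (cases l r rule: linorder_cases) (auto simp: dg_def)
  qed
  finally show ?thesis using r by simp
qed

lemma sub_mult:
  assumes A: "banded n d A" and B: "banded n e B" and i: "i < n" and n: "n \<ge> 2"
  shows "sub n (A * B) i = sub n A i * dg B (prev n i) + dg A i * sub n B i"
proof (cases "i = 0")
  case True
  note [simp] = True
  have l: "n - 1 < n" and z: "(0::nat) < n" using n by auto
  have "sub n (A * B) i = (\<Sum>l<n. \<Sum>p\<le>1. coeff (A $$ (0, l)) p * coeff (B $$ (l, n - 1)) (1 - p))"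
    using coeff_mult_mat[OF banded_carrier[OF A] banded_carrier[OF B] z l, of 1]
    by (simp only: sub_def prev_def True if_True simp_thms)
  also have "\<dots> = (\<Sum>l<n. coeff (A $$ (0, l)) 0 * coeff (B $$ (l, n - 1)) 1 + coeff (A $$ (0, l)) 1 * coeff (B $$ (l, n - 1)) 0)"
    by (simp add: numeral_eq_Suc)
  also have "\<dots> = (\<Sum>l<n. if l = 0 then dg A 0 * sub n B 0 else 0) + (\<Sum>l<n. if l = n - 1 then sub n A 0 * dg B (n - 1) else 0)"
    unfolding sum.distrib[symmetric]
  proof (intro sum.cong refl)
    fix l assume "l \<in> {..<n}"
    then have ln: "l < n" by simp
    have "coeff (A $$ (0, l)) 0 = 0" if "l \<noteq> 0" using banded_zero[OF A z ln, of 0] that by simp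
    moreover have "coeff (B $$ (l, n - 1)) 0 = 0" if "l \<noteq> n - 1"
      by (rule banded_zero[OF B ln l]) (use that ln in auto)
    ultimately show "coeff (A $$ (0, l)) 0 * coeff (B $$ (l, n - 1)) 1 + coeff (A $$ (0, l)) 1 * coeff (B $$ (l, n - 1)) 0
      = (if l = 0 then dg A 0 * sub n B 0 else 0) + (if l = n - 1 then sub n A 0 * dg B (n - 1) else 0)"
      using n by (auto simp: dg_def sub_def prev_def)
  qed
  finally show ?thesis using n by (simp add: prev_def)
next
  case False
  have p: "i - 1 < n" using i by auto
  have "sub n (A * B) i = (\<Sum>l<n. coeff (A $$ (i, l)) 0 * coeff (B $$ (l, i - 1)) 0)"
    using coeff_mult_mat[OF banded_carrier[OF A] banded_carrier[OF B] i p, of 0] False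
    by (simp add: sub_def prev_def)
  also have "\<dots> = (\<Sum>l<n. if l = i then dg A i * sub n B i else 0) + (\<Sum>l<n. if l = i - 1 then sub n A i * dg B (i - 1) else 0)"
    unfolding sum.distrib[symmetric]
  proof (intro sum.cong refl)
    fix l assume "l \<in> {..<n}"
    then have ln: "l < n" by simp
    have "coeff (A $$ (i, l)) 0 * coeff (B $$ (l, i - 1)) 0 = 0" if "l \<noteq> i" "l \<noteq> i - 1"
    proof (cases "i < l")
      case True
      then show ?thesis using banded_zero[OF A i ln, of 0] by simp
    next
      case False
      then have "l + n * 0 < i - 1" using that by simp
      then show ?thesis using banded_zero[OF B ln p, of 0] by simp
    qed
    then show "coeff (A $$ (i, l)) 0 * coeff (B $$ (l, i - 1)) 0
      = (if l = i then dg A i * sub n B i else 0) + (if l = i - 1 then sub n A i * dg B (i - 1) else 0)"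
      using False by (auto simp: dg_def sub_def prev_def)
  qed
  finally show ?thesis using False i by (simp add: prev_def)
qed

lemma row_set_window_prev:
  assumes k: "0 < k" "k < n" and i: "i < n"
  shows "row_set n {int i - int k..int i - 1} = window n k (prev n i)"
proof (cases "i = 0")
  case True
  have e: "- int k - 1 + 2 * int n = int (n - 1 + (n - k))" using k by auto
  have "(- int k - 1) mod int n = (- int k - 1 + 2 * int n) mod int n" by simp
  then have "(- int k - 1) mod int n = int (n - 1 + (n - k)) mod int n" unfolding e .
  from row_set_interval[OF _ this, of k] show ?thesis using True k by (simp add: window_def prev_def)
next
  case False
  then show ?thesis using row_set_window[OF k, of "i - 1"] by (simp add: prev_def of_nat_diff)
qed

lemma row_set_gap_prev:
  assumes k: "0 < k" "k < n" and i: "i < n"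
  shows "row_set n {int i - int k + 1..int i - 1} = gap n k (prev n i)"
proof (cases "i = 0")
  case True
  have e: "- int k + int n * 2 = int (Suc (n - 1 + (n - k)))" using k by auto
  have "(- int k + int n * 2) mod int n = (- int k) mod int n" by (rule mod_mult_self2)
  then have "(- int k + 1 - 1) mod int n = (- int k + int n * 2) mod int n" by simp
  then have "(- int k + 1 - 1) mod int n = int (Suc (n - 1 + (n - k))) mod int n" unfolding e .
  from row_set_interval[OF _ this, of "k - 1"] show ?thesis using True k by (simp add: gap_def prev_def)
next
  case False
  then show ?thesis using row_set_gap[OF k, of "i - 1"] by (simp add: prev_def of_nat_diff algebra_simps)
qed

lemma insert_gap_eq_window:
  assumes k: "0 < k" "k < n" and r: "r < n"
  shows "insert r (gap n k r) = window n k (Suc r)" and "r \<notin> gap n k r"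
proof -
  show ng: "r \<notin> gap n k r" unfolding gap_def cyc_gap_iff[OF k r r] by simp
  have "gap n k r \<subseteq> window n k (Suc r)"
    unfolding gap_def window_def cyc_def by auto
  moreover have "r \<in> window n k (Suc r)"
    unfolding window_def cyc_def using k r by (intro image_eqI[of _ _ "k - 1"]) auto
  ultimately have "insert r (gap n k r) \<subseteq> window n k (Suc r)" by simp
  moreover have "card (insert r (gap n k r)) = card (window n k (Suc r))"
    using card_insert_gap[OF k, of r r] ng card_window[of k n "Suc r"] k by simp
  ultimately show "insert r (gap n k r) = window n k (Suc r)"
    by (intro card_subset_eq) (simp_all add: window_def)
qed

lemma window_n: "window n k n = window n k 0"
  by (simp add: window_def cyc_def add.assoc)

lemma not_in_gap_prev:
  assumes k: "0 < k" "k < n" and i: "i < n"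
  shows "i \<notin> gap n k (prev n i)"
  unfolding gap_def cyc_gap_iff[OF k i prev_less[OF i]] using k by (auto simp: prev_def)

text \<open>The gap of column \<open>r\<close> and the row \<open>r\<close> form the window of the next column, so that the diagonal of \<open>g\<close>
  consists of quotients of window minors. The other Pluecker coordinates in the formulas of the
  crystal occur in the entries of grade 1.\<close>

lemma crystal_g_of:
  assumes x: "g_of n k x G" and k: "0 < k" "k < n" and n: "n \<ge> 2"
  shows "\<And>r. r < n \<Longrightarrow> dg G r \<noteq> 0"
    and "\<And>r. r < n \<Longrightarrow> X_gam n k (Suc r) x = Some (dg G r)"
    and "\<And>i. i < n \<Longrightarrow> X_phi n k i x = Some (sub n G i / dg G (prev n i))"
    and "\<And>i. i < n \<Longrightarrow> X_eps n k i x = Some (sub n G i / dg G i)"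
proof -
  obtain F where F: "F \<in> full_rank_mats n k" and xe: "x = (colspan n F, snd x)"
    and t: "snd x \<noteq> 0" and gm: "g_mat n k x = Some G"
    and nz: "\<And>c. c < n \<Longrightarrow> minor (window n k c) F \<noteq> 0"
    by (rule g_of_frame[OF x k]) blast
  let ?t = "snd x" and ?N = "colspan n F"
  define W where "W c = minor (window n k c) F" for c
  define V where "V i = minor (insert i (gap n k (prev n i))) F" for i
  have n0: "n > 0" using n by simp
  obtain e where e: "e \<noteq> 0" and P: "\<And>I. pluecker n k ?N I =
      (if card (row_set n I) = k then e * minor (row_set n I) F else 0)"
    by (rule pluecker_colspan[OF F n0]) auto
  have Wn: "W n = W 0" by (simp add: W_def window_n)
  have Wnz: "W c \<noteq> 0" if "c \<le> n" for c
    using nz[of c] nz[of 0] that Wn n by (cases "c = n") (auto simp: W_def)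
  have PW: "pluecker n k ?N {int c + 1 - int k..int c} = e * W c" for c
    using k unfolding P row_set_window[OF k] by (simp add: card_window W_def)
  have PW': "pluecker n k ?N {int i - int k..int i - 1} = e * W (prev n i)" if "i < n" for i
    using k unfolding P row_set_window_prev[OF k that] by (simp add: card_window W_def)
  have PV: "pluecker n k ?N ({int i - int k + 1..int i - 1} \<union> {int i + 1}) = e * V i" if i: "i < n" for i
  proof -
    have "row_set n ({int i - int k + 1..int i - 1} \<union> {int i + 1}) = insert i (gap n k (prev n i))"
      unfolding row_set_Un row_set_gap_prev[OF k i] row_set_singleton[OF i] by simp
    then show ?thesis unfolding P using card_insert_gap[OF k, of i "prev n i"] not_in_gap_prev[OF k i] by (simp add: V_def)
  qed
  have Ge: "G $$ (i, j) = Polynomial.smult (minor_ratio n k F i j)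
            (if j < k then 1 else if j \<le> i then [:?t:] else [:0, 1:])" if "i < n" "j < n" for i j
    using gm that unfolding g_mat_colspan[OF F k, of ?t, folded xe] by (auto split: if_splits)
  have dG: "dg G r = (if r < k then 1 else ?t) * W (Suc r) / W r" if r: "r < n" for r
    unfolding dg_def Ge[OF r r] minor_ratio_def using insert_gap_eq_window[OF k r] by (simp add: W_def)
  have sG: "sub n G i = (if i \<le> k then 1 else ?t) * V i / W (prev n i)" if i: "i < n" for i
  proof (cases "i = 0")
    case True
    have "\<not> prev n 0 < k" "\<not> prev n 0 \<le> 0" using k n by (auto simp: prev_def)
    then show ?thesis unfolding sub_def Ge[OF i prev_less[OF i]] minor_ratio_def
      using not_in_gap_prev[OF k i] True by (simp add: V_def W_def)
  next
    case False
    have "(prev n i < k) = (i \<le> k)" "prev n i \<le> i" using False by (auto simp: prev_def)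
    then show ?thesis unfolding sub_def Ge[OF i prev_less[OF i]] minor_ratio_def
      using not_in_gap_prev[OF k i] False by (simp add: V_def W_def)
  qed
  show dnz: "dg G r \<noteq> 0" if r: "r < n" for r
    unfolding dG[OF r] using Wnz[of r] Wnz[of "Suc r"] t r by simp
  show "X_gam n k (Suc r) x = Some (dg G r)" if r: "r < n" for r
  proof -
    have a: "{int (Suc r) - int k + 1..int (Suc r)} = {int (Suc r) + 1 - int k..int (Suc r)}"
      "{int (Suc r) - int k..int (Suc r) - 1} = {int r + 1 - int k..int r}" by auto
    show ?thesis
      by (subst xe) (simp only: X_gam_def prod.case Let_def a PW, use dG[OF r] Wnz[of r] e r in \<open>simp add: pdiv_def\<close>)
  qed
  have a: "{int i - int k + 1..int i} = {int i + 1 - int k..int i}" for i by auto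
  show "X_phi n k i x = Some (sub n G i / dg G (prev n i))" if i: "i < n" for i
  proof -
    have X: "X_phi n k i x = Some (V i / ((if i = 0 then ?t else 1) * W i))"
      by (subst xe) (simp only: X_phi_def prod.case Let_def a PW PV[OF i], use Wnz[of i] e i t in \<open>simp add: pdiv_def\<close>)
    show ?thesis
    proof (cases "i = 0")
      case True
      have d: "dg G (prev n i) = ?t * W i / W (prev n i)"
        using dG[of "n - 1"] k True Wn by (auto simp: prev_def)
      have s: "sub n G i = V i / W (prev n i)" using sG[OF i] True by simp
      show ?thesis unfolding X d s using True Wnz[of i] Wnz[of "prev n i"] prev_less[OF i] i t
        by (simp add: field_simps)
    next
      case False
      have d: "dg G (prev n i) = (if i \<le> k then 1 else ?t) * W i / W (prev n i)"
        using dG[OF prev_less[OF i]] False by (auto simp: prev_def)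
      show ?thesis unfolding X d sG[OF i] using False Wnz[of i] Wnz[of "prev n i"] prev_less[OF i] i t
        by (simp add: field_simps)
    qed
  qed
  show "X_eps n k i x = Some (sub n G i / dg G i)" if i: "i < n" for i
  proof -
    have b: "{int i - int k + 2..int i + 1} = {int (Suc i) + 1 - int k..int (Suc i)}" by auto
    have X: "X_eps n k i x = Some (V i * W i / ((if i = k then ?t else 1) * (W (prev n i) * W (Suc i))))"
      by (subst xe) (simp only: X_eps_def prod.case Let_def a b PW PW'[OF i] PV[OF i],
        use Wnz[of i] Wnz[of "Suc i"] Wnz[of "prev n i"] prev_less[OF i] e i t in \<open>simp add: pdiv_def\<close>)
    show ?thesis unfolding X sG[OF i] dG[OF i]
      using Wnz[of i] Wnz[of "Suc i"] Wnz[of "prev n i"] prev_less[OF i] i t by (auto simp: field_simps)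
  qed
qed

subsection \<open>The action as multiplication by unipotent matrices\<close>

text \<open>For \<open>i = 0\<close> the matrix is multiplied by \<open>\<lambda>\<close>, to clear the denominator of the root vector
  \<open>\<lambda>\<^sup>-\<^sup>1 E\<close>.\<close>

definition root_scale :: "nat \<Rightarrow> complex poly" where
  "root_scale i = (if i = 0 then [:0, 1:] else 1)"

definition x_loop :: "nat \<Rightarrow> nat \<Rightarrow> complex \<Rightarrow> complex poly mat" where
  "x_loop n i a = mat n n (\<lambda>(r, s). (if r = s then root_scale i else 0) + (if r = prev n i \<and> s = i then [:a:] else 0))"

lemma x_loop_carrier [simp]: "x_loop n i a \<in> carrier_mat n n"
  by (simp add: x_loop_def)

lemma x_loop_left:
  assumes M: "M \<in> carrier_mat n m" and i: "i < n" and rs: "r < n" "s < m"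
  shows "(x_loop n i a * M) $$ (r, s) = root_scale i * M $$ (r, s) + (if r = prev n i then [:a:] * M $$ (i, s) else 0)"
proof -
  have "(x_loop n i a * M) $$ (r, s) = (\<Sum>l<n. x_loop n i a $$ (r, l) * M $$ (l, s))"
    using assms by (simp add: scalar_prod_def atLeast0LessThan x_loop_def)
  also have "\<dots> = (\<Sum>l<n. (if l = r then root_scale i * M $$ (r, s) else 0) + (if l = i then (if r = prev n i then [:a:] * M $$ (i, s) else 0) else 0))"
    using rs by (intro sum.cong refl) (auto simp: x_loop_def distrib_right simp del: mult_pCons_left)
  finally show ?thesis using rs i by (simp add: sum.distrib del: mult_pCons_left)
qed

lemma x_loop_right:
  assumes M: "M \<in> carrier_mat m n" and i: "i < n" and rs: "r < m" "s < n"
  shows "(M * x_loop n i a) $$ (r, s) = root_scale i * M $$ (r, s) + (if s = i then [:a:] * M $$ (r, prev n i) else 0)"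
proof -
  have "(M * x_loop n i a) $$ (r, s) = (\<Sum>l<n. M $$ (r, l) * x_loop n i a $$ (l, s))"
    using assms by (simp add: scalar_prod_def atLeast0LessThan x_loop_def)
  also have "\<dots> = (\<Sum>l<n. (if l = s then root_scale i * M $$ (r, s) else 0) + (if l = prev n i then (if s = i then [:a:] * M $$ (r, prev n i) else 0) else 0))"
    using rs by (intro sum.cong refl) (auto simp: x_loop_def distrib_left mult.commute simp del: mult_pCons_left mult_pCons_right)
  finally show ?thesis using rs prev_less[OF i] by (simp add: sum.distrib del: mult_pCons_left)
qed

lemma x_loop_inverse:
  assumes i: "i < n" and n: "n \<ge> 2"
  shows "x_loop n i a * x_loop n i (- a) = (root_scale i * root_scale i) \<cdot>\<^sub>m 1\<^sub>m n"
proof (rule eq_matI)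
  fix r s assume "r < dim_row ((root_scale i * root_scale i) \<cdot>\<^sub>m 1\<^sub>m n)" "s < dim_col ((root_scale i * root_scale i) \<cdot>\<^sub>m 1\<^sub>m n)"
  then have rs: "r < n" "s < n" by auto
  show "(x_loop n i a * x_loop n i (- a)) $$ (r, s) = ((root_scale i * root_scale i) \<cdot>\<^sub>m 1\<^sub>m n) $$ (r, s)"
    unfolding x_loop_left[OF x_loop_carrier i rs] using rs i prev_neq[OF n i]
    by (auto simp: x_loop_def root_scale_def)
qed (auto simp: x_loop_def)

text \<open>Multiplication by the unipotent matrices lowers grades by at most one. A coefficient of grade -1
  could only occur in the position of the root vector, where the hypothesis makes it vanish.\<close>

lemma x_loop_conj_banded:
  assumes G: "banded n d G" and i: "i < n" and n: "n \<ge> 2" and d: "0 < d"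
    and van: "a * dg G i + b * dg G (prev n i) + a * b * sub n G i = 0"
  obtains G' where "banded n d G'" "x_loop n i a * G * x_loop n i b = (root_scale i * root_scale i) \<cdot>\<^sub>m G'"
proof -
  define \<delta> where "\<delta> = (if i = 0 then 1 else 0 :: nat)"
  let ?p = "prev n i"
  have p: "?p < n" "?p \<noteq> i" using prev_less[OF i] prev_neq[OF n i] by auto
  have GC: "G \<in> carrier_mat n n" by (rule banded_carrier[OF G])
  define G' where "G' = mat n n (\<lambda>(r, s). G $$ (r, s)
      + (if r = ?p then Polynomial.smult a (poly_shift \<delta> (G $$ (i, s))) else 0)
      + (if s = i then Polynomial.smult b (poly_shift \<delta> (G $$ (r, ?p))) else 0)
      + (if r = ?p \<and> s = i then Polynomial.smult (a * b) (poly_shift (2 * \<delta>) (G $$ (i, ?p))) else 0))"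
  have G'C: "G' \<in> carrier_mat n n" by (simp add: G'_def)
  have co: "coeff (G' $$ (r, s)) m = coeff (G $$ (r, s)) m
      + (if r = ?p then a * coeff (G $$ (i, s)) (m + \<delta>) else 0)
      + (if s = i then b * coeff (G $$ (r, ?p)) (m + \<delta>) else 0)
      + (if r = ?p \<and> s = i then a * b * coeff (G $$ (i, ?p)) (m + 2 * \<delta>) else 0)"
    if "r < n" "s < n" for r s m
    using that by (simp add: G'_def coeff_poly_shift)
  \<comment> \<open>Moving from row \<open>i\<close> to row \<open>prev n i\<close> lowers the grade by one.\<close>
  have pi: "?p + 1 = i + n * \<delta>" using i by (auto simp: prev_def \<delta>_def)
  have lowered: "i + n * (m + \<delta>) = ?p + n * m + 1" "i + n * (m + 2 * \<delta>) = ?p + n * m + n * \<delta> + 1" for m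
    using pi by (auto simp: algebra_simps)
  have G'b: "banded n d G'"
  proof (rule bandedI[OF G'C])
    fix r s m assume rs: "r < n" "s < n"
    have c1: "coeff (G $$ (i, s)) (m + \<delta>) = 0" if "r = ?p" "r + n * m + 1 < s \<or> s + d < r + n * m + 1"
      by (rule banded_zero[OF G i rs(2)]) (use that lowered[of m] in arith)
    have c2: "coeff (G $$ (r, ?p)) (m + \<delta>) = 0" if "s = i" "r + n * m + 1 < s \<or> s + d < r + n * m + 1"
      by (rule banded_zero[OF G rs(1) p(1)]) (use that pi distrib_left[of n m \<delta>] in arith)
    have c3: "coeff (G $$ (i, ?p)) (m + 2 * \<delta>) = 0" if "r = ?p" "s = i" "r + n * m + 2 \<le> s \<or> s + d < r + n * m + 1"
      by (rule banded_zero[OF G i p(1)]) (use that lowered[of m] pi in arith)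
    show "coeff (G' $$ (r, s)) m = 0" if out: "r + n * m < s \<or> s + d < r + n * m"
    proof (cases "r + n * m + 1 = s")
      case True
      have G0: "coeff (G $$ (r, s)) m = 0" by (rule banded_zero[OF G rs]) (use True in simp)
      show ?thesis
      proof (cases "r = ?p \<or> s = i")
        case False
        then show ?thesis unfolding co[OF rs] using G0 by simp
      next
        case True2: True
        have "n * m = 0 \<and> n * \<delta> = 0 \<and> r = ?p \<and> s = i"
        proof -
          have "n * m < n" using True rs by linarith
          then have m: "m = 0" by (cases m) auto
          show ?thesis
          proof (cases "\<delta> = 0")
            case True
            then show ?thesis using m \<open>r + n * m + 1 = s\<close> True2 pi by auto
          next
            case False
            then have "i = 0" "?p = n - 1" by (auto simp: \<delta>_def prev_def split: if_splits)
            then show ?thesis using m \<open>r + n * m + 1 = s\<close> True2 rs by auto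
          qed
        qed
        then have m: "m = 0" "\<delta> = 0" "r = ?p" "s = i" using n by auto
        then have "sub n G i = coeff (G $$ (i, ?p)) 0" by (auto simp: sub_def \<delta>_def split: if_splits)
        then show ?thesis unfolding co[OF rs] G0 using van m by (simp add: dg_def)
      qed
    next
      case False
      then have o: "r + n * m + 1 < s \<or> s + d < r + n * m + 1" "r + n * m + 2 \<le> s \<or> s + d < r + n * m + 1" using out by auto
      have "coeff (G $$ (r, s)) m = 0" by (rule banded_zero[OF G rs out])
      then show ?thesis unfolding co[OF rs] using c1[OF _ o(1)] c2[OF _ o(1)] c3[OF _ _ o(2)] by auto
    qed
    show "coeff (G' $$ (r, s)) m = 1" if top: "r + n * m = s + d"
    proof -
      have o: "r + n * m + 1 < s \<or> s + d < r + n * m + 1" "r + n * m + 2 \<le> s \<or> s + d < r + n * m + 1" using top by auto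
      have "coeff (G $$ (r, s)) m = 1" by (rule banded_top[OF G rs top])
      then show ?thesis unfolding co[OF rs] using c1[OF _ o(1)] c2[OF _ o(1)] c3[OF _ _ o(2)] by auto
    qed
  qed
  have "x_loop n i a * G * x_loop n i b = (root_scale i * root_scale i) \<cdot>\<^sub>m G'"
  proof (rule eq_matI)
    fix r s assume "r < dim_row ((root_scale i * root_scale i) \<cdot>\<^sub>m G')" "s < dim_col ((root_scale i * root_scale i) \<cdot>\<^sub>m G')"
    then have rs: "r < n" "s < n" using G'C by auto
    have xG: "x_loop n i a * G \<in> carrier_mat n n" using mult_carrier_mat[OF x_loop_carrier GC] .
    let ?q = "root_scale i"
    let ?L = "(x_loop n i a * G * x_loop n i b) $$ (r, s)"
    have L: "?L = ?q * ?q * G $$ (r, s) + ?q * (if r = ?p then Polynomial.smult a (G $$ (i, s)) else 0)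
        + ?q * (if s = i then Polynomial.smult b (G $$ (r, ?p)) else 0)
        + (if r = ?p \<and> s = i then Polynomial.smult (a * b) (G $$ (i, ?p)) else 0)"
      unfolding x_loop_right[OF xG i rs] x_loop_left[OF GC i rs] x_loop_left[OF GC i rs(1) p(1)]
      by (simp add: algebra_simps smult_add_right)
    show "?L = ((?q * ?q) \<cdot>\<^sub>m G') $$ (r, s)"
    proof (cases "i = 0")
      case False
      then have "?q = 1" "\<delta> = 0" by (auto simp: root_scale_def \<delta>_def)
      then show ?thesis unfolding L using rs
        by (simp add: G'_def poly_shift_id)
    next
      case True
      then have q: "?q = [:0, 1:]" and \<delta>: "\<delta> = 1" by (auto simp: root_scale_def \<delta>_def)
      have pn: "?p = n - 1" using True by (simp add: prev_def)
      have z1: "coeff (G $$ (i, s)) 0 = 0" if "s \<noteq> i"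
        by (rule banded_zero[OF G i rs(2)]) (use that True in auto)
      have z2: "coeff (G $$ (r, ?p)) 0 = 0" if "r \<noteq> ?p"
        by (rule banded_zero[OF G rs(1) p(1)]) (use that pn rs in auto)
      have z3: "coeff (G $$ (i, ?p)) 0 = 0"
        by (rule banded_zero[OF G i p(1)]) (use True p in auto)
      have su: "sub n G i = coeff (G $$ (i, ?p)) 1" using True by (simp add: sub_def)
      show ?thesis
      proof (rule poly_eqI)
        fix m
        have R: "((?q * ?q) \<cdot>\<^sub>m G') $$ (r, s) = [:0, 1:] * ([:0, 1:] * G' $$ (r, s))"
          using rs G'C q by (simp del: mult_pCons_left add: mult.assoc)
        show "coeff ?L m = coeff (((?q * ?q) \<cdot>\<^sub>m G') $$ (r, s)) m"
        proof (cases m)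
          case 0
          then show ?thesis unfolding R unfolding L q using z3 by (simp add: mult.assoc)
        next
          case (Suc m')
          note S1 = Suc
          show ?thesis
          proof (cases m')
            case 0
            have "coeff ?L (Suc 0) = (if r = ?p then a * coeff (G $$ (i, s)) 0 else 0)
               + (if s = i then b * coeff (G $$ (r, ?p)) 0 else 0)
               + (if r = ?p \<and> s = i then a * b * coeff (G $$ (i, ?p)) 1 else 0)"
              unfolding L q by (simp add: mult.assoc)
            also have "\<dots> = 0"
              using z1 z2 van su by (cases "r = ?p"; cases "s = i") (auto simp: dg_def)
            finally show ?thesis unfolding R S1 0 by simp
          next
            case (Suc m'')
            show ?thesis unfolding R unfolding S1 Suc L q
              using co[OF rs, of m''] by (simp add: \<delta> mult.assoc numeral_2_eq_2)
          qed
        qed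
      qed
    qed
  qed (use G'C in \<open>auto simp: x_loop_def\<close>)
  then show ?thesis using that G'b by blast
qed

lemma root_scale_nonzero [simp]: "root_scale i \<noteq> 0"
  by (simp add: root_scale_def)

lemma X_act_g_of:
  assumes x: "g_of n k x G" and k: "0 < k" "k < n" and n: "n \<ge> 2" and i: "i < n"
    and c: "c \<noteq> 0" and s: "sub n G i \<noteq> 0"
  obtains x' G' where "X_act n k i c x = Some x'" "g_of n k x' G'" "snd x' = snd x"
    "x_loop n i ((c - 1) * dg G (prev n i) / sub n G i) * G * x_loop n i ((1 / c - 1) * dg G i / sub n G i)
      = (root_scale i * root_scale i) \<cdot>\<^sub>m G'"
proof -
  obtain F X where F: "F \<in> carrier_mat n k" and X: "X \<in> carrier_mat k n"
    and xe: "x = (colspan n F, snd x)" and eq: "ev (lam k (snd x)) G = F * X"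
    and t: "snd x \<noteq> 0" and G: "banded n (n - k) G"
    by (rule g_of_frame[OF x k])
  let ?z = "lam k (snd x)" and ?p = "prev n i"
  note cr = crystal_g_of[OF x k n]
  have p: "?p < n" "?p \<noteq> i" using prev_less[OF i] prev_neq[OF n i] by auto
  have d: "dg G ?p \<noteq> 0" "dg G i \<noteq> 0" using cr(1) i p by auto
  define a where "a = (c - 1) * dg G ?p / sub n G i"
  define b where "b = (1 / c - 1) * dg G i / sub n G i"
  have "a * dg G i + b * dg G ?p + a * b * sub n G i
      = ((c - 1) + (1 / c - 1) + (c - 1) * (1 / c - 1)) * (dg G i * dg G ?p / sub n G i)"
    unfolding a_def b_def using s by (simp add: field_simps)
  also have "(c - 1) + (1 / c - 1) + (c - 1) * (1 / c - 1) = 0" using c by (simp add: field_simps)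
  finally have van: "a * dg G i + b * dg G ?p + a * b * sub n G i = 0" by simp
  obtain G' where G': "banded n (n - k) G'" and conj: "x_loop n i a * G * x_loop n i b = (root_scale i * root_scale i) \<cdot>\<^sub>m G'"
    using x_loop_conj_banded[OF G i n _ van] k by auto
  have GC: "G \<in> carrier_mat n n" and G'C: "G' \<in> carrier_mat n n" by (auto intro: banded_carrier G G')
  define \<zeta> where "\<zeta> = (if i = 0 then ?z else 1)"
  have z: "\<zeta> \<noteq> 0" using t by (simp add: \<zeta>_def)
  have qz: "poly (root_scale i) ?z = \<zeta>" by (simp add: root_scale_def \<zeta>_def)
  let ?x = "x_mat n i (a / \<zeta>)" and ?b = "ev ?z (x_loop n i b)"
  have xC: "?x \<in> carrier_mat n n" by (simp add: x_mat_def)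
  have pos: "(if i = 0 then (n - 1, 0) else (i - 1, i)) = (?p, i)" by (auto simp: prev_def)
  have eva: "ev ?z (x_loop n i a) = \<zeta> \<cdot>\<^sub>m ?x"
  proof (rule eq_matI)
    fix r s assume "r < dim_row (\<zeta> \<cdot>\<^sub>m ?x)" "s < dim_col (\<zeta> \<cdot>\<^sub>m ?x)"
    then have rs: "r < n" "s < n" by (auto simp: x_mat_def)
    have "ev ?z (x_loop n i a) $$ (r, s) = (if r = s then \<zeta> else 0) + (if r = ?p \<and> s = i then a else 0)"
      using rs by (auto simp: x_loop_def qz)
    also have "\<dots> = (\<zeta> \<cdot>\<^sub>m ?x) $$ (r, s)"
      using rs z unfolding x_mat_def pos by (auto simp: distrib_left)
    finally show "ev ?z (x_loop n i a) $$ (r, s) = (\<zeta> \<cdot>\<^sub>m ?x) $$ (r, s)" .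
  qed (auto simp: x_loop_def x_mat_def)
  have bC: "?b \<in> carrier_mat n n" by simp
  have xG: "x_loop n i a * G \<in> carrier_mat n n" using mult_carrier_mat[OF x_loop_carrier GC] .
  have xF: "?x * F \<in> carrier_mat n k" by (rule mult_carrier_mat[OF xC F])
  have Xb: "X * ?b \<in> carrier_mat k n" by (rule mult_carrier_mat[OF X bC])
  have FXc: "F * X \<in> carrier_mat n n" by (rule mult_carrier_mat[OF F X])
  have "(\<zeta> * \<zeta>) \<cdot>\<^sub>m ev ?z G' = ev ?z ((root_scale i * root_scale i) \<cdot>\<^sub>m G')"
    unfolding ev_smult by (simp add: qz)
  also have "\<dots> = (\<zeta> \<cdot>\<^sub>m ?x) * (F * X) * ?b"
    unfolding conj[symmetric] ev_mult[OF xG x_loop_carrier] ev_mult[OF x_loop_carrier GC] eva eq ..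
  also have "\<dots> = \<zeta> \<cdot>\<^sub>m ((?x * F) * (X * ?b))"
    unfolding mult_smult_assoc_mat[OF xC FXc] assoc_mult_mat[OF xC F X, symmetric]
      mult_smult_assoc_mat[OF mult_carrier_mat[OF xF X] bC] assoc_mult_mat[OF xF X bC] ..
  finally have e0: "(\<zeta> * \<zeta>) \<cdot>\<^sub>m ev ?z G' = \<zeta> \<cdot>\<^sub>m ((?x * F) * (X * ?b))" .
  have "ev ?z G' = (1 / (\<zeta> * \<zeta>)) \<cdot>\<^sub>m ((\<zeta> * \<zeta>) \<cdot>\<^sub>m ev ?z G')" using z by (intro eq_matI) auto
  also have "\<dots> = (1 / \<zeta>) \<cdot>\<^sub>m ((?x * F) * (X * ?b))" unfolding e0 using z by (intro eq_matI) auto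
  also have "\<dots> = (?x * F) * ((1 / \<zeta>) \<cdot>\<^sub>m (X * ?b))" by (rule mult_smult_distrib[symmetric, OF xF Xb])
  finally have e: "ev ?z G' = (?x * F) * ((1 / \<zeta>) \<cdot>\<^sub>m (X * ?b))" .
  have g': "g_of n k (colspan n (?x * F), snd x) G'"
    by (rule g_ofI[OF G' t xF _ e]) (use Xb in auto)
  have az: "(if i = 0 then (- 1) ^ (k - 1) / snd x * a else a) = a / \<zeta>"
  proof -
    have "(- 1) ^ (k - 1) / snd x = 1 / ?z" by (auto simp: lam_def uminus_power_if)
    then show ?thesis by (simp add: \<zeta>_def)
  qed
  have ph: "X_phi n k i x = Some (sub n G i / dg G ?p)" using cr(3)[OF i] .
  have pd: "pdiv (c - 1) (sub n G i / dg G ?p) = Some a" using s d by (simp add: pdiv_def a_def)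
  have act: "X_act n k i c x = Some (colspan n (?x * F), snd x)"
  proof -
    have "X_phi n k i (colspan n F, snd x) = Some (sub n G i / dg G ?p)" using ph by (subst (asm) xe)
    then have "X_act n k i c (colspan n F, snd x) =
        Some ((*\<^sub>v) (x_mat n i (if i = 0 then (- 1) ^ (k - 1) / snd x * a else a)) ` colspan n F, snd x)"
      using pd c by (simp add: X_act_def)
    then show ?thesis unfolding az colspan_left_mult[OF xC F] by (subst xe)
  qed
  show ?thesis by (rule that[OF act g' _ conj[unfolded a_def b_def]]) simp
qed

subsection \<open>Products\<close>

lemma prod_crystal_g_of:
  assumes x: "g_of n l x A" and y: "g_of n k y B" and l: "0 < l" "l < n" and k: "0 < k" "k < n" and n: "n \<ge> 2"
  shows "\<And>r. r < n \<Longrightarrow> gam (X_crystal n l \<times>\<^sub>C X_crystal n k) (Suc r) (x, y) = Some (dg (A * B) r)"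
    and "\<And>i. i < n \<Longrightarrow> sub n A i \<noteq> 0 \<Longrightarrow>
      phi (X_crystal n l \<times>\<^sub>C X_crystal n k) i (x, y) = Some (sub n (A * B) i / dg (A * B) (prev n i))"
    and "\<And>i. i < n \<Longrightarrow> sub n B i \<noteq> 0 \<Longrightarrow>
      eps (X_crystal n l \<times>\<^sub>C X_crystal n k) i (x, y) = Some (sub n (A * B) i / dg (A * B) i)"
proof -
  note cx = crystal_g_of[OF x l n] and cy = crystal_g_of[OF y k n]
  have Ab: "banded n (n - l) A" and Bb: "banded n (n - k) B" using x y by (auto simp: g_of_def)
  note dm = dg_mult[OF Ab Bb] and sm = sub_mult[OF Ab Bb _ n]
  show "gam (X_crystal n l \<times>\<^sub>C X_crystal n k) (Suc r) (x, y) = Some (dg (A * B) r)" if r: "r < n" for r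
    using cx(2)[OF r] cy(2)[OF r] dm[OF r] by (simp add: prod_crystal_def X_crystal_def)
  fix i assume i: "i < n"
  have p: "prev n i < n" by (rule prev_less[OF i])
  note nz = cx(1)[OF i] cx(1)[OF p] cy(1)[OF i] cy(1)[OF p]
  show "phi (X_crystal n l \<times>\<^sub>C X_crystal n k) i (x, y) = Some (sub n (A * B) i / dg (A * B) (prev n i))" if s: "sub n A i \<noteq> 0"
    using cx(3)[OF i] cx(4)[OF i] cy(3)[OF i] nz s unfolding dm[OF p] sm[OF i]
    by (simp add: prod_crystal_def X_crystal_def pdiv_def field_simps)
  show "eps (X_crystal n l \<times>\<^sub>C X_crystal n k) i (x, y) = Some (sub n (A * B) i / dg (A * B) i)" if s: "sub n B i \<noteq> 0"
    using cx(4)[OF i] cy(3)[OF i] cy(4)[OF i] nz s unfolding dm[OF i] sm[OF i]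
    by (simp add: prod_crystal_def X_crystal_def pdiv_def field_simps)
qed

text \<open>The last two expressions are \<open>\<epsilon>\<^sub>i(x) + \<phi>\<^sub>i(y)\<close> and \<open>c \<epsilon>\<^sub>i(x) + \<phi>\<^sub>i(y)\<close> up to nonzero factors.\<close>

definition act_ok :: "nat \<Rightarrow> nat \<Rightarrow> complex \<Rightarrow> complex poly mat \<Rightarrow> complex poly mat \<Rightarrow> bool" where
  "act_ok n i c A B \<longleftrightarrow> sub n A i \<noteq> 0 \<and> sub n B i \<noteq> 0 \<and>
    sub n A i * dg B (prev n i) + dg A i * sub n B i \<noteq> 0 \<and>
    c * (sub n A i * dg B (prev n i)) + dg A i * sub n B i \<noteq> 0"

text \<open>The parameters \<open>c\<^sub>1\<close> and \<open>c\<^sub>2\<close> of the product action are such that the inner unipotent factors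
  cancel, so the action on a product is determined by the product of the two matrices.\<close>

lemma prod_act_g_of:
  assumes x: "g_of n l x A" and y: "g_of n k y B" and l: "0 < l" "l < n" and k: "0 < k" "k < n" and n: "n \<ge> 2"
    and i: "i < n" and c: "c \<noteq> 0" and ok: "act_ok n i c A B"
  obtains x2 y2 A2 B2 where "act (X_crystal n l \<times>\<^sub>C X_crystal n k) i c (x, y) = Some (x2, y2)"
    "g_of n l x2 A2" "g_of n k y2 B2" "snd x2 = snd x" "snd y2 = snd y"
    "x_loop n i ((c - 1) * dg (A * B) (prev n i) / sub n (A * B) i) * (A * B) *
     x_loop n i ((1 / c - 1) * dg (A * B) i / sub n (A * B) i) = (root_scale i * root_scale i) \<cdot>\<^sub>m (A2 * B2)"
proof -
  note cx = crystal_g_of[OF x l n] and cy = crystal_g_of[OF y k n]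
  have Ab: "banded n (n - l) A" and Bb: "banded n (n - k) B" using x y by (auto simp: g_of_def)
  have AC: "A \<in> carrier_mat n n" and BC: "B \<in> carrier_mat n n" by (auto intro: banded_carrier Ab Bb)
  let ?p = "prev n i"
  have p: "?p < n" by (rule prev_less[OF i])
  note nz = cx(1)[OF i] cx(1)[OF p] cy(1)[OF i] cy(1)[OF p]
  define sA where "sA = sub n A i"
  define sB where "sB = sub n B i"
  define ai where "ai = dg A i"
  define ap where "ap = dg A ?p"
  define bi where "bi = dg B i"
  define bp where "bp = dg B ?p"
  have nz': "ai \<noteq> 0" "ap \<noteq> 0" "bi \<noteq> 0" "bp \<noteq> 0" using nz by (auto simp: ai_def ap_def bi_def bp_def)
  have ok': "sA \<noteq> 0" "sB \<noteq> 0" "sA * bp + ai * sB \<noteq> 0" "c * (sA * bp) + ai * sB \<noteq> 0"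
    using ok by (auto simp: act_ok_def sA_def sB_def ai_def bp_def)
  define S where "S = sA * bp + ai * sB"
  define T where "T = c * (sA * bp) + ai * sB"
  have ST: "S \<noteq> 0" "T \<noteq> 0" using ok' by (auto simp: S_def T_def)
  have dP: "dg (A * B) i = ai * bi" "dg (A * B) ?p = ap * bp" "sub n (A * B) i = S"
    using dg_mult[OF Ab Bb i] dg_mult[OF Ab Bb p] sub_mult[OF Ab Bb i n]
    by (auto simp: S_def sA_def sB_def ai_def ap_def bi_def bp_def)
  define c1 where "c1 = T / S"
  define c2 where "c2 = c * S / T"
  have c12: "c1 \<noteq> 0" "c2 \<noteq> 0" using ST c by (auto simp: c1_def c2_def)
  have ep: "sA / ai + sB / bp = S / (ai * bp)" "c * (sA / ai) + sB / bp = T / (ai * bp)"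
    "sA / ai + inverse c * (sB / bp) = T / (c * ai * bp)"
    using nz' c by (auto simp: S_def T_def field_simps)
  have p1: "pdiv (c * (sA / ai) + sB / bp) (sA / ai + sB / bp) = Some c1"
    unfolding ep using nz' ST by (simp add: pdiv_def c1_def)
  have p2: "pdiv (sA / ai + sB / bp) (sA / ai + inverse c * (sB / bp)) = Some c2"
    unfolding ep using nz' ST c by (simp add: pdiv_def c2_def)
  obtain x2 A2 where x2: "X_act n l i c1 x = Some x2" "g_of n l x2 A2" "snd x2 = snd x"
    and conjA: "x_loop n i ((c1 - 1) * ap / sA) * A * x_loop n i ((1 / c1 - 1) * ai / sA) = (root_scale i * root_scale i) \<cdot>\<^sub>m A2"
    using X_act_g_of[OF x l n i c12(1)] ok'(1) unfolding sA_def ap_def ai_def by blast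
  obtain y2 B2 where y2: "X_act n k i c2 y = Some y2" "g_of n k y2 B2" "snd y2 = snd y"
    and conjB: "x_loop n i ((c2 - 1) * bp / sB) * B * x_loop n i ((1 / c2 - 1) * bi / sB) = (root_scale i * root_scale i) \<cdot>\<^sub>m B2"
    using X_act_g_of[OF y k n i c12(2)] ok'(2) unfolding sB_def bp_def bi_def by blast
  have act: "act (X_crystal n l \<times>\<^sub>C X_crystal n k) i c (x, y) = Some (x2, y2)"
    using cx(4)[OF i] cy(3)[OF i] p1 p2 x2(1) y2(1) c
    by (simp add: prod_crystal_def X_crystal_def sA_def sB_def ai_def bp_def)
  have left: "(c1 - 1) * ap / sA = (c - 1) * (ap * bp) / S"
  proof -
    have "c1 - 1 = (T - S) / S" using ST by (simp add: c1_def field_simps)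
    also have "T - S = (c - 1) * (sA * bp)" by (simp add: T_def S_def algebra_simps)
    finally show ?thesis using ok' by simp
  qed
  have right: "(1 / c2 - 1) * bi / sB = (1 / c - 1) * (ai * bi) / S"
  proof -
    have "1 / c2 - 1 = (T - c * S) / (c * S)" using ST c by (simp add: c2_def field_simps)
    also have "T - c * S = (1 - c) * (ai * sB)" by (simp add: T_def S_def algebra_simps)
    finally have 1: "1 / c2 - 1 = (1 - c) * (ai * sB) / (c * S)" .
    show ?thesis unfolding 1 using ok'(2) c ST(1) by (simp add: field_simps)
  qed
  have inner: "(1 / c1 - 1) * ai / sA = - ((c2 - 1) * bp / sB)"
  proof -
    have "1 / c1 - 1 = (S - T) / T" using ST by (simp add: c1_def field_simps)
    also have "S - T = (1 - c) * (sA * bp)" by (simp add: T_def S_def algebra_simps)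
    finally have 1: "(1 / c1 - 1) * ai / sA = (1 - c) * (ai * bp) / T" using ok' by simp
    have "c2 - 1 = (c * S - T) / T" using ST by (simp add: c2_def field_simps)
    also have "c * S - T = (c - 1) * (ai * sB)" by (simp add: T_def S_def algebra_simps)
    finally have 2: "(c2 - 1) * bp / sB = (c - 1) * (ai * bp) / T" using ok' by simp
    have "(1 - c) * (ai * bp) = - ((c - 1) * (ai * bp))" by (simp add: algebra_simps)
    then show ?thesis unfolding 1 2 by simp
  qed
  define q where "q = root_scale i * root_scale i"
  have q: "q \<noteq> 0" by (simp add: q_def)
  define u where "u = (c - 1) * (ap * bp) / S"
  define v where "v = (1 / c - 1) * (ai * bi) / S"
  define w where "w = (c2 - 1) * bp / sB"
  let ?x = "x_loop n i"
  have A2C: "A2 \<in> carrier_mat n n" and B2C: "B2 \<in> carrier_mat n n" using x2 y2 g_of_carrier by auto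
  have eA: "?x u * A * ?x (- w) = q \<cdot>\<^sub>m A2" and eB: "?x w * B * ?x v = q \<cdot>\<^sub>m B2"
    using conjA conjB left right inner by (auto simp: q_def u_def v_def w_def)
  have mc: "M * N \<in> carrier_mat n n" if "M \<in> carrier_mat n n" "N \<in> carrier_mat n n" for M N :: "complex poly mat"
    using that by (rule mult_carrier_mat)
  note as = assoc_mult_mat[of _ n n _ n _ n]
  have winv: "?x (- w) * ?x w = q \<cdot>\<^sub>m 1\<^sub>m n" using x_loop_inverse[OF i n, of "- w"] by (simp add: q_def)
  have "q \<cdot>\<^sub>m (q \<cdot>\<^sub>m (A2 * B2)) = (q \<cdot>\<^sub>m A2) * (q \<cdot>\<^sub>m B2)"
    using mult_smult_assoc_mat[OF A2C smult_carrier_mat[OF B2C], of q q] mult_smult_distrib[OF A2C B2C, of q] by simp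
  also have "\<dots> = (?x u * A * ?x (- w)) * (?x w * B * ?x v)" unfolding eA eB ..
  also have "\<dots> = ?x u * (A * ((?x (- w) * ?x w) * (B * ?x v)))"
    using AC BC by (simp add: as mc)
  also have "\<dots> = q \<cdot>\<^sub>m (?x u * (A * (B * ?x v)))"
    unfolding winv using AC BC by (simp add: scalar_mat_mult mc mult_smult_distrib[of _ n n _ n])
  also have "?x u * (A * (B * ?x v)) = ?x u * (A * B) * ?x v" using AC BC by (simp add: as mc)
  finally have "q \<cdot>\<^sub>m (q \<cdot>\<^sub>m (A2 * B2)) = q \<cdot>\<^sub>m (?x u * (A * B) * ?x v)" .
  then have "q \<cdot>\<^sub>m (A2 * B2) = ?x u * (A * B) * ?x v"
    by (rule smult_mat_cancel[OF q smult_carrier_mat[OF mc[OF A2C B2C]] mc[OF mc[OF x_loop_carrier mc[OF AC BC]] x_loop_carrier]])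
  then show ?thesis
    using that[OF act x2(2) y2(2) x2(3) y2(3)] unfolding dP u_def v_def q_def by simp
qed

text \<open>The action on either side multiplies the common product by the same two unipotent matrices.\<close>

lemma R_rel_act:
  assumes x: "g_of n l x A" and y: "g_of n k y B" and x': "g_of n k x' A'" and y': "g_of n l y' B'"
    and eq: "A * B = A' * B'" and s: "snd x' = snd y" "snd y' = snd x" and ne: "lam l (snd x) \<noteq> lam k (snd y)"
    and l: "0 < l" "l < n" and k: "0 < k" "k < n" and n: "n \<ge> 2" and i: "i < n" and c: "c \<noteq> 0"
    and ok: "act_ok n i c A B" "act_ok n i c A' B'"
  obtains p' q' where "act (X_crystal n l \<times>\<^sub>C X_crystal n k) i c (x, y) = Some p'"
    "act (X_crystal n k \<times>\<^sub>C X_crystal n l) i c (x', y') = Some q'" "R_rel n l k p' q'"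
proof -
  obtain x2 y2 A2 B2 where a: "act (X_crystal n l \<times>\<^sub>C X_crystal n k) i c (x, y) = Some (x2, y2)"
    "g_of n l x2 A2" "g_of n k y2 B2" "snd x2 = snd x" "snd y2 = snd y"
    "x_loop n i ((c - 1) * dg (A * B) (prev n i) / sub n (A * B) i) * (A * B) *
     x_loop n i ((1 / c - 1) * dg (A * B) i / sub n (A * B) i) = (root_scale i * root_scale i) \<cdot>\<^sub>m (A2 * B2)"
    by (rule prod_act_g_of[OF x y l k n i c ok(1)])
  obtain x3 y3 A3 B3 where b: "act (X_crystal n k \<times>\<^sub>C X_crystal n l) i c (x', y') = Some (x3, y3)"
    "g_of n k x3 A3" "g_of n l y3 B3" "snd x3 = snd x'" "snd y3 = snd y'"
    "x_loop n i ((c - 1) * dg (A' * B') (prev n i) / sub n (A' * B') i) * (A' * B') *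
     x_loop n i ((1 / c - 1) * dg (A' * B') i / sub n (A' * B') i) = (root_scale i * root_scale i) \<cdot>\<^sub>m (A3 * B3)"
    by (rule prod_act_g_of[OF x' y' k l n i c ok(2)])
  have "(root_scale i * root_scale i) \<cdot>\<^sub>m (A2 * B2) = (root_scale i * root_scale i) \<cdot>\<^sub>m (A3 * B3)"
    using a(6) b(6) eq by simp
  then have e: "A2 * B2 = A3 * B3"
    by (rule smult_mat_cancel[OF _ mult_carrier_mat[OF a(2,3)[THEN g_of_carrier]]
        mult_carrier_mat[OF b(2,3)[THEN g_of_carrier]], rotated]) simp
  have "R_rel n l k (x2, y2) (x3, y3)"
    using a b s ne by (intro R_relI[OF a(2,3) b(2,3) e]) auto
  then show ?thesis using that a(1) b(1) by blast
qed

section \<open>Points fixed by the cyclic shift\<close>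

lemma root_of_unity_powers:
  assumes n: "n > 0"
  defines "\<omega> \<equiv> cis (2 * pi / real n)"
  shows "\<omega> ^ n = 1" and "inj_on (\<lambda>m. \<omega> ^ m) {..<n}"
proof -
  have p: "\<omega> ^ m = cis (2 * pi * real m / real n)" for m
    unfolding \<omega>_def DeMoivre by (simp add: mult.commute)
  show "\<omega> ^ n = 1" unfolding p using n by simp
  show "inj_on (\<lambda>m. \<omega> ^ m) {..<n}"
    using bij_betw_roots_unity[OF n] unfolding p bij_betw_def by simp
qed

lemma inverse_fourier:
  fixes P :: "complex poly"
  assumes n: "n > 0" and \<omega>: "\<omega> ^ n = 1" "inj_on (\<lambda>m. \<omega> ^ m) {..<n}" and deg: "degree P < n" and d: "d < n"
  shows "of_nat n * coeff P d = (\<Sum>m<n. poly P (\<omega> ^ m) * inverse (\<omega> ^ m) ^ d)"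
proof -
  have w0: "\<omega> \<noteq> 0" using \<omega>(1) n by (auto simp: power_0_left split: if_splits)
  have orth: "(\<Sum>m<n. (\<omega> ^ m) ^ e * inverse (\<omega> ^ m) ^ d) = (if e = d then of_nat n else 0)" if e: "e < n" for e
  proof -
    define \<rho> where "\<rho> = \<omega> ^ e * inverse (\<omega> ^ d)"
    have r: "(\<omega> ^ m) ^ e * inverse (\<omega> ^ m) ^ d = \<rho> ^ m" for m
      by (simp add: \<rho>_def power_mult_distrib power_inverse mult.commute flip: power_mult)
    show ?thesis
    proof (cases "e = d")
      case True
      then have "\<rho> = 1" using w0 by (simp add: \<rho>_def)
      then show ?thesis unfolding r using True by simp
    next
      case False
      have "\<omega> ^ e \<noteq> \<omega> ^ d" using inj_onD[OF \<omega>(2), of e d] e d False by auto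
      then have "\<rho> \<noteq> 1" using w0 by (simp add: \<rho>_def field_simps)
      moreover have "\<rho> ^ n = 1"
        using \<omega>(1) by (simp add: \<rho>_def power_mult_distrib power_inverse mult.commute flip: power_mult) (simp add: mult.commute[of _ n] power_mult)
      ultimately show ?thesis unfolding r using False geometric_sum[of \<rho> n] by simp
    qed
  qed
  have "poly P x = (\<Sum>e<n. coeff P e * x ^ e)" for x
    unfolding poly_altdef using deg
    by (intro sum.mono_neutral_left) (auto simp: coeff_eq_0)
  then have "(\<Sum>m<n. poly P (\<omega> ^ m) * inverse (\<omega> ^ m) ^ d) =
      (\<Sum>m<n. \<Sum>e<n. coeff P e * ((\<omega> ^ m) ^ e * inverse (\<omega> ^ m) ^ d))"
    by (simp add: sum_distrib_right mult.assoc)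
  also have "\<dots> = (\<Sum>e<n. coeff P e * (\<Sum>m<n. (\<omega> ^ m) ^ e * inverse (\<omega> ^ m) ^ d))"
    by (subst sum.swap) (simp add: sum_distrib_left)
  also have "\<dots> = (\<Sum>e<n. if e = d then coeff P d * of_nat n else 0)"
    using orth by (intro sum.cong refl) auto
  finally show ?thesis using d by (simp add: mult.commute)
qed

lemma coeff_prod_linear:
  fixes r :: "nat \<Rightarrow> complex"
  assumes "finite S" "\<And>m. m \<in> S \<Longrightarrow> r m \<noteq> 0"
  shows "coeff (\<Prod>m\<in>S. [:- r m, 1:]) 0 \<noteq> 0"
    and "coeff (\<Prod>m\<in>S. [:- r m, 1:]) 1 = - coeff (\<Prod>m\<in>S. [:- r m, 1:]) 0 * (\<Sum>m\<in>S. 1 / r m)"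
    and "degree (\<Prod>m\<in>S. [:- r m, 1:]) = card S"
    and "coeff (\<Prod>m\<in>S. [:- r m, 1:]) (card S) = 1"
proof -
  have "coeff (\<Prod>m\<in>S. [:- r m, 1:]) 0 \<noteq> 0 \<and>
    coeff (\<Prod>m\<in>S. [:- r m, 1:]) 1 = - coeff (\<Prod>m\<in>S. [:- r m, 1:]) 0 * (\<Sum>m\<in>S. 1 / r m)"
    using assms
  proof (induction S rule: finite_induct)
    case (insert x S)
    then have rx: "r x \<noteq> 0" and IH: "coeff (\<Prod>m\<in>S. [:- r m, 1:]) 0 \<noteq> 0"
      "coeff (\<Prod>m\<in>S. [:- r m, 1:]) 1 = - coeff (\<Prod>m\<in>S. [:- r m, 1:]) 0 * (\<Sum>m\<in>S. 1 / r m)" by auto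
    let ?P = "\<Prod>m\<in>S. [:- r m, 1:]"
    have "coeff ([:- r x, 1:] * ?P) 0 = - r x * coeff ?P 0" by simp
    moreover have "coeff ([:- r x, 1:] * ?P) 1 = - r x * coeff ?P 1 + coeff ?P 0" by simp
    ultimately show ?case
      using insert.hyps rx IH by (simp add: field_simps del: mult_pCons_left)
  qed simp
  then show "coeff (\<Prod>m\<in>S. [:- r m, 1:]) 0 \<noteq> 0"
    "coeff (\<Prod>m\<in>S. [:- r m, 1:]) 1 = - coeff (\<Prod>m\<in>S. [:- r m, 1:]) 0 * (\<Sum>m\<in>S. 1 / r m)" by auto
  show d: "degree (\<Prod>m\<in>S. [:- r m, 1:]) = card S"
    by (subst degree_prod_eq_sum_degree) auto
  have "lead_coeff (\<Prod>m\<in>S. [:- r m, 1:]) = 1" by (simp add: lead_coeff_prod)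
  then show "coeff (\<Prod>m\<in>S. [:- r m, 1:]) (card S) = 1" unfolding d .
qed

text \<open>The polynomials \<open>b\<^sub>0 + b\<^sub>1 \<Lambda> + \<dots>\<close> in the cyclic shift \<open>\<Lambda>\<close> (with \<open>\<Lambda>\<^sup>n = \<lambda>\<close>).\<close>

definition circulant :: "nat \<Rightarrow> (nat \<Rightarrow> complex) \<Rightarrow> complex poly mat" where
  "circulant n b = mat n n (\<lambda>(i, j). monom (b ((i + (n - j)) mod n)) (if j \<le> i then 0 else 1))"

lemma circulant_carrier [simp]: "circulant n b \<in> carrier_mat n n"
  by (simp add: circulant_def)

lemma circulant_commute: "circulant n a * circulant n b = circulant n b * circulant n a"
proof (rule eq_matI)
  fix i j assume "i < dim_row (circulant n b * circulant n a)" "j < dim_col (circulant n b * circulant n a)"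
  then have ij: "i < n" "j < n" by (auto simp: circulant_def)
  define cl where "cl i j = (i + (n - j)) mod n" for i j
  define pw where "pw i j = (if j \<le> i then 0 else 1 :: nat)" for i j :: nat
  have clpw: "cl i j + j = i + n * pw i j" "cl i j < n" if "i < n" "j < n" for i j
    using that by (auto simp: cl_def pw_def mod_if)
  have cl_unique: "cl i j = c" if "i < n" "j < n" "c < n" "c + j = i + n * e" for i j c e
  proof -
    have e: "e = pw i j" using that
      by (cases e; cases "e - 1") (auto simp: pw_def)
    show ?thesis using clpw[OF that(1,2)] that(4) e by simp
  qed
  have prod: "(circulant n a * circulant n b) $$ (i, j) = (\<Sum>l<n. monom (a (cl i l) * b (cl l j)) (pw i l + pw l j))" for a b
    using ij by (simp add: circulant_def scalar_prod_def atLeast0LessThan cl_def pw_def mult_monom)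
  define f where "f l = (i + j + (n - l)) mod n" for l
  have fl: "f l < n" "f (f l) = l" "cl i (f l) = cl l j" "cl (f l) j = cl i l"
    "pw i (f l) + pw (f l) j = pw i l + pw l j" if l: "l < n" for l
  proof -
    show fn: "f l < n" using ij by (simp add: f_def)
    define e where "e = (i + j + (n - l)) div n"
    have fe: "f l + n * e + l = i + j + n"
      using l unfolding f_def e_def by simp
    have e2: "e \<le> 2"
    proof (rule ccontr)
      assume "\<not> e \<le> 2"
      then have "n * 3 \<le> n * e" by simp
      then show False using fe ij l by linarith
    qed
    have "l + n * e + f l = i + j + n" using fe by simp
    define e' where "e' = (i + j + (n - f l)) div n"
    have fe': "f (f l) + n * e' + f l = i + j + n"
      using fn unfolding f_def[of "f l"] e'_def by simp
    have ff: "f (f l) < n" using ij by (simp add: f_def)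
    have "f (f l) + n * e' = l + n * e" using fe fe' by simp
    then have "(f (f l) + n * e') mod n = (l + n * e) mod n" by simp
    then show "f (f l) = l" using ff l by simp
    note cij = clpw[OF ij(1) l] clpw[OF l ij(2)]
    \<comment> \<open>The two residues are exchanged, and their sum fixes the exponent of \<open>\<lambda>\<close>.\<close>
    have a1: "(cl l j + f l) mod n = i mod n"
    proof -
      have "cl l j + f l + n * e + n = i + n * (pw l j + 2)" using cij fe by (simp add: algebra_simps)
      then have "(cl l j + f l + n * (e + 1)) mod n = (i + n * (pw l j + 2)) mod n" by (simp add: algebra_simps)
      then show ?thesis by (simp only: mod_mult_self2)
    qed
    then obtain d1 where d1: "cl l j + f l = i + n * d1"
    proof -
      have m: "(cl l j + f l) mod n = i" using a1 ij by simp
      show thesis by (rule that[of "(cl l j + f l) div n"]) (use mult_div_mod_eq[of n "cl l j + f l"] m in simp)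
    qed
    show c1: "cl i (f l) = cl l j" by (rule cl_unique[OF ij(1) fn cij(4) d1])
    have a2: "(cl i l + j) mod n = f l mod n"
    proof -
      have "cl i l + j + n = f l + n * (pw i l + e)" using cij fe by (simp add: algebra_simps)
      then have "(cl i l + j + n) mod n = (f l + n * (pw i l + e)) mod n" by simp
      then show ?thesis by simp
    qed
    then obtain d2 where d2: "cl i l + j = f l + n * d2"
    proof -
      have m: "(cl i l + j) mod n = f l" using a2 fn by simp
      show thesis by (rule that[of "(cl i l + j) div n"]) (use mult_div_mod_eq[of n "cl i l + j"] m in simp)
    qed
    show c2: "cl (f l) j = cl i l" by (rule cl_unique[OF fn ij(2) cij(2) d2])
    have "n * (pw i (f l) + pw (f l) j) = n * (pw i l + pw l j)"
      using clpw(1)[OF ij(1) fn] clpw(1)[OF fn ij(2)] cij c1 c2 by (simp add: distrib_left)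
    then show "pw i (f l) + pw (f l) j = pw i l + pw l j" using ij by simp
  qed
  show "(circulant n a * circulant n b) $$ (i, j) = (circulant n b * circulant n a) $$ (i, j)"
    unfolding prod
    by (rule sum.reindex_bij_witness[of _ f f]) (use fl in \<open>auto simp: mult.commute\<close>)
qed (auto simp: circulant_def)

definition fixed_coeff :: "nat \<Rightarrow> nat \<Rightarrow> complex \<Rightarrow> nat \<Rightarrow> complex" where
  "fixed_coeff n k \<alpha> d = \<alpha> ^ (n - k) * inverse \<alpha> ^ d * coeff (\<Prod>m\<in>{k..<n}. [:- (cis (2 * pi / real n) ^ m), 1:]) d"

text \<open>The subspace spanned by \<open>k\<close> eigenvectors of the twisted cyclic shift gives a point whose matrix
  is a polynomial in the shift: the one that vanishes at the other \<open>n - k\<close> eigenvalues.\<close>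

lemma fixed_point:
  assumes k: "0 < k" "k < n" and \<alpha>: "\<alpha> \<noteq> 0"
  obtains x where "g_of n k x (circulant n (fixed_coeff n k \<alpha>))" "lam k (snd x) = \<alpha> ^ n"
proof -
  define \<omega> where "\<omega> = cis (2 * pi / real n)"
  define P where "P = (\<Prod>m\<in>{k..<n}. [:- (\<omega> ^ m), 1:])"
  define b where "b = fixed_coeff n k \<alpha>"
  let ?G = "circulant n b"
  have n: "n > 0" using k by simp
  have \<omega>: "\<omega> ^ n = 1" "inj_on (\<lambda>m. \<omega> ^ m) {..<n}"
    using root_of_unity_powers[OF n] unfolding \<omega>_def by auto
  have w0: "\<omega> \<noteq> 0" by (simp add: \<omega>_def)
  have be: "b d = \<alpha> ^ (n - k) * inverse \<alpha> ^ d * coeff P d" for d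
    unfolding b_def fixed_coeff_def P_def \<omega>_def ..
  have degP: "degree P = n - k" and topP: "coeff P (n - k) = 1"
    using coeff_prod_linear(3,4)[of "{k..<n}" "\<lambda>m. \<omega> ^ m"] w0 by (auto simp: P_def)
  have bz: "b d = 0" if "d > n - k" for d unfolding be using that degP by (simp add: coeff_eq_0)
  have b1: "b (n - k) = 1" unfolding be topP using \<alpha> by (simp add: power_inverse)
  have entry: "?G $$ (i, j) = (if j \<le> i then monom (b (i - j)) 0 else monom (b (n + i - j)) 1)" if "i < n" "j < n" for i j
    using that by (auto simp: circulant_def mod_if add.commute)
  have band: "banded n (n - k) ?G"
  proof (rule bandedI)
    fix i j m assume ij: "i < n" "j < n"
    show "coeff (?G $$ (i, j)) m = 0" if out: "i + n * m < j \<or> j + (n - k) < i + n * m"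
    proof (cases "j \<le> i")
      case True
      then show ?thesis using out bz[of "i - j"] unfolding entry[OF ij] by (cases m) auto
    next
      case False
      then show ?thesis using out bz[of "n + i - j"] ij unfolding entry[OF ij] by (cases m; cases "m - 1") auto
    qed
    show "coeff (?G $$ (i, j)) m = 1" if top: "i + n * m = j + (n - k)"
    proof (cases m)
      case 0
      then have "j \<le> i" "i - j = n - k" using top by auto
      then show ?thesis unfolding entry[OF ij] using 0 b1 by simp
    next
      case (Suc m')
      have m': "m' = 0"
      proof (rule ccontr)
        assume "m' \<noteq> 0"
        then have "n \<le> n * m'" by simp
        moreover have "n * m = n + n * m'" using Suc by simp
        ultimately show False using top ij k by linarith
      qed
      then have "\<not> j \<le> i" "n + i - j = n - k" using top Suc k by auto
      then show ?thesis unfolding entry[OF ij] using Suc m' b1 by simp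
    qed
  qed simp
  define t where "t = (- 1) ^ (k - 1) * \<alpha> ^ n"
  have lt: "lam k t = \<alpha> ^ n" unfolding lam_def t_def by (simp flip: mult.assoc power_add power_mult_distrib)
  have t: "t \<noteq> 0" using \<alpha> by (simp add: t_def)
  define F where "F = mat n k (\<lambda>(i, m). inverse \<alpha> ^ i * inverse (\<omega> ^ m) ^ i / of_nat n)"
  define X where "X = mat k n (\<lambda>(m, j). \<alpha> ^ (n - k) * poly P (\<omega> ^ m) * (\<alpha> ^ j * (\<omega> ^ m) ^ j))"
  have F: "F \<in> carrier_mat n k" and X: "X \<in> carrier_mat k n" by (auto simp: F_def X_def)
  have bf: "b d = (\<Sum>m<k. \<alpha> ^ (n - k) * inverse \<alpha> ^ d * (poly P (\<omega> ^ m) * inverse (\<omega> ^ m) ^ d) / of_nat n)" if d: "d < n" for d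
  proof -
    have "poly P (\<omega> ^ m) = 0" if "m \<in> {k..<n}" for m
      unfolding P_def poly_prod using that by (intro prod_zero) auto
    then have "(\<Sum>m<n. poly P (\<omega> ^ m) * inverse (\<omega> ^ m) ^ d) = (\<Sum>m<k. poly P (\<omega> ^ m) * inverse (\<omega> ^ m) ^ d)"
      using k by (intro sum.mono_neutral_right) auto
    then have "of_nat n * coeff P d = (\<Sum>m<k. poly P (\<omega> ^ m) * inverse (\<omega> ^ m) ^ d)"
      using inverse_fourier[OF n \<omega> _ d, of P] degP k by simp
    then have "coeff P d = (\<Sum>m<k. poly P (\<omega> ^ m) * inverse (\<omega> ^ m) ^ d) / of_nat n"
      using n by (simp add: field_simps)
    then show ?thesis unfolding be by (simp add: sum_distrib_left sum_divide_distrib)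
  qed
  have "ev (lam k t) ?G = F * X"
  proof (rule eq_matI)
    fix i j assume "i < dim_row (F * X)" "j < dim_col (F * X)"
    then have ij: "i < n" "j < n" by (auto simp: F_def X_def)
    have FX: "(F * X) $$ (i, j) = (\<Sum>m<k. inverse \<alpha> ^ i * inverse (\<omega> ^ m) ^ i / of_nat n *
        (\<alpha> ^ (n - k) * poly P (\<omega> ^ m) * (\<alpha> ^ j * (\<omega> ^ m) ^ j)))"
      using ij by (simp add: F_def X_def scalar_prod_def atLeast0LessThan)
    have wn: "(\<omega> ^ m) ^ n = 1" for m by (metis \<omega>(1) mult.commute power_mult power_one)
    show "ev (lam k t) ?G $$ (i, j) = (F * X) $$ (i, j)"
    proof (cases "j \<le> i")
      case True
      have pi: "inverse y ^ (i - j) = inverse y ^ i * y ^ j" if "y \<noteq> 0" for y :: complex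
      proof -
        have "inverse y ^ i = inverse y ^ (i - j) * inverse y ^ j" using True by (simp flip: power_add)
        then show ?thesis using that by (simp add: power_inverse)
      qed
      have "ev (lam k t) ?G $$ (i, j) = b (i - j)"
        using ij True by (simp add: entry poly_monom carrier_matD[OF circulant_carrier])
      also have "\<dots> = (F * X) $$ (i, j)"
        unfolding FX bf[OF less_imp_diff_less[OF ij(1)]] using pi[OF \<alpha>] pi[of "\<omega> ^ _"] w0
        by (intro sum.cong refl) (simp add: field_simps)
      finally show ?thesis .
    next
      case False
      have d: "n + i - j < n" using False ij by auto
      have pi: "y ^ n * inverse y ^ (n + i - j) = inverse y ^ i * y ^ j" if "y \<noteq> 0" for y :: complex
      proof -
        have "n + i = (n + i - j) + j" using False ij by auto
        then have "inverse y ^ (n + i) = inverse y ^ (n + i - j) * inverse y ^ j" by (metis power_add)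
        then have "inverse y ^ n * inverse y ^ i * y ^ j = inverse y ^ (n + i - j)"
          using that by (simp add: power_add power_inverse)
        then show ?thesis using that by (simp add: power_inverse field_simps)
      qed
      have "ev (lam k t) ?G $$ (i, j) = \<alpha> ^ n * b (n + i - j)"
        using ij False by (simp add: entry poly_monom carrier_matD[OF circulant_carrier] lt)
      also have "\<dots> = (\<Sum>m<k. (\<alpha> ^ n * inverse \<alpha> ^ (n + i - j)) * ((\<omega> ^ m) ^ n * inverse (\<omega> ^ m) ^ (n + i - j)) *
          (\<alpha> ^ (n - k) * poly P (\<omega> ^ m)) / of_nat n)"
        unfolding bf[OF d] sum_distrib_left wn by (intro sum.cong refl) simp
      also have "\<dots> = (F * X) $$ (i, j)"
        unfolding FX using pi[OF \<alpha>] pi[of "\<omega> ^ _"] w0 by (intro sum.cong refl) simp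
      finally show ?thesis .
    qed
  qed (auto simp: F_def X_def carrier_matD[OF circulant_carrier])
  then have "g_of n k (colspan n F, t) ?G" by (rule g_ofI[OF band t F X])
  then show ?thesis using that[of "(colspan n F, t)"] lt unfolding b_def by simp
qed

lemma fixed_point_entries:
  assumes k: "0 < k" "k < n"
  obtains \<kappa> b0 where "\<kappa> \<noteq> 0" "b0 \<noteq> 0"
    "\<And>\<alpha> i. \<alpha> \<noteq> 0 \<Longrightarrow> i < n \<Longrightarrow> dg (circulant n (fixed_coeff n k \<alpha>)) i = \<alpha> ^ (n - k) * b0"
    "\<And>\<alpha> i. \<alpha> \<noteq> 0 \<Longrightarrow> i < n \<Longrightarrow> sub n (circulant n (fixed_coeff n k \<alpha>)) i = \<alpha> ^ (n - k) * b0 * \<kappa> / \<alpha>"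
proof -
  define \<omega> where "\<omega> = cis (2 * pi / real n)"
  define P where "P = (\<Prod>m\<in>{k..<n}. [:- (\<omega> ^ m), 1:])"
  define b0 where "b0 = coeff P 0"
  define \<kappa> where "\<kappa> = - (\<Sum>m\<in>{k..<n}. 1 / \<omega> ^ m)"
  have n: "n > 0" "n \<ge> 2" using k by auto
  have \<omega>: "\<omega> ^ n = 1" "inj_on (\<lambda>m. \<omega> ^ m) {..<n}"
    using root_of_unity_powers[OF n(1)] unfolding \<omega>_def by auto
  have w0: "\<omega> \<noteq> 0" by (simp add: \<omega>_def)
  have b0: "b0 \<noteq> 0" and P1: "coeff P 1 = b0 * \<kappa>"
    using coeff_prod_linear(1,2)[of "{k..<n}" "\<lambda>m. \<omega> ^ m"] w0 by (auto simp: P_def b0_def \<kappa>_def)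
  have \<kappa>: "\<kappa> \<noteq> 0"
  proof
    assume "\<kappa> = 0"
    then have s: "(\<Sum>m\<in>{k..<n}. inverse \<omega> ^ m) = 0" by (simp add: \<kappa>_def power_inverse divide_inverse)
    have "(\<Sum>m\<in>{k..<n}. inverse \<omega> ^ Suc m - inverse \<omega> ^ m) = inverse \<omega> ^ n - inverse \<omega> ^ k"
      using k by (intro sum_Suc_diff') auto
    moreover have "(\<Sum>m\<in>{k..<n}. inverse \<omega> ^ Suc m - inverse \<omega> ^ m) = (inverse \<omega> - 1) * (\<Sum>m\<in>{k..<n}. inverse \<omega> ^ m)"
      by (simp add: sum_distrib_left algebra_simps)
    ultimately have "inverse \<omega> ^ k = inverse \<omega> ^ n" using s by simp
    then have "\<omega> ^ k = \<omega> ^ 0" using \<omega>(1) by (simp add: power_inverse)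
    then show False using inj_onD[OF \<omega>(2), of k 0] k by auto
  qed
  have be: "fixed_coeff n k \<alpha> d = \<alpha> ^ (n - k) * inverse \<alpha> ^ d * coeff P d" for \<alpha> d
    unfolding fixed_coeff_def P_def \<omega>_def ..
  show ?thesis
  proof (rule that[OF \<kappa> b0])
    fix \<alpha> :: complex and i assume \<alpha>: "\<alpha> \<noteq> 0" and i: "i < n"
    show "dg (circulant n (fixed_coeff n k \<alpha>)) i = \<alpha> ^ (n - k) * b0"
      using i by (simp add: dg_def circulant_def be b0_def)
    have "sub n (circulant n (fixed_coeff n k \<alpha>)) i = fixed_coeff n k \<alpha> 1"
    proof (cases "i = 0")
      case True
      then show ?thesis using n by (simp add: sub_def circulant_def prev_def)
    next
      case False
      then have "(i + (n - (i - 1))) mod n = 1" using i n by (simp add: mod_if)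
      then show ?thesis using False i by (simp add: sub_def circulant_def prev_def)
    qed
    also have "\<dots> = \<alpha> ^ (n - k) * b0 * \<kappa> / \<alpha>" unfolding be P1 by (simp add: divide_inverse)
    finally show "sub n (circulant n (fixed_coeff n k \<alpha>)) i = \<alpha> ^ (n - k) * b0 * \<kappa> / \<alpha>" .
  qed
qed

section \<open>Rational functions on frames and liftable maps\<close>

text \<open>Quotients of polynomials with one denominator that has no zero on the frames over \<open>U\<close>. The
  R-matrix is given on frames by such functions, on the whole of its domain.\<close>

definition rf :: "('a, 'p) variety \<Rightarrow> 'p set \<Rightarrow> ('a \<Rightarrow> complex) \<Rightarrow> bool" where
  "rf V U h \<longleftrightarrow> (\<exists>p\<in>poly_funs (coords V). \<exists>q\<in>poly_funs (coords V).
    \<forall>a\<in>frames V. proj V a \<in> U \<longrightarrow> q a \<noteq> 0 \<and> h a = p a / q a)"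

lemma rf_poly: "p \<in> poly_funs (coords V) \<Longrightarrow> rf V U p"
  unfolding rf_def by (intro bexI[of _ p] bexI[of _ "\<lambda>_. 1"]) (auto intro: poly_funs.const)

lemma rf_const: "rf V U (\<lambda>_. z)"
  by (rule rf_poly) (rule poly_funs.const)

lemma rf_coord: "c \<in> coords V \<Longrightarrow> rf V U c"
  by (rule rf_poly) (rule poly_funs.coord)

lemma rf_cong: "rf V U h \<Longrightarrow> (\<And>a. a \<in> frames V \<Longrightarrow> proj V a \<in> U \<Longrightarrow> h' a = h a) \<Longrightarrow> rf V U h'"
  unfolding rf_def by metis

lemma rf_subset: "rf V U h \<Longrightarrow> U' \<subseteq> U \<Longrightarrow> rf V U' h"
  unfolding rf_def by blast

lemma rf_add:
  assumes "rf V U f" "rf V U g"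
  shows "rf V U (\<lambda>a. f a + g a)"
proof -
  obtain p q where pq: "p \<in> poly_funs (coords V)" "q \<in> poly_funs (coords V)"
    "\<forall>a\<in>frames V. proj V a \<in> U \<longrightarrow> q a \<noteq> 0 \<and> f a = p a / q a" using assms(1) unfolding rf_def by blast
  obtain r s where rs: "r \<in> poly_funs (coords V)" "s \<in> poly_funs (coords V)"
    "\<forall>a\<in>frames V. proj V a \<in> U \<longrightarrow> s a \<noteq> 0 \<and> g a = r a / s a" using assms(2) unfolding rf_def by blast
  show ?thesis unfolding rf_def
    by (rule bexI[of _ "\<lambda>a. p a * s a + r a * q a"], rule bexI[of _ "\<lambda>a. q a * s a"])
       (use pq rs in \<open>auto intro!: poly_funs.add poly_funs.mult simp: field_simps\<close>)
qed

lemma rf_mult: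
  assumes "rf V U f" "rf V U g"
  shows "rf V U (\<lambda>a. f a * g a)"
proof -
  obtain p q where pq: "p \<in> poly_funs (coords V)" "q \<in> poly_funs (coords V)"
    "\<forall>a\<in>frames V. proj V a \<in> U \<longrightarrow> q a \<noteq> 0 \<and> f a = p a / q a" using assms(1) unfolding rf_def by blast
  obtain r s where rs: "r \<in> poly_funs (coords V)" "s \<in> poly_funs (coords V)"
    "\<forall>a\<in>frames V. proj V a \<in> U \<longrightarrow> s a \<noteq> 0 \<and> g a = r a / s a" using assms(2) unfolding rf_def by blast
  show ?thesis unfolding rf_def
    by (rule bexI[of _ "\<lambda>a. p a * r a"], rule bexI[of _ "\<lambda>a. q a * s a"])
       (use pq rs in \<open>auto intro!: poly_funs.add poly_funs.mult simp: field_simps\<close>)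
qed

lemma rf_divide:
  assumes "rf V U f" "rf V U g" "\<And>a. a \<in> frames V \<Longrightarrow> proj V a \<in> U \<Longrightarrow> g a \<noteq> 0"
  shows "rf V U (\<lambda>a. f a / g a)"
proof -
  obtain r s where rs: "r \<in> poly_funs (coords V)" "s \<in> poly_funs (coords V)"
    "\<forall>a\<in>frames V. proj V a \<in> U \<longrightarrow> s a \<noteq> 0 \<and> g a = r a / s a" using assms(2) unfolding rf_def by blast
  have "rf V U (\<lambda>a. s a / r a)" unfolding rf_def
    by (rule bexI[of _ s], rule bexI[of _ r]) (use rs assms(3) in auto)
  from rf_mult[OF assms(1) this] show ?thesis
    by (rule rf_cong) (use rs in auto)
qed

lemma rf_sum: "(\<And>i. i \<in> S \<Longrightarrow> rf V U (f i)) \<Longrightarrow> rf V U (\<lambda>a. \<Sum>i\<in>S. f i a)"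
  by (induction S rule: infinite_finite_induct) (auto intro: rf_const rf_add)

lemma rf_prod: "(\<And>i. i \<in> S \<Longrightarrow> rf V U (f i)) \<Longrightarrow> rf V U (\<lambda>a. \<Prod>i\<in>S. f i a)"
  by (induction S rule: infinite_finite_induct) (auto intro: rf_const rf_mult)

lemma rf_if: "rf V U f \<Longrightarrow> rf V U g \<Longrightarrow> rf V U (\<lambda>a. if b then f a else g a)"
  by (cases b) simp_all

lemma rf_diff: "rf V U f \<Longrightarrow> rf V U g \<Longrightarrow> rf V U (\<lambda>a. f a - g a)"
  using rf_add[of V U f "\<lambda>a. -1 * g a"] rf_mult[OF rf_const, of V U g "-1"] by simp

lemma open_points: "openin (zariski V) (points V)"
  using openin_topspace[of "zariski V"] by (simp add: topspace_zariski)

lemma open_subset_points: "openin (zariski V) U \<Longrightarrow> U \<subseteq> points V"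
  by (simp add: openin_zariski zariski_open_def)

lemma open_rf_nonzero:
  assumes U: "openin (zariski V) U" and h: "rf V U h"
    and P: "\<And>a. a \<in> frames V \<Longrightarrow> proj V a \<in> U \<Longrightarrow> P (proj V a) \<longleftrightarrow> h a \<noteq> 0"
  shows "openin (zariski V) {x \<in> U. P x}"
  unfolding openin_zariski zariski_open_def
proof (intro conjI ballI impI)
  show "{x \<in> U. P x} \<subseteq> points V" using open_subset_points[OF U] by auto
  fix a assume a: "a \<in> frames V" "proj V a \<in> {x \<in> U. P x}"
  obtain q0 where q0: "q0 \<in> poly_funs (coords V)" "q0 a \<noteq> 0" "\<forall>b\<in>frames V. q0 b \<noteq> 0 \<longrightarrow> proj V b \<in> U"
    using U a unfolding openin_zariski zariski_open_def by blast
  obtain p q where pq: "p \<in> poly_funs (coords V)" "q \<in> poly_funs (coords V)"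
    "\<forall>a\<in>frames V. proj V a \<in> U \<longrightarrow> q a \<noteq> 0 \<and> h a = p a / q a" using h unfolding rf_def by blast
  show "\<exists>q\<in>poly_funs (coords V). q a \<noteq> 0 \<and> (\<forall>b\<in>frames V. q b \<noteq> 0 \<longrightarrow> proj V b \<in> {x \<in> U. P x})"
    using q0 pq P a by (intro bexI[of _ "\<lambda>a. q0 a * p a"]) (auto intro!: poly_funs.mult)
qed

text \<open>A lift to frames is a criterion for morphisms of the quotient varieties that composes well.\<close>

definition lifts :: "('a, 'p) variety \<Rightarrow> ('b, 'q) variety \<Rightarrow> 'p set \<Rightarrow> ('p \<Rightarrow> 'q) \<Rightarrow> ('a \<Rightarrow> 'b) \<Rightarrow> bool" where
  "lifts V W U f F \<longleftrightarrow>
    (\<forall>a\<in>frames V. proj V a \<in> U \<longrightarrow> F a \<in> frames W \<and> proj W (F a) = f (proj V a)) \<and>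
    (\<forall>c\<in>coords W. rf V U (\<lambda>a. c (F a)))"

definition liftable :: "('a, 'p) variety \<Rightarrow> ('b, 'q) variety \<Rightarrow> 'p set \<Rightarrow> ('p \<Rightarrow> 'q) \<Rightarrow> bool" where
  "liftable V W U f \<longleftrightarrow> openin (zariski V) U \<and> (\<exists>F. lifts V W U f F)"

lemma rf_lift_poly:
  assumes F: "\<And>c. c \<in> coords W \<Longrightarrow> rf V U (\<lambda>a. c (F a))" and p: "p \<in> poly_funs (coords W)"
  shows "rf V U (\<lambda>a. p (F a))"
  using p by (induction rule: poly_funs.induct) (auto intro: rf_const F rf_add rf_mult)

lemma lifts_preimage_open:
  assumes U: "openin (zariski V) U" and F: "lifts V W U f F" and Z: "openin (zariski W) Z"
  shows "openin (zariski V) {x \<in> U. f x \<in> Z}"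
  unfolding openin_zariski zariski_open_def
proof (intro conjI ballI impI)
  show "{x \<in> U. f x \<in> Z} \<subseteq> points V" using open_subset_points[OF U] by auto
  fix a assume a: "a \<in> frames V" "proj V a \<in> {x \<in> U. f x \<in> Z}"
  have Fa: "F a \<in> frames W" "proj W (F a) \<in> Z" using F a unfolding lifts_def by auto
  obtain q0 where q0: "q0 \<in> poly_funs (coords V)" "q0 a \<noteq> 0" "\<forall>b\<in>frames V. q0 b \<noteq> 0 \<longrightarrow> proj V b \<in> U"
    using U a unfolding openin_zariski zariski_open_def by blast
  obtain r where r: "r \<in> poly_funs (coords W)" "r (F a) \<noteq> 0" "\<forall>b\<in>frames W. r b \<noteq> 0 \<longrightarrow> proj W b \<in> Z"
    using Z Fa unfolding openin_zariski zariski_open_def by blast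
  have "rf V U (\<lambda>a. r (F a))" by (rule rf_lift_poly[OF _ r(1)]) (use F in \<open>auto simp: lifts_def\<close>)
  then obtain p q where pq: "p \<in> poly_funs (coords V)" "q \<in> poly_funs (coords V)"
    "\<forall>a\<in>frames V. proj V a \<in> U \<longrightarrow> q a \<noteq> 0 \<and> r (F a) = p a / q a" unfolding rf_def by blast
  have "proj V b \<in> U \<and> f (proj V b) \<in> Z" if b: "b \<in> frames V" "q0 b * p b \<noteq> 0" for b
  proof -
    have bU: "proj V b \<in> U" using q0 b by auto
    then have "r (F b) \<noteq> 0" using pq b by auto
    then show ?thesis using r F b bU unfolding lifts_def by metis
  qed
  moreover have "q0 a * p a \<noteq> 0" using q0 pq a r by auto
  ultimately show "\<exists>q\<in>poly_funs (coords V). q a \<noteq> 0 \<and> (\<forall>b\<in>frames V. q b \<noteq> 0 \<longrightarrow> proj V b \<in> {x \<in> U. f x \<in> Z})"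
    using poly_funs.mult[OF q0(1) pq(1)] by (intro bexI[of _ "\<lambda>a. q0 a * p a"]) auto
qed

lemma liftable_preimage_open:
  "liftable V W U f \<Longrightarrow> openin (zariski W) Z \<Longrightarrow> openin (zariski V) {x \<in> U. f x \<in> Z}"
  unfolding liftable_def using lifts_preimage_open by blast

lemma liftable_in_points:
  assumes f: "liftable V W U f" and x: "x \<in> U"
  shows "f x \<in> points W"
proof -
  obtain F where U: "openin (zariski V) U" and F: "lifts V W U f F" using f unfolding liftable_def by blast
  obtain a where "a \<in> frames V" "x = proj V a" using x open_subset_points[OF U] unfolding points_def by blast
  then have "F a \<in> frames W" "f x = proj W (F a)" using F x unfolding lifts_def by auto
  then show ?thesis unfolding points_def by auto
qed

lemma liftable_morphism_on:
  assumes "liftable V W U f"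
  shows "morphism_on V W U f"
proof -
  obtain F where U: "openin (zariski V) U" and F: "lifts V W U f F" using assms unfolding liftable_def by blast
  have ts: "topspace (subtopology (zariski V) U) = U"
    using open_subset_points[OF U] by (auto simp: topspace_zariski)
  have into: "f x \<in> points W" if "x \<in> U" for x using liftable_in_points[OF assms that] .
  show ?thesis unfolding morphism_on_def
  proof (intro conjI allI impI)
    show "continuous_map (subtopology (zariski V) U) (zariski W) f"
      unfolding continuous_map_def ts
      using into lifts_preimage_open[OF U F] openin_open_subtopology[OF U] by (auto simp: topspace_zariski)
  next
    fix Z h assume Zh: "openin (zariski W) Z \<and> regular_on W Z h"
    show "regular_on V {x \<in> U. f x \<in> Z} (h \<circ> f)"
      unfolding regular_on_def
    proof (intro ballI impI)
      fix a assume a: "a \<in> frames V" "proj V a \<in> {x \<in> U. f x \<in> Z}"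
      have Fb: "F b \<in> frames W" "proj W (F b) = f (proj V b)" if "b \<in> frames V" "proj V b \<in> U" for b
        using F that unfolding lifts_def by auto
      obtain p q where pq: "p \<in> poly_funs (coords W)" "q \<in> poly_funs (coords W)" "q (F a) \<noteq> 0"
        "\<forall>b\<in>frames W. proj W b \<in> Z \<and> q b \<noteq> 0 \<longrightarrow> h (proj W b) = p b / q b"
        using Zh a Fb[OF a(1)] unfolding regular_on_def by force
      have "rf V U (\<lambda>a. p (F a))" by (rule rf_lift_poly[OF _ pq(1)]) (use F in \<open>auto simp: lifts_def\<close>)
      then obtain p1 p2 where p12: "p1 \<in> poly_funs (coords V)" "p2 \<in> poly_funs (coords V)"
        "\<forall>a\<in>frames V. proj V a \<in> U \<longrightarrow> p2 a \<noteq> 0 \<and> p (F a) = p1 a / p2 a" unfolding rf_def by blast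
      have "rf V U (\<lambda>a. q (F a))" by (rule rf_lift_poly[OF _ pq(2)]) (use F in \<open>auto simp: lifts_def\<close>)
      then obtain q1 q2 where q12: "q1 \<in> poly_funs (coords V)" "q2 \<in> poly_funs (coords V)"
        "\<forall>a\<in>frames V. proj V a \<in> U \<longrightarrow> q2 a \<noteq> 0 \<and> q (F a) = q1 a / q2 a" unfolding rf_def by blast
      show "\<exists>p\<in>poly_funs (coords V). \<exists>q\<in>poly_funs (coords V). q a \<noteq> 0 \<and>
        (\<forall>b\<in>frames V. proj V b \<in> {x \<in> U. f x \<in> Z} \<and> q b \<noteq> 0 \<longrightarrow> (h \<circ> f) (proj V b) = p b / q b)"
      proof (rule bexI[of _ "\<lambda>a. p1 a * q2 a"], rule bexI[of _ "\<lambda>a. p2 a * q1 a"], intro conjI ballI impI)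
        show "p2 a * q1 a \<noteq> 0" using p12(3) q12(3) a pq(3) by auto
        fix b assume b: "b \<in> frames V" "proj V b \<in> {x \<in> U. f x \<in> Z} \<and> p2 b * q1 b \<noteq> 0"
        then have bU: "proj V b \<in> U" "f (proj V b) \<in> Z" by auto
        have "q (F b) \<noteq> 0" using q12(3) b bU by auto
        then have "h (f (proj V b)) = p (F b) / q (F b)" using pq(4) Fb[OF b(1) bU(1)] bU by metis
        then show "(h \<circ> f) (proj V b) = p1 b * q2 b / (p2 b * q1 b)" using p12(3) q12(3) b bU by auto
      qed (use p12 q12 in \<open>auto intro: poly_funs.mult\<close>)
    qed
  qed
qed

lemma liftable_restrict:
  "liftable V W U f \<Longrightarrow> openin (zariski V) U' \<Longrightarrow> U' \<subseteq> U \<Longrightarrow> liftable V W U' f"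
  unfolding liftable_def lifts_def using rf_subset by (metis subsetD)

lemma liftable_comp:
  assumes f: "liftable V W U f" and g: "liftable W X U' g"
  shows "liftable V X {x \<in> U. f x \<in> U'} (\<lambda>x. g (f x))"
proof -
  obtain F where F: "lifts V W U f F" and U: "openin (zariski V) U" using f unfolding liftable_def by blast
  obtain G where G: "lifts W X U' g G" and U': "openin (zariski W) U'" using g unfolding liftable_def by blast
  have "lifts V X {x \<in> U. f x \<in> U'} (\<lambda>x. g (f x)) (\<lambda>a. G (F a))"
    unfolding lifts_def
  proof (intro conjI ballI impI)
    fix a assume a: "a \<in> frames V" "proj V a \<in> {x \<in> U. f x \<in> U'}"
    then have "F a \<in> frames W" "proj W (F a) = f (proj V a)" "proj W (F a) \<in> U'" using F unfolding lifts_def by auto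
    then show "G (F a) \<in> frames X" "proj X (G (F a)) = g (f (proj V a))" using G unfolding lifts_def by auto
  next
    fix c assume "c \<in> coords X"
    then obtain p q where pq: "p \<in> poly_funs (coords W)" "q \<in> poly_funs (coords W)"
      "\<forall>b\<in>frames W. proj W b \<in> U' \<longrightarrow> q b \<noteq> 0 \<and> c (G b) = p b / q b"
      using G unfolding lifts_def rf_def by metis
    have pF: "rf V U (\<lambda>a. p (F a))" and qF: "rf V U (\<lambda>a. q (F a))"
      using rf_lift_poly[OF _ pq(1), of V U F] rf_lift_poly[OF _ pq(2), of V U F] F unfolding lifts_def by auto
    have sub: "{x \<in> U. f x \<in> U'} \<subseteq> U" by auto
    have b: "q (F a) \<noteq> 0 \<and> c (G (F a)) = p (F a) / q (F a)"
      if "a \<in> frames V" "proj V a \<in> {x \<in> U. f x \<in> U'}" for a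
    proof -
      have "F a \<in> frames W" "proj W (F a) \<in> U'" using F that unfolding lifts_def by auto
      then show ?thesis using pq(3) by blast
    qed
    show "rf V {x \<in> U. f x \<in> U'} (\<lambda>a. c (G (F a)))"
      by (rule rf_cong[OF rf_divide[OF rf_subset[OF pF sub] rf_subset[OF qF sub]]]) (use b in auto)
  qed
  then show ?thesis unfolding liftable_def using lifts_preimage_open[OF U F U'] by blast
qed

lemma liftable_pair:
  assumes f: "liftable V W U f" and g: "liftable V X U g"
  shows "liftable V (W \<times>\<^sub>V X) U (\<lambda>x. (f x, g x))"
proof -
  obtain F where F: "lifts V W U f F" and U: "openin (zariski V) U" using f unfolding liftable_def by blast
  obtain G where G: "lifts V X U g G" using g unfolding liftable_def by blast
  have "lifts V (W \<times>\<^sub>V X) U (\<lambda>x. (f x, g x)) (\<lambda>a. (F a, G a))"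
    using F G unfolding lifts_def prod_variety_def by auto
  then show ?thesis unfolding liftable_def using U by blast
qed

lemma points_prod: "points (V \<times>\<^sub>V W) = points V \<times> points W"
  unfolding points_def prod_variety_def by (auto simp: map_prod_def image_iff)

lemma liftable_fst: "liftable (V \<times>\<^sub>V W) V (points (V \<times>\<^sub>V W)) fst"
  unfolding liftable_def
proof (intro conjI exI open_points)
  show "lifts (V \<times>\<^sub>V W) V (points (V \<times>\<^sub>V W)) fst fst"
    unfolding lifts_def by (auto simp: prod_variety_def comp_def intro!: rf_coord)
qed

lemma liftable_snd: "liftable (V \<times>\<^sub>V W) W (points (V \<times>\<^sub>V W)) snd"
  unfolding liftable_def
proof (intro conjI exI open_points)
  show "lifts (V \<times>\<^sub>V W) W (points (V \<times>\<^sub>V W)) snd snd"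
    unfolding lifts_def by (auto simp: prod_variety_def comp_def intro!: rf_coord)
qed

subsection \<open>Matrices of rational functions\<close>

definition rfm :: "('a, 'p) variety \<Rightarrow> 'p set \<Rightarrow> nat \<Rightarrow> nat \<Rightarrow> ('a \<Rightarrow> complex mat) \<Rightarrow> bool" where
  "rfm V U n m M \<longleftrightarrow> (\<forall>a\<in>frames V. proj V a \<in> U \<longrightarrow> M a \<in> carrier_mat n m) \<and>
    (\<forall>i<n. \<forall>j<m. rf V U (\<lambda>a. M a $$ (i, j)))"

lemma rfm_mult:
  assumes M: "rfm V U n m M" and N: "rfm V U m l N"
  shows "rfm V U n l (\<lambda>a. M a * N a)"
  unfolding rfm_def
proof (intro conjI ballI impI allI)
  fix a assume "a \<in> frames V" "proj V a \<in> U"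
  then show "M a * N a \<in> carrier_mat n l" using M N unfolding rfm_def by auto
next
  fix i j assume ij: "i < n" "j < l"
  have "rf V U (\<lambda>a. \<Sum>k<m. M a $$ (i, k) * N a $$ (k, j))"
    using M N ij unfolding rfm_def by (intro rf_sum rf_mult) auto
  then show "rf V U (\<lambda>a. (M a * N a) $$ (i, j))"
  proof (rule rf_cong)
    fix a assume "a \<in> frames V" "proj V a \<in> U"
    then have "M a \<in> carrier_mat n m" "N a \<in> carrier_mat m l" using M N unfolding rfm_def by auto
    then show "(M a * N a) $$ (i, j) = (\<Sum>k<m. M a $$ (i, k) * N a $$ (k, j))"
      using ij by (simp add: scalar_prod_def atLeast0LessThan)
  qed
qed

lemma rf_det:
  assumes M: "rfm V U m m M"
  shows "rf V U (\<lambda>a. det (M a))"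
proof (rule rf_cong)
  show "rf V U (\<lambda>a. \<Sum>p\<in>{p. p permutes {0..<m}}. signof p * (\<Prod>i = 0..<m. M a $$ (i, p i)))"
  proof (intro rf_sum rf_mult rf_const rf_prod)
    fix p i assume "p \<in> {p. p permutes {0..<m}}" "i \<in> {0..<m}"
    then have "i < m" "p i < m" using permutes_in_image[of p "{0..<m}" i] by auto
    then show "rf V U (\<lambda>a. M a $$ (i, p i))" using M unfolding rfm_def by blast
  qed
  fix a assume "a \<in> frames V" "proj V a \<in> U"
  then have "M a \<in> carrier_mat m m" using M unfolding rfm_def by auto
  then show "det (M a) = (\<Sum>p\<in>{p. p permutes {0..<m}}. signof p * (\<Prod>i = 0..<m. M a $$ (i, p i)))"
    by (rule det_def')
qed

lemma rf_minor:
  assumes M: "rfm V U n k M" and J: "J \<subseteq> {..<n}" "card J = k"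
  shows "rf V U (\<lambda>a. minor J (M a))"
  unfolding minor_def
proof (rule rf_det[where m = k], unfold rfm_def, intro conjI ballI impI allI)
  fix a assume "a \<in> frames V" "proj V a \<in> U"
  then have "M a \<in> carrier_mat n k" using M unfolding rfm_def by auto
  then show "submatrix (M a) J UNIV \<in> carrier_mat k k" by (simp add: submatrix_rows_eq[OF _ J])
next
  fix i j assume ij: "i < k" "j < k"
  have "rf V U (\<lambda>a. M a $$ (pick J i, j))"
    using M ij pick_subset[OF J(1), of i] J(2) unfolding rfm_def by auto
  then show "rf V U (\<lambda>a. submatrix (M a) J UNIV $$ (i, j))"
  proof (rule rf_cong)
    fix a assume "a \<in> frames V" "proj V a \<in> U"
    then have "M a \<in> carrier_mat n k" using M unfolding rfm_def by auto
    then show "submatrix (M a) J UNIV $$ (i, j) = M a $$ (pick J i, j)"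
      using submatrix_rows_eq[OF _ J, of "M a" k] ij by simp
  qed
qed

lemma rfm_adj:
  assumes M: "rfm V U n n M"
  shows "rfm V U n n (\<lambda>a. adj_mat (M a))"
  unfolding rfm_def
proof (intro conjI ballI impI allI)
  fix a assume "a \<in> frames V" "proj V a \<in> U"
  then show "adj_mat (M a) \<in> carrier_mat n n" using M adj_mat(1) unfolding rfm_def by auto
next
  fix i j assume ij: "i < n" "j < n"
  have "rfm V U (n - 1) (n - 1) (\<lambda>a. mat_delete (M a) j i)"
    unfolding rfm_def
  proof (intro conjI ballI impI allI)
    fix a assume "a \<in> frames V" "proj V a \<in> U"
    then have "M a \<in> carrier_mat n n" using M unfolding rfm_def by blast
    then show "mat_delete (M a) j i \<in> carrier_mat (n - 1) (n - 1)" by (rule mat_delete_carrier)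
  next
    fix i' j' assume ij': "i' < n - 1" "j' < n - 1"
    have "rf V U (\<lambda>a. M a $$ (if i' < j then i' else Suc i', if j' < i then j' else Suc j'))"
      using M ij' unfolding rfm_def by auto
    then show "rf V U (\<lambda>a. mat_delete (M a) j i $$ (i', j'))"
    proof (rule rf_cong)
      fix a assume "a \<in> frames V" "proj V a \<in> U"
      then have "M a \<in> carrier_mat n n" using M unfolding rfm_def by auto
      then show "mat_delete (M a) j i $$ (i', j') = M a $$ (if i' < j then i' else Suc i', if j' < i then j' else Suc j')"
        using ij' by (simp add: mat_delete_def)
    qed
  qed
  then have "rf V U (\<lambda>a. (- 1) ^ (j + i) * det (mat_delete (M a) j i))"
    by (intro rf_mult rf_const rf_det)
  then show "rf V U (\<lambda>a. adj_mat (M a) $$ (i, j))"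
  proof (rule rf_cong)
    fix a assume "a \<in> frames V" "proj V a \<in> U"
    then have "M a \<in> carrier_mat n n" using M unfolding rfm_def by auto
    then show "adj_mat (M a) $$ (i, j) = (- 1) ^ (j + i) * det (mat_delete (M a) j i)"
      using ij by (simp add: adj_mat_def cofactor_def)
  qed
qed

subsection \<open>The matrix \<open>g\<close> as a function of a frame\<close>

definition g_frame :: "nat \<Rightarrow> nat \<Rightarrow> complex mat \<Rightarrow> complex \<Rightarrow> complex poly mat" where
  "g_frame n k F t = mat n n (\<lambda>(i, j). Polynomial.smult (minor_ratio n k F i j)
            (if j < k then 1 else if j \<le> i then [:t:] else [:0, 1:]))"

definition good_minors :: "nat \<Rightarrow> nat \<Rightarrow> complex mat \<Rightarrow> complex" where
  "good_minors n k F = (\<Prod>c<n. minor (window n k c) F)"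

lemma good_minors_nonzero_iff: "good_minors n k F \<noteq> 0 \<longleftrightarrow> (\<forall>c<n. minor (window n k c) F \<noteq> 0)"
  by (auto simp: good_minors_def)

lemma g_of_g_frame_iff:
  assumes F: "F \<in> full_rank_mats n k" and t: "t \<noteq> 0" and k: "0 < k" "k < n"
  shows "g_of n k (colspan n F, t) G \<longleftrightarrow> good_minors n k F \<noteq> 0 \<and> G = g_frame n k F t"
proof -
  have "(colspan n F, t) \<in> points (XX n k)" unfolding points_def XX_def using F t by force
  then show ?thesis unfolding g_of_iff[OF k] g_mat_colspan[OF F k] good_minors_nonzero_iff g_frame_def by auto
qed

lemma rf_good_minors:
  assumes F: "rfm V U n k F" and k: "0 < k" "k < n"
  shows "rf V U (\<lambda>a. good_minors n k (F a))"
  unfolding good_minors_def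
  by (intro rf_prod rf_minor[OF F] window_subset card_window) (use k in auto)

lemma rf_minor_ratio:
  assumes F: "rfm V U n k F" and k: "0 < k" "k < n" and ij: "i < n" "j < n"
    and nz: "\<And>a. a \<in> frames V \<Longrightarrow> proj V a \<in> U \<Longrightarrow> good_minors n k (F a) \<noteq> 0"
  shows "rf V U (\<lambda>a. minor_ratio n k (F a) i j)"
proof (cases "i \<in> gap n k j")
  case True
  then show ?thesis by (simp add: minor_ratio_def rf_const)
next
  case False
  have "rf V U (\<lambda>a. minor (insert i (gap n k j)) (F a) / minor (window n k j) (F a))"
  proof (rule rf_divide)
    show "rf V U (\<lambda>a. minor (insert i (gap n k j)) (F a))"
      by (rule rf_minor[OF F]) (use gap_subset[of n k j] card_insert_gap[OF k, of i j] False ij in auto)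
    show "rf V U (\<lambda>a. minor (window n k j) (F a))"
      by (intro rf_minor[OF F] window_subset card_window) (use k in auto)
  qed (use nz ij good_minors_nonzero_iff in blast)
  then show ?thesis using False by (simp add: minor_ratio_def)
qed

lemma rf_g_frame_coeff:
  assumes F: "rfm V U n k F" and t: "rf V U t" and k: "0 < k" "k < n" and ij: "i < n" "j < n"
    and nz: "\<And>a. a \<in> frames V \<Longrightarrow> proj V a \<in> U \<Longrightarrow> good_minors n k (F a) \<noteq> 0"
  shows "rf V U (\<lambda>a. coeff (g_frame n k (F a) (t a) $$ (i, j)) m)"
proof -
  have e: "coeff (g_frame n k (F a) (t a) $$ (i, j)) m =
    minor_ratio n k (F a) i j * (if j < k then (if m = 0 then 1 else 0) else if j \<le> i then (if m = 0 then t a else 0) else (if m = 1 then 1 else 0))" for a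
    using ij by (auto simp: g_frame_def coeff_pCons split: nat.split)
  show ?thesis unfolding e
    by (intro rf_mult rf_minor_ratio[OF F k ij nz] rf_if rf_const t)
qed

lemma rfm_ev_g_frame:
  assumes F: "rfm V U n k F" and t: "rf V U t" and z: "rf V U z" and k: "0 < k" "k < n"
    and nz: "\<And>a. a \<in> frames V \<Longrightarrow> proj V a \<in> U \<Longrightarrow> good_minors n k (F a) \<noteq> 0"
  shows "rfm V U n n (\<lambda>a. ev (z a) (g_frame n k (F a) (t a)))"
  unfolding rfm_def
proof (intro conjI ballI impI allI)
  fix i j assume ij: "i < n" "j < n"
  have e: "ev (z a) (g_frame n k (F a) (t a)) $$ (i, j) =
    minor_ratio n k (F a) i j * (if j < k then 1 else if j \<le> i then t a else z a)" for a
    using ij by (simp add: g_frame_def)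
  show "rf V U (\<lambda>a. ev (z a) (g_frame n k (F a) (t a)) $$ (i, j))" unfolding e
    by (intro rf_mult rf_minor_ratio[OF F k ij nz] rf_if rf_const t z)
qed (simp add: g_frame_def)

subsection \<open>The domain of the R-matrix\<close>

text \<open>Frames for the two components of the R-matrix: the image of the second subspace under the first
  matrix, and the image of the first subspace under the inverse of the new first matrix, up to a
  scalar.\<close>

definition R_frame1 :: "nat \<Rightarrow> nat \<Rightarrow> nat \<Rightarrow> (complex mat \<times> complex) \<times> (complex mat \<times> complex) \<Rightarrow> complex mat" where
  "R_frame1 n l k = (\<lambda>((E, s), (F, t)). ev (lam k t) (g_frame n l E s) * F)"

definition R_frame2 :: "nat \<Rightarrow> nat \<Rightarrow> nat \<Rightarrow> (complex mat \<times> complex) \<times> (complex mat \<times> complex) \<Rightarrow> complex mat" where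
  "R_frame2 n l k a = (case a of ((E, s), (F, t)) \<Rightarrow> adj_mat (ev (lam l s) (g_frame n k (R_frame1 n l k a) t)) * E)"

definition R_dom :: "nat \<Rightarrow> nat \<Rightarrow> nat \<Rightarrow> (point \<times> point) set" where
  "R_dom n l k = {p. \<exists>q. R_rel n l k p q}"

definition good_pairs :: "nat \<Rightarrow> nat \<Rightarrow> nat \<Rightarrow> (point \<times> point) set" where
  "good_pairs n l k = {(x, y). (\<exists>A. g_of n l x A) \<and> (\<exists>B. g_of n k y B)}"

lemma frames_pair:
  "a \<in> frames (XX n l \<times>\<^sub>V XX n k) \<longleftrightarrow> (\<exists>E s F t. a = ((E, s), (F, t)) \<and>
    E \<in> full_rank_mats n l \<and> s \<noteq> 0 \<and> F \<in> full_rank_mats n k \<and> t \<noteq> 0)"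
  by (auto simp: prod_variety_def XX_def)

lemma proj_pair: "proj (XX n l \<times>\<^sub>V XX n k) ((E, s), (F, t)) = ((colspan n E, s), (colspan n F, t))"
  by (simp add: prod_variety_def XX_def)

lemma rfm_pair:
  shows "rfm (XX n l \<times>\<^sub>V XX n k) U n l (\<lambda>a. fst (fst a))" and "rfm (XX n l \<times>\<^sub>V XX n k) U n k (\<lambda>a. fst (snd a))"
    and "rf (XX n l \<times>\<^sub>V XX n k) U (\<lambda>a. snd (fst a))" and "rf (XX n l \<times>\<^sub>V XX n k) U (\<lambda>a. snd (snd a))"
proof -
  let ?V = "XX n l \<times>\<^sub>V XX n k"
  have c: "(\<lambda>a. c (fst a)) \<in> coords ?V" if "c \<in> coords (XX n l)" for c
    using that by (auto simp: prod_variety_def comp_def)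
  have d: "(\<lambda>a. c (snd a)) \<in> coords ?V" if "c \<in> coords (XX n k)" for c
    using that by (auto simp: prod_variety_def comp_def)
  have e: "(\<lambda>a. fst a $$ (i, j)) \<in> coords (XX n m)" if "i < n" "j < m" for i j m
    using that by (auto simp: XX_def case_prod_beta')
  have f: "snd \<in> coords (XX n m)" for m by (auto simp: XX_def case_prod_beta' fun_eq_iff)
  show "rf ?V U (\<lambda>a. snd (fst a))" "rf ?V U (\<lambda>a. snd (snd a))" using c[OF f] d[OF f] by (auto intro: rf_coord)
  show "rfm ?V U n l (\<lambda>a. fst (fst a))" "rfm ?V U n k (\<lambda>a. fst (snd a))"
    unfolding rfm_def using c[OF e] d[OF e] by (auto simp: frames_pair full_rank_mats_iff intro!: rf_coord)
qed

lemma open_good_pairs: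
  assumes l: "0 < l" "l < n" and k: "0 < k" "k < n"
  shows "openin (zariski (XX n l \<times>\<^sub>V XX n k)) (good_pairs n l k)"
proof -
  let ?V = "XX n l \<times>\<^sub>V XX n k"
  have "openin (zariski ?V) {x \<in> points ?V. x \<in> good_pairs n l k}"
  proof (rule open_rf_nonzero[OF open_points])
    show "rf ?V (points ?V) (\<lambda>a. good_minors n l (fst (fst a)) * good_minors n k (fst (snd a)))"
      by (intro rf_mult rf_good_minors rfm_pair l k)
    fix a assume "a \<in> frames ?V"
    then obtain E s F t where "a = ((E, s), (F, t))" "E \<in> full_rank_mats n l" "s \<noteq> 0" "F \<in> full_rank_mats n k" "t \<noteq> 0"
      unfolding frames_pair by auto
    then show "proj ?V a \<in> good_pairs n l k \<longleftrightarrow> good_minors n l (fst (fst a)) * good_minors n k (fst (snd a)) \<noteq> 0"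
      using g_of_g_frame_iff l k by (auto simp: proj_pair good_pairs_def)
  qed
  moreover have "{x \<in> points ?V. x \<in> good_pairs n l k} = good_pairs n l k"
    unfolding points_prod good_pairs_def using g_of_points l k by auto
  ultimately show ?thesis by simp
qed

text \<open>The first component always exists as a subspace; the R-matrix is defined as soon as its window
  minors do not vanish.\<close>

lemma R_rel_frames:
  assumes l: "0 < l" "l < n" and k: "0 < k" "k < n"
    and E: "E \<in> full_rank_mats n l" "s \<noteq> 0" and F: "F \<in> full_rank_mats n k" "t \<noteq> 0"
    and gE: "good_minors n l E \<noteq> 0" and gF: "good_minors n k F \<noteq> 0" and ne: "lam l s \<noteq> lam k t"
  defines "a \<equiv> ((E, s), (F, t))"
  shows "R_frame1 n l k a \<in> full_rank_mats n k"
    and "(\<exists>q. R_rel n l k (proj (XX n l \<times>\<^sub>V XX n k) a) q) \<longleftrightarrow> good_minors n k (R_frame1 n l k a) \<noteq> 0"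
    and "R_rel n l k (proj (XX n l \<times>\<^sub>V XX n k) a) q \<Longrightarrow>
      q = ((colspan n (R_frame1 n l k a), t), (colspan n (R_frame2 n l k a), s)) \<and>
      R_frame2 n l k a \<in> full_rank_mats n l"
proof -
  let ?A = "g_frame n l E s" and ?B = "g_frame n k F t" and ?C = "R_frame1 n l k a" and ?D = "R_frame2 n l k a"
  let ?x = "(colspan n E, s)" and ?y = "(colspan n F, t)"
  have pa: "proj (XX n l \<times>\<^sub>V XX n k) a = (?x, ?y)" by (simp add: a_def proj_pair)
  have x: "g_of n l ?x ?A" and y: "g_of n k ?y ?B" using g_of_g_frame_iff E F gE gF l k by auto
  have AC: "?A \<in> carrier_mat n n" using x by (rule g_of_carrier)
  have BC: "?B \<in> carrier_mat n n" using y by (rule g_of_carrier)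
  have dA: "det (ev (lam k t) ?A) \<noteq> 0" using g_det_nonzero[OF x l, of "lam k t"] ne by simp
  have Ce: "?C = ev (lam k t) ?A * F" by (simp add: R_frame1_def a_def)
  note fc = product_first_cols[OF AC dA y F(1) k, folded Ce]
  show Cf: "?C \<in> full_rank_mats n k" by (rule fc(3))
  have factor: "R_rel n l k (?x, ?y) ((colspan n ?C, t), (colspan n ?D, s)) \<and> ?D \<in> full_rank_mats n l"
    if gC: "good_minors n k ?C \<noteq> 0"
  proof -
    let ?A' = "g_frame n k ?C t"
    have x': "g_of n k (colspan n ?C, t) ?A'" using g_of_g_frame_iff[OF Cf F(2) k] gC by simp
    obtain B' where B': "?A * ?B = ?A' * B'" "g_of n l (colspan n (adj_mat (ev (lam l s) ?A') * E), s) B'"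
      by (rule g_factor[OF x y E(1) F(1) l k ne x'[unfolded Ce], folded Ce])
    have De: "?D = adj_mat (ev (lam l s) ?A') * E" by (simp add: R_frame2_def a_def)
    have "R_rel n l k (?x, ?y) ((colspan n ?C, t), (colspan n ?D, s))"
      unfolding De using ne by (intro R_relI[OF x y x' B'(2,1)]) auto
    moreover have "?D \<in> full_rank_mats n l"
    proof -
      let ?a = "ev (lam l s) ?A'"
      have aC: "?a \<in> carrier_mat n n" using g_of_carrier[OF x'] by simp
      have "det ?a \<noteq> 0" using g_det_nonzero[OF x' k, of "lam l s"] ne by simp
      moreover have "det (adj_mat ?a) * det ?a = det ?a ^ n"
        using det_mult[OF adj_mat(1)[OF aC] aC] unfolding adj_mat(3)[OF aC] by simp
      ultimately have "det (adj_mat ?a) \<noteq> 0" by auto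
      then show ?thesis unfolding De by (rule full_rank_left_mult[OF E(1) adj_mat(1)[OF aC]])
    qed
    ultimately show ?thesis by simp
  qed
  have necessary: "good_minors n k ?C \<noteq> 0" if R: "R_rel n l k (?x, ?y) q" for q
  proof -
    obtain x' y' where q: "q = (x', y')" by (metis prod.exhaust)
    from R[unfolded q] obtain A B A' B' where x1: "g_of n l ?x A" and y1: "g_of n k ?y B" and x': "g_of n k x' A'" and y': "g_of n l y' B'"
      and eq: "A * B = A' * B'" and s: "snd x' = snd ?y" "snd y' = snd ?x" by (rule R_relE) blast
    have AB: "A = ?A" "B = ?B" using g_of_unique[OF l x1 x] g_of_unique[OF k y1 y] by auto
    have ne': "lam l (snd ?x) \<noteq> lam k (snd ?y)" using ne by simp
    have "Psi n k l (?x, ?y) = Some x'" by (rule Psi_eqI[OF x1 y1 x' l k g_of_carrier[OF y'] eq s(1) ne'])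
    moreover have "Psi n k l (?x, ?y) = Some (colspan n ?C, t)"
    proof -
      have "g_mat n l ?x = Some ?A" "g_mat n k ?y = Some ?B" using x y l k by (auto simp: g_of_iff)
      then show ?thesis
        using fc(1,2) mult_carrier_mat[OF AC BC] k by (simp add: Psi_def pi_map_first_cols)
    qed
    ultimately have "x' = (colspan n ?C, t)" by simp
    then show ?thesis using x' g_of_g_frame_iff[OF Cf F(2) k] by simp
  qed
  show "(\<exists>q. R_rel n l k (proj (XX n l \<times>\<^sub>V XX n k) a) q) \<longleftrightarrow> good_minors n k ?C \<noteq> 0"
    unfolding pa using factor necessary by blast
  assume "R_rel n l k (proj (XX n l \<times>\<^sub>V XX n k) a) q"
  then show "q = ((colspan n ?C, t), (colspan n ?D, s)) \<and> ?D \<in> full_rank_mats n l"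
    unfolding pa using factor necessary R_rel_functional[OF _ _ l k] by metis
qed

lemma R_liftable:
  assumes l: "0 < l" "l < n" and k: "0 < k" "k < n"
  shows "liftable (XX n l \<times>\<^sub>V XX n k) (XX n k \<times>\<^sub>V XX n l) (R_dom n l k) (the \<circ> geo_R n l k)"
proof -
  let ?V = "XX n l \<times>\<^sub>V XX n k" and ?W = "XX n k \<times>\<^sub>V XX n l"
  define U0 where "U0 = {p \<in> good_pairs n l k. lam l (snd (fst p)) \<noteq> lam k (snd (snd p))}"
  have rlam: "rf ?V U (\<lambda>a. lam k (snd (snd a)))" "rf ?V U (\<lambda>a. lam l (snd (fst a)))" for U
    unfolding lam_def by (intro rf_mult rf_const rfm_pair)+
  have U0: "openin (zariski ?V) U0" unfolding U0_def
  proof (rule open_rf_nonzero[OF open_good_pairs[OF l k]])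
    show "rf ?V (good_pairs n l k) (\<lambda>a. lam l (snd (fst a)) - lam k (snd (snd a)))"
      by (intro rf_diff rlam)
    fix a assume "a \<in> frames ?V"
    then show "lam l (snd (fst (proj ?V a))) \<noteq> lam k (snd (snd (proj ?V a))) \<longleftrightarrow> lam l (snd (fst a)) - lam k (snd (snd a)) \<noteq> 0"
      unfolding frames_pair by (auto simp: proj_pair)
  qed
  have frame: "\<exists>E s F t. a = ((E, s), (F, t)) \<and> E \<in> full_rank_mats n l \<and> s \<noteq> 0 \<and> F \<in> full_rank_mats n k \<and> t \<noteq> 0 \<and>
      good_minors n l E \<noteq> 0 \<and> good_minors n k F \<noteq> 0 \<and> lam l s \<noteq> lam k t"
    if a: "a \<in> frames ?V" "proj ?V a \<in> U0" for a
  proof -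
    obtain E s F t where *: "a = ((E, s), (F, t))" "E \<in> full_rank_mats n l" "s \<noteq> 0" "F \<in> full_rank_mats n k" "t \<noteq> 0"
      using a(1) unfolding frames_pair by auto
    then show ?thesis using a(2) g_of_g_frame_iff l k by (auto simp: U0_def good_pairs_def proj_pair)
  qed
  have C0: "rfm ?V U0 n k (R_frame1 n l k)"
  proof -
    have "rfm ?V U0 n k (\<lambda>a. ev (lam k (snd (snd a))) (g_frame n l (fst (fst a)) (snd (fst a))) * fst (snd a))"
      by (intro rfm_mult[where m = n] rfm_ev_g_frame rfm_pair rlam l) (use frame in fastforce)
    then show ?thesis by (simp add: R_frame1_def case_prod_beta' rfm_def)
  qed
  have sub: "R_dom n l k \<subseteq> U0"
  proof
    fix p assume "p \<in> R_dom n l k"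
    then obtain q where q: "R_rel n l k p q" unfolding R_dom_def by blast
    obtain x y x' y' where pq: "p = (x, y)" "q = (x', y')" by (metis prod.exhaust)
    from q[unfolded pq] show "p \<in> U0" by (rule R_relE) (auto simp: U0_def good_pairs_def pq)
  qed
  then have dom: "R_dom n l k = {p \<in> U0. p \<in> R_dom n l k}" by blast
  have open_dom: "openin (zariski ?V) (R_dom n l k)"
  proof (subst dom, rule open_rf_nonzero[OF U0])
    show "rf ?V U0 (\<lambda>a. good_minors n k (R_frame1 n l k a))" by (rule rf_good_minors[OF C0 k])
    fix a assume a: "a \<in> frames ?V" "proj ?V a \<in> U0"
    then obtain E s F t where *: "a = ((E, s), (F, t))" "E \<in> full_rank_mats n l" "s \<noteq> 0" "F \<in> full_rank_mats n k" "t \<noteq> 0"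
      "good_minors n l E \<noteq> 0" "good_minors n k F \<noteq> 0" "lam l s \<noteq> lam k t" using frame by blast
    show "proj ?V a \<in> R_dom n l k \<longleftrightarrow> good_minors n k (R_frame1 n l k a) \<noteq> 0"
      unfolding R_dom_def mem_Collect_eq using R_rel_frames(2)[OF l k *(2-8)] unfolding *(1) .
  qed
  have C: "rfm ?V (R_dom n l k) n k (R_frame1 n l k)"
    using C0 sub rf_subset[OF _ sub] unfolding rfm_def by blast
  have on_dom: "good_minors n k (R_frame1 n l k a) \<noteq> 0 \<and> R_frame1 n l k a \<in> full_rank_mats n k \<and> R_frame2 n l k a \<in> full_rank_mats n l \<and>
      geo_R n l k (proj ?V a) = Some ((colspan n (R_frame1 n l k a), snd (snd a)), (colspan n (R_frame2 n l k a), snd (fst a)))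
      \<and> snd (fst a) \<noteq> 0 \<and> snd (snd a) \<noteq> 0"
    if a: "a \<in> frames ?V" "proj ?V a \<in> R_dom n l k" for a
  proof -
    have aU: "proj ?V a \<in> U0" using a sub by auto
    obtain E s F t where *: "a = ((E, s), (F, t))" "E \<in> full_rank_mats n l" "s \<noteq> 0" "F \<in> full_rank_mats n k" "t \<noteq> 0"
      "good_minors n l E \<noteq> 0" "good_minors n k F \<noteq> 0" "lam l s \<noteq> lam k t" using frame[OF a(1) aU] by blast
    obtain q where q: "R_rel n l k (proj ?V a) q" using a unfolding R_dom_def by blast
    note rr = R_rel_frames[OF l k *(2-8), folded *(1)]
    show ?thesis using rr(1) rr(2) rr(3)[OF q] q geo_R_eqI[OF q l k] *(1,3,5) by auto
  qed
  have D: "rfm ?V (R_dom n l k) n l (R_frame2 n l k)"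
  proof -
    have "rfm ?V (R_dom n l k) n l (\<lambda>a. adj_mat (ev (lam l (snd (fst a))) (g_frame n k (R_frame1 n l k a) (snd (snd a)))) * fst (fst a))"
      by (intro rfm_mult[where m = n] rfm_adj rfm_ev_g_frame C rfm_pair rlam k) (use on_dom in blast)
    then show ?thesis by (simp add: R_frame2_def case_prod_beta' rfm_def)
  qed
  have "lifts ?V ?W (R_dom n l k) (the \<circ> geo_R n l k)
    (\<lambda>a. ((R_frame1 n l k a, snd (snd a)), (R_frame2 n l k a, snd (fst a))))"
    unfolding lifts_def
  proof (intro conjI ballI impI)
    fix a assume a: "a \<in> frames ?V" "proj ?V a \<in> R_dom n l k"
    show "((R_frame1 n l k a, snd (snd a)), (R_frame2 n l k a, snd (fst a))) \<in> frames ?W"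
      unfolding frames_pair using on_dom[OF a] by auto
    show "proj ?W ((R_frame1 n l k a, snd (snd a)), (R_frame2 n l k a, snd (fst a))) = (the \<circ> geo_R n l k) (proj ?V a)"
      unfolding proj_pair using on_dom[OF a] by simp
  next
    fix c assume "c \<in> coords ?W"
    then consider (1) i j where "i < n" "j < k" "c = (\<lambda>a. fst (fst a) $$ (i, j))"
      | (2) "c = (\<lambda>a. snd (fst a))" | (3) i j where "i < n" "j < l" "c = (\<lambda>a. fst (snd a) $$ (i, j))"
      | (4) "c = (\<lambda>a. snd (snd a))"
      by (auto simp: prod_variety_def XX_def case_prod_beta' comp_def)
    then show "rf ?V (R_dom n l k) (\<lambda>a. c ((R_frame1 n l k a, snd (snd a)), (R_frame2 n l k a, snd (fst a))))"
      using C D rfm_pair(3,4) unfolding rfm_def by cases auto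
  qed
  then show ?thesis unfolding liftable_def using open_dom by blast
qed

lemma open_act_ok:
  assumes l: "0 < l" "l < n" and k: "0 < k" "k < n" and i: "i < n"
  shows "openin (zariski (XX n l \<times>\<^sub>V XX n k)) {(x, y). \<exists>A B. g_of n l x A \<and> g_of n k y B \<and> act_ok n i c A B}"
proof -
  let ?V = "XX n l \<times>\<^sub>V XX n k" and ?U = "good_pairs n l k"
  let ?A = "\<lambda>a. g_frame n l (fst (fst a)) (snd (fst a))" and ?B = "\<lambda>a. g_frame n k (fst (snd a)) (snd (snd a))"
  have p: "prev n i < n" by (rule prev_less[OF i])
  have frame: "good_minors n l (fst (fst a)) \<noteq> 0 \<and> good_minors n k (fst (snd a)) \<noteq> 0 \<and>
      (\<forall>A B. g_of n l (fst (proj ?V a)) A \<and> g_of n k (snd (proj ?V a)) B \<longleftrightarrow> A = ?A a \<and> B = ?B a)"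
    if a: "a \<in> frames ?V" "proj ?V a \<in> ?U" for a
  proof -
    obtain E s F t where *: "a = ((E, s), (F, t))" "E \<in> full_rank_mats n l" "s \<noteq> 0" "F \<in> full_rank_mats n k" "t \<noteq> 0"
      using a(1) unfolding frames_pair by auto
    then show ?thesis using a(2) g_of_g_frame_iff l k by (auto simp: good_pairs_def proj_pair)
  qed
  have rA: "rf ?V ?U (\<lambda>a. coeff (?A a $$ (r, s)) m)" and rB: "rf ?V ?U (\<lambda>a. coeff (?B a $$ (r, s)) m)"
    if "r < n" "s < n" for r s m
    using that frame l k by (auto intro!: rf_g_frame_coeff rfm_pair)
  have "openin (zariski ?V) {p \<in> ?U. \<exists>A B. g_of n l (fst p) A \<and> g_of n k (snd p) B \<and> act_ok n i c A B}"
  proof (rule open_rf_nonzero[OF open_good_pairs[OF l k]])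
    show "rf ?V ?U (\<lambda>a. sub n (?A a) i * sub n (?B a) i *
      (sub n (?A a) i * dg (?B a) (prev n i) + dg (?A a) i * sub n (?B a) i) *
      (c * (sub n (?A a) i * dg (?B a) (prev n i)) + dg (?A a) i * sub n (?B a) i))"
      unfolding sub_def dg_def by (intro rf_mult rf_add rf_const rA rB i p)
    fix a assume a: "a \<in> frames ?V" "proj ?V a \<in> ?U"
    show "(\<exists>A B. g_of n l (fst (proj ?V a)) A \<and> g_of n k (snd (proj ?V a)) B \<and> act_ok n i c A B) \<longleftrightarrow>
      sub n (?A a) i * sub n (?B a) i *
      (sub n (?A a) i * dg (?B a) (prev n i) + dg (?A a) i * sub n (?B a) i) *
      (c * (sub n (?A a) i * dg (?B a) (prev n i)) + dg (?A a) i * sub n (?B a) i) \<noteq> 0"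
    proof -
      have eq: "g_of n l (fst (proj ?V a)) A \<and> g_of n k (snd (proj ?V a)) B \<and> act_ok n i c A B \<longleftrightarrow>
          A = ?A a \<and> B = ?B a \<and> act_ok n i c A B" for A B using frame[OF a] by blast
      show ?thesis unfolding eq by (auto simp: act_ok_def)
    qed
  qed
  moreover have "{p \<in> ?U. \<exists>A B. g_of n l (fst p) A \<and> g_of n k (snd p) B \<and> act_ok n i c A B} =
      {(x, y). \<exists>A B. g_of n l x A \<and> g_of n k y B \<and> act_ok n i c A B}"
    unfolding good_pairs_def by fastforce
  ultimately show ?thesis by simp
qed

section \<open>The R-matrix as an isomorphism of geometric crystals\<close>

lemma liftable_cong: "liftable V W U f \<Longrightarrow> (\<And>x. x \<in> U \<Longrightarrow> g x = f x) \<Longrightarrow> liftable V W U g"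
  unfolding liftable_def lifts_def by metis

lemma liftable_comp_into:
  assumes f: "liftable V W U f" and g: "liftable W X U' g" and into: "\<And>x. x \<in> U \<Longrightarrow> f x \<in> U'"
  shows "liftable V X U (\<lambda>x. g (f x))"
proof -
  have "{x \<in> U. f x \<in> U'} = U" using into by auto
  then show ?thesis using liftable_comp[OF f g] by simp
qed

lemma rat_eqI:
  assumes "openin (zariski V) U" "x0 \<in> U" "\<And>x. x \<in> U \<Longrightarrow> \<exists>y. f x = Some y \<and> g x = Some y"
  shows "rat_eq V f g"
  unfolding rat_eq_def
proof (intro exI[of _ U] conjI)
  show "U \<subseteq> dom f" "U \<subseteq> dom g" using assms(3) by (auto simp: dom_def)
  show "\<forall>x\<in>U. f x = g x"
  proof
    fix x assume "x \<in> U"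
    then obtain y where "f x = Some y" "g x = Some y" using assms(3) by blast
    then show "f x = g x" by simp
  qed
qed (use assms in auto)

text \<open>Two points fixed by the shift have commuting matrices, so the R-matrix just exchanges them;
  scaling the eigenvalues of one of them avoids any given degeneracy.\<close>

lemma generic_fixed_pair:
  assumes l: "0 < l" "l < n" and k: "0 < k" "k < n" and c: "c \<noteq> 0"
  obtains x y A B where "g_of n l x A" "g_of n k y B" "R_rel n l k (x, y) (y, x)"
    "\<And>i. i < n \<Longrightarrow> act_ok n i c A B" "\<And>i. i < n \<Longrightarrow> act_ok n i c B A"
proof -
  obtain \<kappa> b where \<kappa>: "\<kappa> \<noteq> 0" and b: "b \<noteq> 0" and
    e1: "\<And>\<alpha> i. \<alpha> \<noteq> 0 \<Longrightarrow> i < n \<Longrightarrow> dg (circulant n (fixed_coeff n l \<alpha>)) i = \<alpha> ^ (n - l) * b"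
    "\<And>\<alpha> i. \<alpha> \<noteq> 0 \<Longrightarrow> i < n \<Longrightarrow> sub n (circulant n (fixed_coeff n l \<alpha>)) i = \<alpha> ^ (n - l) * b * \<kappa> / \<alpha>"
    by (rule fixed_point_entries[OF l]) auto
  obtain \<mu> d where \<mu>: "\<mu> \<noteq> 0" and d: "d \<noteq> 0" and
    e2: "\<And>\<alpha> i. \<alpha> \<noteq> 0 \<Longrightarrow> i < n \<Longrightarrow> dg (circulant n (fixed_coeff n k \<alpha>)) i = \<alpha> ^ (n - k) * d"
    "\<And>\<alpha> i. \<alpha> \<noteq> 0 \<Longrightarrow> i < n \<Longrightarrow> sub n (circulant n (fixed_coeff n k \<alpha>)) i = \<alpha> ^ (n - k) * d * \<mu> / \<alpha>"
    by (rule fixed_point_entries[OF k]) auto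
  define N where "N = 2 + cmod (\<mu> / \<kappa>) + cmod (\<mu> / (c * \<kappa>)) + cmod (c * \<mu> / \<kappa>)"
  define \<beta> where "\<beta> = complex_of_real N"
  have N: "N > 1" "N > cmod (\<mu> / \<kappa>)" "N > cmod (\<mu> / (c * \<kappa>))" "N > cmod (c * \<mu> / \<kappa>)"
    unfolding N_def by (smt (verit) norm_ge_zero)+
  have nb: "cmod \<beta> = N" using N(1) by (simp add: \<beta>_def)
  have \<beta>: "\<beta> \<noteq> 0" using N(1) by (simp add: \<beta>_def)
  have avoid: "u * \<beta> + v \<noteq> 0" if "u \<noteq> 0" "cmod (v / u) < N" for u v
  proof
    assume "u * \<beta> + v = 0"
    then have "\<beta> = - (v / u)" using that by (simp add: field_simps eq_neg_iff_add_eq_0)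
    then have "cmod \<beta> = cmod (v / u)" by (metis norm_minus_cancel)
    then show False using that nb by simp
  qed
  have a1: "\<kappa> * \<beta> + \<mu> \<noteq> 0" by (rule avoid[OF \<kappa> N(2)])
  have a2: "(c * \<kappa>) * \<beta> + \<mu> \<noteq> 0" by (rule avoid[OF _ N(3)]) (use c \<kappa> in simp)
  have a3: "\<kappa> * \<beta> + c * \<mu> \<noteq> 0" by (rule avoid[OF \<kappa> N(4)])
  let ?A = "circulant n (fixed_coeff n l 1)" and ?B = "circulant n (fixed_coeff n k \<beta>)"
  obtain x where x: "g_of n l x ?A" "lam l (snd x) = 1 ^ n" by (rule fixed_point[OF l, of 1]) auto
  obtain y where y: "g_of n k y ?B" "lam k (snd y) = \<beta> ^ n" by (rule fixed_point[OF k \<beta>])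
  have "cmod (\<beta> ^ n) > 1" unfolding norm_power nb using N(1) l by (simp add: one_less_power)
  then have ne: "lam l (snd x) \<noteq> lam k (snd y)" unfolding x y by (metis norm_one less_irrefl power_one)
  define e where "e = \<beta> ^ (n - k) * d"
  have en: "e \<noteq> 0" using \<beta> d by (simp add: e_def)
  have va: "dg ?A i = b" "sub n ?A i = b * \<kappa>" if "i < n" for i using e1[OF _ that, of 1] by auto
  have vb: "dg ?B i = e" "sub n ?B i = e * \<mu> / \<beta>" if "i < n" for i using e2[OF \<beta> that] by (auto simp: e_def)
  have R: "R_rel n l k (x, y) (y, x)"
    by (rule R_relI[OF x(1) y(1) y(1) x(1) circulant_commute]) (use ne in auto)
  show ?thesis
  proof (rule that[OF x(1) y(1) R])
    fix i assume i: "i < n"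
    note v = va[OF i] vb[OF i] va(1)[OF prev_less[OF i]] vb(1)[OF prev_less[OF i]]
    have s1: "b * \<kappa> * e + b * (e * \<mu> / \<beta>) = b * e * (\<kappa> * \<beta> + \<mu>) / \<beta>" using \<beta> by (simp add: field_simps)
    have s2: "c * (b * \<kappa> * e) + b * (e * \<mu> / \<beta>) = b * e * ((c * \<kappa>) * \<beta> + \<mu>) / \<beta>" using \<beta> by (simp add: field_simps)
    have s3: "e * \<mu> / \<beta> * b + e * (b * \<kappa>) = b * e * (\<kappa> * \<beta> + \<mu>) / \<beta>" using \<beta> by (simp add: field_simps)
    have s4: "c * (e * \<mu> / \<beta> * b) + e * (b * \<kappa>) = b * e * (\<kappa> * \<beta> + c * \<mu>) / \<beta>" using \<beta> by (simp add: field_simps)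
    show "act_ok n i c ?A ?B" unfolding act_ok_def v s1 s2 using b en \<kappa> \<mu> \<beta> a1 a2 by simp
    show "act_ok n i c ?B ?A" unfolding act_ok_def v s3 s4 using b en \<kappa> \<mu> \<beta> a1 a3 by simp
  qed
qed

lemma R_dom_nonempty:
  assumes l: "0 < l" "l < n" and k: "0 < k" "k < n"
  obtains p where "p \<in> R_dom n l k"
proof -
  obtain x y where "R_rel n l k (x, y) (y, x)" by (rule generic_fixed_pair[OF l k, of 1]) auto
  then show ?thesis using that unfolding R_dom_def by blast
qed

lemma open_R_dom: "0 < l \<Longrightarrow> l < n \<Longrightarrow> 0 < k \<Longrightarrow> k < n \<Longrightarrow> openin (zariski (XX n l \<times>\<^sub>V XX n k)) (R_dom n l k)"
  using R_liftable unfolding liftable_def by blast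

definition crystal_dom :: "nat \<Rightarrow> nat \<Rightarrow> nat \<Rightarrow> nat \<Rightarrow> complex \<Rightarrow> (point \<times> point) set" where
  "crystal_dom n l k i c = {p \<in> R_dom n l k.
     p \<in> {(x, y). \<exists>A B. g_of n l x A \<and> g_of n k y B \<and> act_ok n i c A B} \<and>
     (the \<circ> geo_R n l k) p \<in> {(x, y). \<exists>A B. g_of n k x A \<and> g_of n l y B \<and> act_ok n i c A B}}"

lemma open_crystal_dom:
  assumes l: "0 < l" "l < n" and k: "0 < k" "k < n" and i: "i < n"
  shows "openin (zariski (XX n l \<times>\<^sub>V XX n k)) (crystal_dom n l k i c)"
proof -
  define P where "P = {(x, y). \<exists>A B. g_of n l x A \<and> g_of n k y B \<and> act_ok n i c A B}"
  define Q where "Q = {(x, y). \<exists>A B. g_of n k x A \<and> g_of n l y B \<and> act_ok n i c A B}"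
  have e: "crystal_dom n l k i c = P \<inter> {p \<in> R_dom n l k. (the \<circ> geo_R n l k) p \<in> Q}"
    unfolding crystal_dom_def P_def[symmetric] Q_def[symmetric] by blast
  have P: "openin (zariski (XX n l \<times>\<^sub>V XX n k)) P" unfolding P_def by (rule open_act_ok[OF l k i])
  have Q: "openin (zariski (XX n k \<times>\<^sub>V XX n l)) Q" unfolding Q_def by (rule open_act_ok[OF k l i])
  show ?thesis unfolding e by (rule openin_Int[OF P liftable_preimage_open[OF R_liftable[OF l k] Q]])
qed

lemma crystal_dom_nonempty:
  assumes l: "0 < l" "l < n" and k: "0 < k" "k < n" and i: "i < n" and c: "c \<noteq> 0"
  obtains p where "p \<in> crystal_dom n l k i c"
proof -
  obtain x y A B where "g_of n l x A" "g_of n k y B" and R: "R_rel n l k (x, y) (y, x)"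
    and "act_ok n i c A B" "act_ok n i c B A" using generic_fixed_pair[OF l k c] i by metis
  moreover have "geo_R n l k (x, y) = Some (y, x)" by (rule geo_R_eqI[OF R l k])
  moreover have "(x, y) \<in> R_dom n l k" using R unfolding R_dom_def by blast
  ultimately have "(x, y) \<in> crystal_dom n l k i c" unfolding crystal_dom_def by auto
  then show ?thesis using that by blast
qed

lemma crystal_domE:
  assumes p: "p \<in> crystal_dom n l k i c" and l: "0 < l" "l < n" and k: "0 < k" "k < n"
  obtains x y x' y' A B A' B' where "p = (x, y)" "geo_R n l k (x, y) = Some (x', y')"
    "g_of n l x A" "g_of n k y B" "g_of n k x' A'" "g_of n l y' B'" "A * B = A' * B'"
    "snd x' = snd y" "snd y' = snd x" "lam l (snd x) \<noteq> lam k (snd y)"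
    "act_ok n i c A B" "act_ok n i c A' B'"
proof -
  obtain x y where pxy: "p = (x, y)" by (metis prod.exhaust)
  obtain q where q: "R_rel n l k p q" using p unfolding crystal_dom_def R_dom_def by blast
  obtain x' y' where qxy: "q = (x', y')" by (metis prod.exhaust)
  have geo: "geo_R n l k p = Some q" by (rule geo_R_eqI[OF q l k])
  from q[unfolded pxy qxy] obtain A B A' B' where g: "g_of n l x A" "g_of n k y B" "g_of n k x' A'" "g_of n l y' B'"
    and r: "A * B = A' * B'" "snd x' = snd y" "snd y' = snd x" "lam l (snd x) \<noteq> lam k (snd y)" by (rule R_relE)
  obtain A1 B1 where 1: "g_of n l x A1" "g_of n k y B1" "act_ok n i c A1 B1"
    using p unfolding crystal_dom_def pxy by auto
  obtain A2 B2 where 2: "g_of n k x' A2" "g_of n l y' B2" "act_ok n i c A2 B2"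
    using p geo unfolding crystal_dom_def pxy qxy by auto
  have "A1 = A" "B1 = B" "A2 = A'" "B2 = B'"
    using g_of_unique[OF l 1(1) g(1)] g_of_unique[OF k 1(2) g(2)] g_of_unique[OF k 2(1) g(3)] g_of_unique[OF l 2(2) g(4)]
    by auto
  then show ?thesis using that[OF pxy _ g r] geo 1 2 pxy qxy by auto
qed

lemma rat_eq_on_crystal_dom:
  assumes l: "0 < l" "l < n" and k: "0 < k" "k < n" and i: "i < n" and c: "c \<noteq> 0"
    and eq: "\<And>x y x' y' A B A' B'. geo_R n l k (x, y) = Some (x', y') \<Longrightarrow>
      g_of n l x A \<Longrightarrow> g_of n k y B \<Longrightarrow> g_of n k x' A' \<Longrightarrow> g_of n l y' B' \<Longrightarrow> A * B = A' * B' \<Longrightarrow>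
      snd x' = snd y \<Longrightarrow> snd y' = snd x \<Longrightarrow> lam l (snd x) \<noteq> lam k (snd y) \<Longrightarrow>
      act_ok n i c A B \<Longrightarrow> act_ok n i c A' B' \<Longrightarrow> \<exists>z. f (x, y) = Some z \<and> g (x, y) = Some z"
  shows "rat_eq (XX n l \<times>\<^sub>V XX n k) f g"
proof -
  obtain p0 where p0: "p0 \<in> crystal_dom n l k i c" by (rule crystal_dom_nonempty[OF l k i c])
  show ?thesis
  proof (rule rat_eqI[OF open_crystal_dom[OF l k i] p0])
    fix p assume p: "p \<in> crystal_dom n l k i c"
    obtain x y x' y' A B A' B' where pe: "p = (x, y)" and r: "geo_R n l k (x, y) = Some (x', y')"
      "g_of n l x A" "g_of n k y B" "g_of n k x' A'" "g_of n l y' B'" "A * B = A' * B'"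
      "snd x' = snd y" "snd y' = snd x" "lam l (snd x) \<noteq> lam k (snd y)"
      "act_ok n i c A B" "act_ok n i c A' B'" by (rule crystal_domE[OF p l k])
    show "\<exists>z. f p = Some z \<and> g p = Some z" unfolding pe by (rule eq[OF r])
  qed
qed

lemma R_crystal_morphism:
  assumes l: "0 < l" "l < n" and k: "0 < k" "k < n" and n: "n \<ge> 2"
  shows "crystal_morphism n (XX n l \<times>\<^sub>V XX n k) (X_crystal n l \<times>\<^sub>C X_crystal n k)
    (XX n k \<times>\<^sub>V XX n l) (X_crystal n k \<times>\<^sub>C X_crystal n l) (geo_R n l k)"
  unfolding crystal_morphism_def
proof (intro conjI allI ballI impI)
  let ?V = "XX n l \<times>\<^sub>V XX n k" and ?C = "X_crystal n l \<times>\<^sub>C X_crystal n k" and ?D = "X_crystal n k \<times>\<^sub>C X_crystal n l"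
  show "rational_map ?V (XX n k \<times>\<^sub>V XX n l) (geo_R n l k)"
    unfolding rational_map_def
  proof (intro exI[of _ "R_dom n l k"] conjI)
    show "R_dom n l k \<noteq> {}" using R_dom_nonempty[OF l k] by blast
    show "R_dom n l k \<subseteq> dom (geo_R n l k)" using geo_R_eqI[OF _ l k] unfolding R_dom_def by blast
  qed (use open_R_dom l k liftable_morphism_on[OF R_liftable[OF l k]] in auto)
  show "rat_eq ?V (act ?D i c \<circ>\<^sub>m geo_R n l k) (geo_R n l k \<circ>\<^sub>m act ?C i c)" if i: "i < n" and c: "c \<noteq> 0" for i c
  proof (rule rat_eq_on_crystal_dom[OF l k i c])
    fix x y x' y' A B A' B'
    assume geo: "geo_R n l k (x, y) = Some (x', y')"
      and r: "g_of n l x A" "g_of n k y B" "g_of n k x' A'" "g_of n l y' B'" "A * B = A' * B'"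
        "snd x' = snd y" "snd y' = snd x" "lam l (snd x) \<noteq> lam k (snd y)"
      and ok: "act_ok n i c A B" "act_ok n i c A' B'"
    obtain p' q' where "act ?C i c (x, y) = Some p'" "act ?D i c (x', y') = Some q'" "R_rel n l k p' q'"
      by (rule R_rel_act[OF r l k n i c ok])
    then show "\<exists>q. (act ?D i c \<circ>\<^sub>m geo_R n l k) (x, y) = Some q \<and> (geo_R n l k \<circ>\<^sub>m act ?C i c) (x, y) = Some q"
      using geo geo_R_eqI[OF _ l k] by (intro exI[of _ q']) (simp add: map_comp_def)
  qed
  show "rat_eq ?V (gam ?D i \<circ>\<^sub>m geo_R n l k) (gam ?C i)" if i: "i \<in> {1..n}" for i
  proof -
    obtain r where ir: "i = Suc r" "r < n" using i by (cases i) auto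
    show ?thesis
      by (rule rat_eq_on_crystal_dom[OF l k ir(2) one_neq_zero])
         (use prod_crystal_g_of(1)[OF _ _ l k n ir(2)] prod_crystal_g_of(1)[OF _ _ k l n ir(2)]
          in \<open>auto simp: map_comp_def ir(1)\<close>)
  qed
  show "rat_eq ?V (phi ?D i \<circ>\<^sub>m geo_R n l k) (phi ?C i)" if i: "i < n" for i
    by (rule rat_eq_on_crystal_dom[OF l k i one_neq_zero])
       (use prod_crystal_g_of(2)[OF _ _ l k n i] prod_crystal_g_of(2)[OF _ _ k l n i]
        in \<open>auto simp: map_comp_def act_ok_def\<close>)
  show "rat_eq ?V (eps ?D i \<circ>\<^sub>m geo_R n l k) (eps ?C i)" if i: "i < n" for i
    by (rule rat_eq_on_crystal_dom[OF l k i one_neq_zero])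
       (use prod_crystal_g_of(3)[OF _ _ l k n i] prod_crystal_g_of(3)[OF _ _ k l n i]
        in \<open>auto simp: map_comp_def act_ok_def\<close>)
qed

lemma rat_eq_on_R_dom:
  assumes l: "0 < l" "l < n" and k: "0 < k" "k < n"
    and eq: "\<And>p q. R_rel n l k p q \<Longrightarrow> \<exists>r. f p = Some r \<and> g p = Some r"
  shows "rat_eq (XX n l \<times>\<^sub>V XX n k) f g"
proof -
  obtain p0 where p0: "p0 \<in> R_dom n l k" by (rule R_dom_nonempty[OF l k])
  show ?thesis
    by (rule rat_eqI[OF open_R_dom[OF l k] p0]) (use eq in \<open>auto simp: R_dom_def\<close>)
qed

lemma R_inverse:
  assumes l: "0 < l" "l < n" and k: "0 < k" "k < n"
  shows "rat_eq (XX n l \<times>\<^sub>V XX n k) (geo_R n k l \<circ>\<^sub>m geo_R n l k) Some"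
proof (rule rat_eq_on_R_dom[OF l k])
  fix p q assume R: "R_rel n l k p q"
  show "\<exists>r. (geo_R n k l \<circ>\<^sub>m geo_R n l k) p = Some r \<and> Some p = Some r"
    using geo_R_eqI[OF R l k] geo_R_eqI[OF R_rel_sym[OF R] k l] by (intro exI[of _ p]) (simp add: map_comp_def)
qed

section \<open>The Yang--Baxter relation\<close>

definition R1_dom :: "nat \<Rightarrow> nat \<Rightarrow> nat \<Rightarrow> nat \<Rightarrow> (point \<times> point \<times> point) set" where
  "R1_dom n a b c = {p \<in> points (XX n a \<times>\<^sub>V XX n b \<times>\<^sub>V XX n c). (fst p, fst (snd p)) \<in> R_dom n a b}"

definition R2_dom :: "nat \<Rightarrow> nat \<Rightarrow> nat \<Rightarrow> nat \<Rightarrow> (point \<times> point \<times> point) set" where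
  "R2_dom n a b c = {p \<in> points (XX n a \<times>\<^sub>V XX n b \<times>\<^sub>V XX n c). snd p \<in> R_dom n b c}"

lemma R1_liftable:
  assumes a: "0 < a" "a < n" and b: "0 < b" "b < n"
  shows "liftable (XX n a \<times>\<^sub>V XX n b \<times>\<^sub>V XX n c) (XX n b \<times>\<^sub>V XX n a \<times>\<^sub>V XX n c) (R1_dom n a b c) (the \<circ> geo_R1 n a b)"
proof -
  let ?V = "XX n a \<times>\<^sub>V XX n b \<times>\<^sub>V XX n c"
  define r where "r p = (the \<circ> geo_R n a b) (fst p, fst (snd p))" for p :: "point \<times> point \<times> point"
  have s: "liftable ?V (XX n b) (points ?V) (\<lambda>p. fst (snd p))"
    by (rule liftable_comp_into[OF liftable_snd liftable_fst]) (auto simp: points_prod)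
  have ab: "liftable ?V (XX n a \<times>\<^sub>V XX n b) (points ?V) (\<lambda>p. (fst p, fst (snd p)))"
    by (rule liftable_pair[OF liftable_fst s])
  have R: "liftable ?V (XX n b \<times>\<^sub>V XX n a) (R1_dom n a b c) r"
    unfolding R1_dom_def r_def by (rule liftable_comp[OF ab R_liftable[OF a b]])
  have "liftable ?V (XX n c) (points ?V) (\<lambda>p. snd (snd p))"
    by (rule liftable_comp_into[OF liftable_snd liftable_snd]) (auto simp: points_prod)
  then have z: "liftable ?V (XX n c) (R1_dom n a b c) (\<lambda>p. snd (snd p))"
    by (rule liftable_restrict) (use R in \<open>auto simp: liftable_def R1_dom_def\<close>)
  note r1 = liftable_comp_into[OF R liftable_fst liftable_in_points[OF R]]
  note r2 = liftable_comp_into[OF R liftable_snd liftable_in_points[OF R]]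
  show ?thesis
  proof (rule liftable_cong[OF liftable_pair[OF r1 liftable_pair[OF r2 z]]])
    fix p assume "p \<in> R1_dom n a b c"
    then obtain q where q: "R_rel n a b (fst p, fst (snd p)) q" unfolding R1_dom_def R_dom_def by auto
    obtain x y w where p: "p = (x, y, w)" by (metis prod.exhaust)
    obtain x' y' where qq: "q = (x', y')" by (metis prod.exhaust)
    show "(the \<circ> geo_R1 n a b) p = (fst (r p), snd (r p), snd (snd p))"
      using geo_R_eqI[OF q a b] by (simp add: geo_R1_def r_def p qq)
  qed
qed

lemma R2_liftable:
  assumes b: "0 < b" "b < n" and c: "0 < c" "c < n"
  shows "liftable (XX n a \<times>\<^sub>V XX n b \<times>\<^sub>V XX n c) (XX n a \<times>\<^sub>V XX n c \<times>\<^sub>V XX n b) (R2_dom n a b c) (the \<circ> geo_R2 n b c)"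
proof -
  let ?V = "XX n a \<times>\<^sub>V XX n b \<times>\<^sub>V XX n c"
  define r where "r p = (the \<circ> geo_R n b c) (snd p)" for p :: "point \<times> point \<times> point"
  have R: "liftable ?V (XX n c \<times>\<^sub>V XX n b) (R2_dom n a b c) r"
    unfolding R2_dom_def r_def by (rule liftable_comp[OF liftable_snd R_liftable[OF b c]])
  have x: "liftable ?V (XX n a) (R2_dom n a b c) fst"
    by (rule liftable_restrict[OF liftable_fst]) (use R in \<open>auto simp: liftable_def R2_dom_def\<close>)
  show ?thesis
  proof (rule liftable_cong[OF liftable_pair[OF x R]])
    fix p assume "p \<in> R2_dom n a b c"
    then obtain q where q: "R_rel n b c (snd p) q" unfolding R2_dom_def R_dom_def by auto
    obtain x y w where p: "p = (x, y, w)" by (metis prod.exhaust)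
    obtain x' y' where qq: "q = (x', y')" by (metis prod.exhaust)
    show "(the \<circ> geo_R2 n b c) p = (fst p, r p)"
      using geo_R_eqI[OF q b c] by (simp add: geo_R2_def r_def p qq)
  qed
qed

text \<open>The first factor is the image at its own parameter, where the other factors are invertible.\<close>

lemma first_factor_unique:
  assumes z: "g_of n k z G" and w: "g_of n k w G'" and s: "snd z = snd w" and k: "0 < k" "k < n"
    and M: "M \<in> carrier_mat n n" and M': "M' \<in> carrier_mat n n" and eq: "G * M = G' * M'"
    and d: "det (ev (lam k (snd z)) M) \<noteq> 0"
  shows "z = w" and "M = M'"
proof -
  let ?z = "lam k (snd z)"
  obtain F X where F: "F \<in> full_rank_mats n k" "F \<in> carrier_mat n k" and X: "X \<in> carrier_mat k n"
    and ze: "z = (colspan n F, snd z)" and FX: "ev ?z G = F * X" and dX: "det (first_cols k X) \<noteq> 0"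
    by (rule g_of_frame[OF z k])
  obtain F' X' where F': "F' \<in> carrier_mat n k" and X': "X' \<in> carrier_mat k n"
    and we: "w = (colspan n F', snd w)" and FX': "ev (lam k (snd w)) G' = F' * X'"
    by (rule g_of_frame[OF w k])
  have GC: "G \<in> carrier_mat n n" "G' \<in> carrier_mat n n" using z w by (auto simp: g_of_carrier)
  have eM: "ev ?z M \<in> carrier_mat n n" "ev ?z M' \<in> carrier_mat n n" using M M' by auto
  obtain Y where Y: "Y \<in> carrier_mat n n" "ev ?z M * Y = 1\<^sub>m n" by (rule invertible_of_det[OF eM(1) d])
  note FXC = mult_carrier_mat[OF F(2) X] and XM = mult_carrier_mat[OF X' eM(2)]
  have "F * X * ev ?z M = F' * X' * ev ?z M'"
    using arg_cong[OF eq, of "ev ?z"] FX FX' s by (simp add: ev_mult[OF GC(1) M] ev_mult[OF GC(2) M'])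
  also have "\<dots> = F' * (X' * ev ?z M')" by (rule assoc_mult_mat[OF F' X' eM(2)])
  finally have FXM: "F * X * ev ?z M = F' * (X' * ev ?z M')" .
  have "F * X = F * X * (ev ?z M * Y)" unfolding Y(2) using right_mult_one_mat[OF FXC] by simp
  also have "\<dots> = F * X * ev ?z M * Y" by (rule assoc_mult_mat[symmetric, OF FXC eM(1) Y(1)])
  also have "\<dots> = F' * (X' * ev ?z M' * Y)" unfolding FXM by (rule assoc_mult_mat[OF F' XM Y(1)])
  finally have FF: "F * X = F' * (X' * ev ?z M' * Y)" .
  have XY: "X' * ev ?z M' * Y \<in> carrier_mat k n" using mult_carrier_mat[OF mult_carrier_mat[OF X' eM(2)] Y(1)] .
  have kn: "k \<le> n" using k by simp
  have e: "F * first_cols k X = F' * first_cols k (X' * ev ?z M' * Y)"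
    unfolding first_cols_mult[OF F(2) X kn, symmetric] first_cols_mult[OF F' XY kn, symmetric] FF ..
  have fr: "F * first_cols k X \<in> full_rank_mats n k"
    by (rule full_rank_right_mult[OF F(1) first_cols_carrier[OF X] dX])
  have "colspan n F = colspan n F'"
    using full_rank_factors(3)[OF F(2) first_cols_carrier[OF X] fr]
      full_rank_factors(3)[OF F' first_cols_carrier[OF XY] fr[unfolded e]] e by simp
  then show zw: "z = w" using ze we s by metis
  then have "G = G'" using g_of_unique[OF k z] w by simp
  then show "M = M'" using g_left_cancel[OF z k M M'] eq by simp
qed

text \<open>Peel off the factors from the left, each being determined at its own parameter.\<close>

lemma triple_factorisation_unique:
  assumes k: "0 < a" "a < n" "0 < b" "b < n" "0 < c" "c < n"
    and g: "g_of n c z C" "g_of n b y B" "g_of n a x A"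
    and g': "g_of n c z' C'" "g_of n b y' B'" "g_of n a x' A'"
    and s: "snd z' = snd z" "snd y' = snd y" "snd x' = snd x"
    and ne: "lam c (snd z) \<noteq> lam b (snd y)" "lam c (snd z) \<noteq> lam a (snd x)" "lam b (snd y) \<noteq> lam a (snd x)"
    and eq: "C * (B * A) = C' * (B' * A')"
  shows "z = z'" "y = y'" "x = x'"
proof -
  note AC = g_of_carrier[OF g(1)] g_of_carrier[OF g(2)] g_of_carrier[OF g(3)]
    g_of_carrier[OF g'(1)] g_of_carrier[OF g'(2)] g_of_carrier[OF g'(3)]
  have BA: "B * A \<in> carrier_mat n n" "B' * A' \<in> carrier_mat n n"
    using mult_carrier_mat[OF AC(2,3)] mult_carrier_mat[OF AC(5,6)] by auto
  have "det (ev (lam c (snd z)) B) \<noteq> 0" by (rule g_det_nonzero[OF g(2) k(3,4) ne(1)])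
  moreover have "det (ev (lam c (snd z)) A) \<noteq> 0" by (rule g_det_nonzero[OF g(3) k(1,2) ne(2)])
  ultimately have dBA: "det (ev (lam c (snd z)) (B * A)) \<noteq> 0"
    unfolding ev_mult[OF AC(2,3)] using det_mult[of "ev (lam c (snd z)) B" n "ev (lam c (snd z)) A"] AC by simp
  note 1 = first_factor_unique[OF g(1) g'(1) s(1)[symmetric] k(5,6) BA eq dBA]
  show "z = z'" by (rule 1)
  have dA: "det (ev (lam b (snd y)) A) \<noteq> 0" by (rule g_det_nonzero[OF g(3) k(1,2) ne(3)])
  note 2 = first_factor_unique[OF g(2) g'(2) s(2)[symmetric] k(3,4) AC(3,6) 1(2) dA]
  show "y = y'" by (rule 2)
  show "x = x'" using g_of_unique_point[OF k(1,2) g(3)] g'(3) 2(2) s(3) by simp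
qed

lemma R_relE_dom:
  assumes "(x, y) \<in> R_dom n l k" "0 < l" "l < n" "0 < k" "k < n"
  obtains x' y' where "geo_R n l k (x, y) = Some (x', y')" "R_rel n l k (x, y) (x', y')"
proof -
  obtain q where "R_rel n l k (x, y) q" using assms(1) unfolding R_dom_def by blast
  then show ?thesis using that geo_R_eqI[OF _ assms(2-5)] by (cases q) auto
qed

text \<open>Both sides refactor the product of the three matrices into factors of the opposite order of types,
  and this factorisation is unique. Three points fixed by the shift show that both sides are defined
  on a nonempty open set.\<close>

lemma yang_baxter:
  assumes a: "0 < a" "a < n" and b: "0 < b" "b < n" and c: "0 < c" "c < n"
  shows "rat_eq (XX n a \<times>\<^sub>V XX n b \<times>\<^sub>V XX n c)
           (geo_R1 n b c \<circ>\<^sub>m geo_R2 n a c \<circ>\<^sub>m geo_R1 n a b)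
           (geo_R2 n a b \<circ>\<^sub>m geo_R1 n a c \<circ>\<^sub>m geo_R2 n b c)"
proof -
  let ?V = "XX n a \<times>\<^sub>V XX n b \<times>\<^sub>V XX n c"
  define UL where "UL = {p \<in> R1_dom n a b c. (the \<circ> geo_R1 n a b) p \<in>
      {q \<in> R2_dom n b a c. (the \<circ> geo_R2 n a c) q \<in> R1_dom n b c a}}"
  define UR where "UR = {p \<in> R2_dom n a b c. (the \<circ> geo_R2 n b c) p \<in>
      {q \<in> R1_dom n a c b. (the \<circ> geo_R1 n a c) q \<in> R2_dom n c a b}}"
  have o1: "openin (zariski (XX n i \<times>\<^sub>V XX n j \<times>\<^sub>V XX n m)) (R1_dom n i j m)" if "0 < i" "i < n" "0 < j" "j < n" for i j m
    using R1_liftable[OF that] unfolding liftable_def by blast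
  have o2: "openin (zariski (XX n i \<times>\<^sub>V XX n j \<times>\<^sub>V XX n m)) (R2_dom n i j m)" if "0 < j" "j < n" "0 < m" "m < n" for i j m
    using R2_liftable[OF that] unfolding liftable_def by blast
  have "openin (zariski ?V) UL" unfolding UL_def
    by (rule liftable_preimage_open[OF R1_liftable[OF a b] liftable_preimage_open[OF R2_liftable[OF a c] o1[OF b c]]])
  moreover have "openin (zariski ?V) UR" unfolding UR_def
    by (rule liftable_preimage_open[OF R2_liftable[OF b c] liftable_preimage_open[OF R1_liftable[OF a c] o2[OF a b]]])
  ultimately have open_U: "openin (zariski ?V) (UL \<inter> UR)" by (rule openin_Int)
  obtain x0 where x0: "g_of n a x0 (circulant n (fixed_coeff n a 1))" "lam a (snd x0) = 1 ^ n"
    by (rule fixed_point[OF a, of 1]) auto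
  obtain y0 where y0: "g_of n b y0 (circulant n (fixed_coeff n b 2))" "lam b (snd y0) = 2 ^ n"
    by (rule fixed_point[OF b, of 2]) auto
  obtain z0 where z0: "g_of n c z0 (circulant n (fixed_coeff n c 3))" "lam c (snd z0) = 3 ^ n"
    by (rule fixed_point[OF c, of 3]) auto
  have pw: "(1::real) ^ n < 2 ^ n" "(2::real) ^ n < 3 ^ n" using a by (auto intro: power_strict_mono one_less_power)
  have "cmod (lam a (snd x0)) < cmod (lam b (snd y0))" "cmod (lam b (snd y0)) < cmod (lam c (snd z0))"
    unfolding x0 y0 z0 norm_power using pw by auto
  then have ne: "lam a (snd x0) \<noteq> lam b (snd y0)" "lam a (snd x0) \<noteq> lam c (snd z0)" "lam b (snd y0) \<noteq> lam c (snd z0)"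
    by auto
  have Rxy: "R_rel n a b (x0, y0) (y0, x0)" by (rule R_relI[OF x0(1) y0(1) y0(1) x0(1) circulant_commute]) (use ne in auto)
  have Rxz: "R_rel n a c (x0, z0) (z0, x0)" by (rule R_relI[OF x0(1) z0(1) z0(1) x0(1) circulant_commute]) (use ne in auto)
  have Ryz: "R_rel n b c (y0, z0) (z0, y0)" by (rule R_relI[OF y0(1) z0(1) z0(1) y0(1) circulant_commute]) (use ne in auto)
  note R0 = geo_R_eqI[OF Rxy a b] geo_R_eqI[OF Rxz a c] geo_R_eqI[OF Ryz b c]
  have pts: "x0 \<in> points (XX n a)" "y0 \<in> points (XX n b)" "z0 \<in> points (XX n c)"
    using g_of_points x0(1) y0(1) z0(1) a b c by auto
  have dom0: "(x0, y0) \<in> R_dom n a b" "(x0, z0) \<in> R_dom n a c" "(y0, z0) \<in> R_dom n b c"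
    using Rxy Rxz Ryz unfolding R_dom_def by blast+
  have mem: "(x0, y0, z0) \<in> UL \<inter> UR"
    using pts dom0 R0 by (simp add: UL_def UR_def R1_dom_def R2_dom_def points_prod geo_R1_def geo_R2_def)
  show ?thesis
  proof (rule rat_eqI[OF open_U mem])
    fix p assume p: "p \<in> UL \<inter> UR"
    obtain x y z where pe: "p = (x, y, z)" by (metis prod.exhaust)
    have "(x, y) \<in> R_dom n a b" using p unfolding pe UL_def R1_dom_def by auto
    then obtain y1 x1 where r1: "geo_R n a b (x, y) = Some (y1, x1)" "R_rel n a b (x, y) (y1, x1)" by (rule R_relE_dom[OF _ a b])
    have q1: "geo_R1 n a b p = Some (y1, x1, z)" using r1 by (simp add: pe geo_R1_def)
    have "(x1, z) \<in> R_dom n a c" using p q1 unfolding UL_def R2_dom_def by auto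
    then obtain z1 x2 where r2: "geo_R n a c (x1, z) = Some (z1, x2)" "R_rel n a c (x1, z) (z1, x2)" by (rule R_relE_dom[OF _ a c])
    have q2: "geo_R2 n a c (y1, x1, z) = Some (y1, z1, x2)" using r2 by (simp add: geo_R2_def)
    have "(y1, z1) \<in> R_dom n b c" using p q1 q2 unfolding UL_def R1_dom_def by auto
    then obtain z2 y2 where r3: "geo_R n b c (y1, z1) = Some (z2, y2)" "R_rel n b c (y1, z1) (z2, y2)" by (rule R_relE_dom[OF _ b c])
    have q3: "geo_R1 n b c (y1, z1, x2) = Some (z2, y2, x2)" using r3 by (simp add: geo_R1_def)
    have "(y, z) \<in> R_dom n b c" using p unfolding pe UR_def R2_dom_def by auto
    then obtain z3 y3 where t1: "geo_R n b c (y, z) = Some (z3, y3)" "R_rel n b c (y, z) (z3, y3)" by (rule R_relE_dom[OF _ b c])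
    have s1: "geo_R2 n b c p = Some (x, z3, y3)" using t1 by (simp add: pe geo_R2_def)
    have "(x, z3) \<in> R_dom n a c" using p s1 unfolding UR_def R1_dom_def by auto
    then obtain z4 x3 where t2: "geo_R n a c (x, z3) = Some (z4, x3)" "R_rel n a c (x, z3) (z4, x3)" by (rule R_relE_dom[OF _ a c])
    have s2: "geo_R1 n a c (x, z3, y3) = Some (z4, x3, y3)" using t2 by (simp add: geo_R1_def)
    have "(x3, y3) \<in> R_dom n a b" using p s1 s2 unfolding UR_def R2_dom_def by auto
    then obtain y4 x4 where t3: "geo_R n a b (x3, y3) = Some (y4, x4)" "R_rel n a b (x3, y3) (y4, x4)" by (rule R_relE_dom[OF _ a b])
    have s3: "geo_R2 n a b (z4, x3, y3) = Some (z4, y4, x4)" using t3 by (simp add: geo_R2_def)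
    from r1(2) obtain A B B1 A1 where m1: "g_of n a x A" "g_of n b y B" "g_of n b y1 B1" "g_of n a x1 A1" "A * B = B1 * A1"
      and n1: "snd y1 = snd y" "snd x1 = snd x" "lam a (snd x) \<noteq> lam b (snd y)" by (rule R_relE)
    from r2(2) obtain A1' C C1 A2 where m2: "g_of n a x1 A1'" "g_of n c z C" "g_of n c z1 C1" "g_of n a x2 A2" "A1' * C = C1 * A2"
      and n2: "snd z1 = snd z" "snd x2 = snd x1" "lam a (snd x1) \<noteq> lam c (snd z)" by (rule R_relE)
    from r3(2) obtain B1' C1' C2 B2 where m3: "g_of n b y1 B1'" "g_of n c z1 C1'" "g_of n c z2 C2" "g_of n b y2 B2" "B1' * C1' = C2 * B2"
      and n3: "snd z2 = snd z1" "snd y2 = snd y1" "lam b (snd y1) \<noteq> lam c (snd z1)" by (rule R_relE)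
    from t1(2) obtain B' C' C3 B3 where m4: "g_of n b y B'" "g_of n c z C'" "g_of n c z3 C3" "g_of n b y3 B3" "B' * C' = C3 * B3"
      and n4: "snd z3 = snd z" "snd y3 = snd y" by (rule R_relE)
    from t2(2) obtain A' C3' C4 A3 where m5: "g_of n a x A'" "g_of n c z3 C3'" "g_of n c z4 C4" "g_of n a x3 A3" "A' * C3' = C4 * A3"
      and n5: "snd z4 = snd z3" "snd x3 = snd x" by (rule R_relE)
    from t3(2) obtain A3' B3' B4 A4 where m6: "g_of n a x3 A3'" "g_of n b y3 B3'" "g_of n b y4 B4" "g_of n a x4 A4" "A3' * B3' = B4 * A4"
      and n6: "snd y4 = snd y3" "snd x4 = snd x3" by (rule R_relE)
    have same: "A1' = A1" "B1' = B1" "C1' = C1" "B' = B" "C' = C" "A' = A" "C3' = C3" "A3' = A3" "B3' = B3"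
      using g_of_unique[OF a m2(1) m1(4)] g_of_unique[OF b m3(1) m1(3)] g_of_unique[OF c m3(2) m2(3)]
        g_of_unique[OF b m4(1) m1(2)] g_of_unique[OF c m4(2) m2(2)] g_of_unique[OF a m5(1) m1(1)]
        g_of_unique[OF c m5(2) m4(3)] g_of_unique[OF a m6(1) m5(4)] g_of_unique[OF b m6(2) m4(4)] by auto
    note gC = m1(1-4)[THEN g_of_carrier] m2(2-4)[THEN g_of_carrier] m3(3,4)[THEN g_of_carrier]
      m4(3,4)[THEN g_of_carrier] m5(3,4)[THEN g_of_carrier] m6(3,4)[THEN g_of_carrier]
    note as = assoc_mult_mat[of _ n n _ n _ n]
    have left: "A * (B * C) = C2 * (B2 * A2)"
    proof -
      have "A * (B * C) = (A * B) * C" using gC by (simp add: as)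
      also have "\<dots> = B1 * (A1 * C)" unfolding m1(5) using gC by (simp add: as)
      also have "\<dots> = B1 * (C1 * A2)" using m2(5) unfolding same by simp
      also have "\<dots> = (B1 * C1) * A2" using gC by (simp add: as)
      also have "\<dots> = C2 * (B2 * A2)" using m3(5) gC unfolding same by (simp add: as)
      finally show ?thesis .
    qed
    have right: "A * (B * C) = C4 * (B4 * A4)"
    proof -
      have "A * (B * C) = A * (C3 * B3)" using m4(5) unfolding same by simp
      also have "\<dots> = (A * C3) * B3" using gC by (simp add: as)
      also have "\<dots> = C4 * (A3 * B3)" using m5(5) gC unfolding same by (simp add: as)
      also have "\<dots> = C4 * (B4 * A4)" using m6(5) unfolding same by simp
      finally show ?thesis .
    qed
    have "z2 = z4 \<and> y2 = y4 \<and> x2 = x4"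
      using triple_factorisation_unique[OF a b c m3(3) m3(4) m2(4) m5(3) m6(3) m6(4) _ _ _ _ _ _ trans[OF left[symmetric] right]]
        n1 n2 n3 n4 n5 n6 left right by auto
    then show "\<exists>q. (geo_R1 n b c \<circ>\<^sub>m geo_R2 n a c \<circ>\<^sub>m geo_R1 n a b) p = Some q \<and>
        (geo_R2 n a b \<circ>\<^sub>m geo_R1 n a c \<circ>\<^sub>m geo_R2 n b c) p = Some q"
      using q1 q2 q3 s1 s2 s3 by (simp add: map_comp_def)
  qed
qed

theorem theorem5p10:
  fixes n k1 k2 k3 :: nat
  assumes "n \<ge> 2"
    and "k1 \<in> {1..n - 1}" and "k2 \<in> {1..n - 1}" and "k3 \<in> {1..n - 1}"
  shows "crystal_isomorphism n
           (XX n k1 \<times>\<^sub>V XX n k2) (X_crystal n k1 \<times>\<^sub>C X_crystal n k2)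
           (XX n k2 \<times>\<^sub>V XX n k1) (X_crystal n k2 \<times>\<^sub>C X_crystal n k1)
           (geo_R n k1 k2) \<and>
    rat_eq (XX n k1 \<times>\<^sub>V XX n k2)
           (geo_R n k1 k2 \<circ>\<^sub>m PR2 n k1 k2) (PR2 n k2 k1 \<circ>\<^sub>m geo_R n k1 k2) \<and>
    rat_eq (XX n k1 \<times>\<^sub>V XX n k2)
           (geo_R n k2 k1 \<circ>\<^sub>m geo_S2 n k1 k2) (geo_S2 n k2 k1 \<circ>\<^sub>m geo_R n k1 k2) \<and>
    rat_eq (XX n k1 \<times>\<^sub>V XX n k2)
           (geo_R n (n - k2) (n - k1) \<circ>\<^sub>m geo_D2 n k1 k2) (geo_D2 n k2 k1 \<circ>\<^sub>m geo_R n k1 k2) \<and>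
    rat_eq (XX n k1 \<times>\<^sub>V XX n k2 \<times>\<^sub>V XX n k3)
           (geo_R1 n k2 k3 \<circ>\<^sub>m geo_R2 n k1 k3 \<circ>\<^sub>m geo_R1 n k1 k2)
           (geo_R2 n k1 k2 \<circ>\<^sub>m geo_R1 n k1 k3 \<circ>\<^sub>m geo_R2 n k2 k3)"
proof (intro conjI)
  have n: "n \<ge> 2" by fact
  have k1: "0 < k1" "k1 < n" and k2: "0 < k2" "k2 < n" and k3: "0 < k3" "k3 < n" using assms by auto
  have d1: "0 < n - k1" "n - k1 < n" and d2: "0 < n - k2" "n - k2 < n" using k1 k2 by auto
  show "crystal_isomorphism n
           (XX n k1 \<times>\<^sub>V XX n k2) (X_crystal n k1 \<times>\<^sub>C X_crystal n k2)
           (XX n k2 \<times>\<^sub>V XX n k1) (X_crystal n k2 \<times>\<^sub>C X_crystal n k1)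
           (geo_R n k1 k2)"
    unfolding crystal_isomorphism_def
    using R_crystal_morphism[OF k1 k2 n] R_crystal_morphism[OF k2 k1 n] R_inverse[OF k1 k2] R_inverse[OF k2 k1] by blast
  show "rat_eq (XX n k1 \<times>\<^sub>V XX n k2)
           (geo_R n k1 k2 \<circ>\<^sub>m PR2 n k1 k2) (PR2 n k2 k1 \<circ>\<^sub>m geo_R n k1 k2)"
  proof (rule rat_eq_on_R_dom[OF k1 k2])
    fix p q assume R: "R_rel n k1 k2 p q"
    show "\<exists>r. (geo_R n k1 k2 \<circ>\<^sub>m PR2 n k1 k2) p = Some r \<and> (PR2 n k2 k1 \<circ>\<^sub>m geo_R n k1 k2) p = Some r"
      using geo_R_eqI[OF R k1 k2] geo_R_eqI[OF R_rel_PR[OF R k1 k2 n] k1 k2]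
      by (intro exI[of _ "map_prod (PR n k2) (PR n k1) q"]) (simp add: map_comp_def PR2_def)
  qed
  show "rat_eq (XX n k1 \<times>\<^sub>V XX n k2)
           (geo_R n k2 k1 \<circ>\<^sub>m geo_S2 n k1 k2) (geo_S2 n k2 k1 \<circ>\<^sub>m geo_R n k1 k2)"
  proof (rule rat_eq_on_R_dom[OF k1 k2])
    fix p q assume R: "R_rel n k1 k2 p q"
    obtain p' q' where "geo_S2 n k1 k2 p = Some p'" "geo_S2 n k2 k1 q = Some q'" "R_rel n k2 k1 p' q'"
      by (rule R_rel_S[OF R k1 k2])
    then show "\<exists>r. (geo_R n k2 k1 \<circ>\<^sub>m geo_S2 n k1 k2) p = Some r \<and> (geo_S2 n k2 k1 \<circ>\<^sub>m geo_R n k1 k2) p = Some r"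
      using geo_R_eqI[OF R k1 k2] geo_R_eqI[OF _ k2 k1] by (intro exI[of _ q']) (simp add: map_comp_def)
  qed
  show "rat_eq (XX n k1 \<times>\<^sub>V XX n k2)
           (geo_R n (n - k2) (n - k1) \<circ>\<^sub>m geo_D2 n k1 k2) (geo_D2 n k2 k1 \<circ>\<^sub>m geo_R n k1 k2)"
  proof (rule rat_eq_on_R_dom[OF k1 k2])
    fix p q assume R: "R_rel n k1 k2 p q"
    obtain p' q' where "geo_D2 n k1 k2 p = Some p'" "geo_D2 n k2 k1 q = Some q'" "R_rel n (n - k2) (n - k1) p' q'"
      by (rule R_rel_D[OF R k1 k2])
    then show "\<exists>r. (geo_R n (n - k2) (n - k1) \<circ>\<^sub>m geo_D2 n k1 k2) p = Some r \<and> (geo_D2 n k2 k1 \<circ>\<^sub>m geo_R n k1 k2) p = Some r"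
      using geo_R_eqI[OF R k1 k2] geo_R_eqI[OF _ d2 d1] by (intro exI[of _ q']) (simp add: map_comp_def)
  qed
  show "rat_eq (XX n k1 \<times>\<^sub>V XX n k2 \<times>\<^sub>V XX n k3)
           (geo_R1 n k2 k3 \<circ>\<^sub>m geo_R2 n k1 k3 \<circ>\<^sub>m geo_R1 n k1 k2)
           (geo_R2 n k1 k2 \<circ>\<^sub>m geo_R1 n k1 k3 \<circ>\<^sub>m geo_R2 n k2 k3)"
    by (rule yang_baxter[OF k1 k2 k3])
qed

end
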